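(* Let $\{P_\theta:\theta\in\Theta\}$ be a parametric family with univariate parameter $\theta\in\Theta$, with densities $p(x;\theta)$, score $s(x;\theta)=\frac{\partial}{\partial\theta}\log p(x;\theta)$ and Fisher information $\mathcal{I}(\theta)$. Let $\hat\theta_0$ be an initial value and let $(X_n)_{n\ge1}$ be sampled inductively, for $n\ge1$, by $$X_n\mid\mathcal{G}_{n-1}\sim P_{\hat\theta_{n-1}},\qquad \hat\theta_n=\hat\theta_{n-1}+\eta_n Z(X_n,\hat\theta_{n-1}),\qquad Z(x,\theta)=\mathcal{I}(\theta)^{-1}s(x;\theta),$$ where $(\eta_n)_{n\ge1}$ is a deterministic sequence of step sizes with $\eta_n\to0$. Assume: (a) $p$ is twice differentiable with respect to $\theta$; (b) $\mathcal{I}(\theta)$ is continuous and there exists $\epsilon>0$ such that $\epsilon<\mathcal{I}(\theta)<\infty$ for all $\theta\in\Theta$; (c) the sequence $(Z(X_n,\hat\theta_{n-1}))_{n\ge1}$ is uniformly integrable; (d) there exists $C<\infty$ such that $\int p''(x;\theta)\,dx<C$ for all $\theta\in\Theta$, where $p''$ is the second derivative of $p$ with respect to $\theta$; and $\sum_{n=1}^\infty\eta_n^2<\infty$. Then: (i) $(X_n)_{n\ge1}$ is $(\xi_n)_{n\ge0}$-a.c.i.d. with respect to $(\mathcal{G}_n)_{n\ge0}$, with $\xi_n:=C\,\dfrac{\eta_{n+1}^2}{2\,\mathcal{I}(\hat\theta_n)}$, where $C$ is the constant in (d); (ii) $\sum_{n=0}^\infty\xi_n<\infty$ almost surely; (iii)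 $(X_n)_{n\ge1}$ is asymptotically exchangeable.
   Context: $\mathcal{G}_n=\sigma(X_1,\ldots,X_n)$ is the natural filtration, with $\mathcal{G}_0$ trivial. The observations take values in a Euclidean space with its Borel sets; $P_\theta$ has density $p(\cdot;\theta)$ (or probability mass function in the discrete case, integrals then being read as sums). $\mathcal{I}(\theta)=\mathbb{E}[s(X;\theta)^2]$ for $X\sim P_\theta$. Definition (a.c.i.d., almost conditionally identically distributed). Let $(\xi_n)_{n\ge0}$ be a sequence of $\mathcal{G}$-adapted non-negative random variables. The sequence $(X_n)_{n\ge1}$ is $(\xi_n)_{n\ge0}$-a.c.i.d. with respect to $\mathcal{G}=(\mathcal{G}_n)_{n\ge0}$ if for every Borel set $A$ and every $n\ge0$, $$\mathbb{E}\big(\mathbb{P}(X_{n+2}\in A\mid\mathcal{G}_{n+1})\mid\mathcal{G}_n\big)\le \mathbb{P}(X_{n+1}\in A\mid\mathcal{G}_n)+\xi_n\quad\text{a.s.}$$ $(X_n)_{n\ge1}$ is asymptotically exchangeable if, as $n\to\infty$, $(X_n,X_{n+1},\ldots)$ converges in distribution to some exchangeable sequence $(Z_1,Z_2,\ldots)$.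
   Formalization: Condition (d) is taken as: p''(·;θ) is integrable and its integral over every Borel set A (not only the whole space) is < C, since (i) fails otherwise, e.g. for N(θ,1) with small C; Θ is taken to be an open interval, since (i) can fail for disconnected Θ. *)

theory Defs
  imports "HOL-Probability.Probability"
begin

section \<open>Filtrations, conditional probabilities, a.c.i.d. sequences\<close>

(* Observations are indexed from 1; the value X 0 is never used. For n = 0 the generating
   family is empty, so this is the trivial sigma-algebra. *)
definition natural_filtration ::
    "'w measure \<Rightarrow> (nat \<Rightarrow> 'w \<Rightarrow> 'a::euclidean_space) \<Rightarrow> nat \<Rightarrow> 'w measure" where
  "natural_filtration M X n =
     sigma (space M) {X i -` A \<inter> space M | i A. i \<in> {1..n} \<and> A \<in> sets borel}"

definition conditional_prob :: "'w measure \<Rightarrow> 'w measure \<Rightarrow> 'w set \<Rightarrow> 'w \<Rightarrow> real" where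
  "conditional_prob M F E = real_cond_exp M F (indicator E)"

definition acid ::
    "'w measure \<Rightarrow> (nat \<Rightarrow> 'w measure) \<Rightarrow> (nat \<Rightarrow> 'w \<Rightarrow> real) \<Rightarrow>
     (nat \<Rightarrow> 'w \<Rightarrow> 'a::euclidean_space) \<Rightarrow> bool" where
  "acid M G \<xi> X \<longleftrightarrow>
     (\<forall>n. \<xi> n \<in> borel_measurable (G n)) \<and>
     (\<forall>n. \<forall>\<omega>\<in>space M. 0 \<le> \<xi> n \<omega>) \<and>
     (\<forall>A\<in>sets borel. \<forall>n. AE \<omega> in M.
        real_cond_exp M (G n)
          (conditional_prob M (G (n + 1)) (X (n + 2) -` A \<inter> space M)) \<omega>
        \<le> conditional_prob M (G n) (X (n + 1) -` A \<inter> space M) \<omega> + \<xi> n \<omega>)"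

section \<open>Asymptotic exchangeability\<close>

definition exchangeable :: "'w measure \<Rightarrow> (nat \<Rightarrow> 'w \<Rightarrow> 'a::euclidean_space) \<Rightarrow> bool" where
  "exchangeable N Z \<longleftrightarrow>
     (\<forall>m \<pi>. \<pi> permutes {..<m} \<longrightarrow>
        distr N borel (\<lambda>\<omega> k. Z (\<pi> k) \<omega>) = distr N borel (\<lambda>\<omega> k. Z k \<omega>))"

definition converges_weakly :: "(nat \<Rightarrow> 'b::topological_space measure) \<Rightarrow> 'b measure \<Rightarrow> bool" where
  "converges_weakly L N \<longleftrightarrow>
     (\<forall>f :: 'b \<Rightarrow> real. continuous_on UNIV f \<and> bounded (range f) \<longrightarrow>
        (\<lambda>n. integral\<^sup>L (L n) f) \<longlonglongrightarrow> integral\<^sup>L N f)"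

(* The type nat => 'a carries the product topology; its Borel sets are the product
   sigma-algebra (sets_PiM_equal_borel). Taking the space of the limit sequence to be one on
   nat => 'a is no restriction, since every sequence has a copy there with the same law
   (the coordinate process). *)
definition asymptotically_exchangeable ::
    "'w measure \<Rightarrow> (nat \<Rightarrow> 'w \<Rightarrow> 'a::euclidean_space) \<Rightarrow> bool" where
  "asymptotically_exchangeable M X \<longleftrightarrow>
     (\<exists>(N :: (nat \<Rightarrow> 'a) measure) (Z :: nat \<Rightarrow> (nat \<Rightarrow> 'a) \<Rightarrow> 'a).
        prob_space N \<and> (\<forall>k. Z k \<in> borel_measurable N) \<and> exchangeable N Z \<and>
        converges_weakly (\<lambda>n. distr M borel (\<lambda>\<omega> k. X (n + k) \<omega>))
                         (distr N borel (\<lambda>\<omega> k. Z k \<omega>)))"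

section \<open>Uniform integrability\<close>

definition uniformly_integrable :: "'w measure \<Rightarrow> ('i \<Rightarrow> 'w \<Rightarrow> real) \<Rightarrow> 'i set \<Rightarrow> bool" where
  "uniformly_integrable M Y I \<longleftrightarrow>
     (\<forall>i\<in>I. integrable M (Y i)) \<and>
     (\<forall>e>0. \<exists>K. \<forall>i\<in>I. (LINT \<omega>:{\<omega>\<in>space M. K < \<bar>Y i \<omega>\<bar>}|M. \<bar>Y i \<omega>\<bar>) < e)"

section \<open>The parametric family\<close>

(* Lebesgue measure (densities), or counting measure on a countable set S seen as a measure
   on the Borel sets (mass functions; integrals are then sums over S). *)
definition reference_measure :: "'a::euclidean_space measure \<Rightarrow> bool" where
  "reference_measure \<mu> \<longleftrightarrow>
     \<mu> = lborel \<or> (\<exists>S. countable S \<and> \<mu> = distr (count_space S) borel (\<lambda>x. x))"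

definition P_law :: "'a::euclidean_space measure \<Rightarrow> ('a \<Rightarrow> real \<Rightarrow> real) \<Rightarrow> real \<Rightarrow> 'a measure" where
  "P_law \<mu> p \<theta> = density \<mu> (\<lambda>x. ennreal (p x \<theta>))"

definition parametric_family ::
    "'a::euclidean_space measure \<Rightarrow> ('a \<Rightarrow> real \<Rightarrow> real) \<Rightarrow> real set \<Rightarrow> bool" where
  "parametric_family \<mu> p \<Theta> \<longleftrightarrow>
     (\<forall>\<theta>\<in>\<Theta>. (\<lambda>x. p x \<theta>) \<in> borel_measurable borel \<and> (\<forall>x. 0 \<le> p x \<theta>) \<and> prob_space (P_law \<mu> p \<theta>))"

(* Where p x \<theta> = 0 this is a junk value; such x form a null set of P_law \<mu> p \<theta>. *)
definition score :: "('a \<Rightarrow> real \<Rightarrow> real) \<Rightarrow> 'a \<Rightarrow> real \<Rightarrow> real" where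
  "score p x \<theta> = deriv (\<lambda>t. ln (p x t)) \<theta>"

definition fisher ::
    "'a::euclidean_space measure \<Rightarrow> ('a \<Rightarrow> real \<Rightarrow> real) \<Rightarrow> real \<Rightarrow> real" where
  "fisher \<mu> p \<theta> = (LINT x|P_law \<mu> p \<theta>. (score p x \<theta>)\<^sup>2)"

definition score_step ::
    "'a::euclidean_space measure \<Rightarrow> ('a \<Rightarrow> real \<Rightarrow> real) \<Rightarrow> 'a \<Rightarrow> real \<Rightarrow> real" where
  "score_step \<mu> p x \<theta> = inverse (fisher \<mu> p \<theta>) * score p x \<theta>"

primrec theta_hat ::
    "'a::euclidean_space measure \<Rightarrow> ('a \<Rightarrow> real \<Rightarrow> real) \<Rightarrow> (nat \<Rightarrow> real) \<Rightarrow> real \<Rightarrow>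
     (nat \<Rightarrow> 'w \<Rightarrow> 'a) \<Rightarrow> nat \<Rightarrow> 'w \<Rightarrow> real" where
  "theta_hat \<mu> p \<eta> \<theta>0 X 0 \<omega> = \<theta>0"
| "theta_hat \<mu> p \<eta> \<theta>0 X (Suc n) \<omega> =
     theta_hat \<mu> p \<eta> \<theta>0 X n \<omega> +
     \<eta> (Suc n) * score_step \<mu> p (X (Suc n) \<omega>) (theta_hat \<mu> p \<eta> \<theta>0 X n \<omega>)"

definition recursively_sampled ::
    "'w measure \<Rightarrow> 'a::euclidean_space measure \<Rightarrow> ('a \<Rightarrow> real \<Rightarrow> real) \<Rightarrow> real set \<Rightarrow>
     (nat \<Rightarrow> real) \<Rightarrow> real \<Rightarrow> (nat \<Rightarrow> 'w \<Rightarrow> 'a) \<Rightarrow> bool" where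
  "recursively_sampled M \<mu> p \<Theta> \<eta> \<theta>0 X \<longleftrightarrow>
     (\<forall>n\<ge>1. X n \<in> borel_measurable M) \<and>
     (\<forall>n. \<forall>\<omega>\<in>space M. theta_hat \<mu> p \<eta> \<theta>0 X n \<omega> \<in> \<Theta>) \<and>
     (\<forall>n\<ge>1. \<forall>A\<in>sets borel. AE \<omega> in M.
        conditional_prob M (natural_filtration M X (n - 1)) (X n -` A \<inter> space M) \<omega>
        = measure (P_law \<mu> p (theta_hat \<mu> p \<eta> \<theta>0 X (n - 1) \<omega>)) A)"

end

theory Submission
  imports Defs
begin

text \<open>
  Write \<open>F A t\<close> for the probability of \<open>A\<close> under the law with parameter \<open>t\<close>, and \<open>I\<close> for the
  Fisher information. Everything rests on the inequality (lemma \<open>measure_upper_bound\<close>)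
  \<open>F A (t + h) \<le> F A t + h * (\<integral> p' over A) + C * h^2 / 2\<close>.
  Pointwise in the observation, the Taylor remainder of the density is at most the integral of the
  positive part of \<open>p''\<close> along the segment from \<open>t\<close> to \<open>t + h\<close>. Tonelli's theorem exchanges this with
  the integral over observations, and for each parameter the positive part of \<open>p''\<close> has integral
  below \<open>C\<close>, because it is the integral of \<open>p''\<close> over the set where \<open>p''\<close> is positive.

  With the whole space for \<open>A\<close> and small \<open>h\<close> of both signs, the inequality forces the integral of
  \<open>p'\<close> to vanish: the score is centred. If the inequality is averaged over a step
  \<open>h = \<eta> * Z\<close> of the recursion, the linear term disappears, and since \<open>Z\<close> has second moment \<open>1 / I\<close> the
  quadratic term becomes \<open>C * \<eta>^2 / (2 * I)\<close>. This is the a.c.i.d. property, and \<open>I > \<epsilon>\<close> makes the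
  slacks summable.

  For asymptotic exchangeability, apply the inequality to complements as well. It becomes two-sided,
  and together with \<open>0 \<le> F A \<le> 1\<close> it makes \<open>F A\<close> Lipschitz with a constant independent of \<open>A\<close>
  (\<open>measure_lipschitz\<close>). Hence the laws extend to the closure of \<open>\<Theta>\<close>, Lipschitz in total variation
  (\<open>lipschitz_family_extends_to_closure\<close>); the closure matters because the parameter estimates may
  converge to an end point of \<open>\<Theta>\<close>. The estimates form a martingale whose increments have second
  moments at most \<open>\<eta>^2 / \<epsilon>\<close>, so they converge in \<open>L\<^sup>1\<close>, and the probabilities \<open>F A\<close> at the estimates
  converge in \<open>L\<^sup>1\<close> to those of a random limit law (\<open>limit_kernel\<close>). Conditioning on the past one
  observation at a time, the law of a block of \<open>k\<close> successive observations converges on rectangles to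
  the mixture of the \<open>k\<close>-fold products of the limit law (\<open>block_converges\<close>). A mixture of i.i.d.
  sequences is exchangeable, and convergence on cylinders implies weak convergence in the product
  topology (\<open>converges_weakly_of_cylinders\<close>).
\<close>

section \<open>One-sided Taylor bounds and joint measurability\<close>

lemma segment_in_interval:
  fixes S :: "real set"
  assumes "is_interval S" "a \<in> S" "a + h \<in> S" "s \<in> {0..1}"
  shows "a + s * h \<in> S"
proof -
  have "convex S" using assms(1) by (simp add: is_interval_convex)
  then have "(1 - s) *\<^sub>R a + s *\<^sub>R (a + h) \<in> S"
    using assms(2-4) by (intro convexD) auto
  then show ?thesis by (simp add: algebra_simps)
qed

text \<open>
  Taylor's formula with integral remainder holds for the Henstock-Kurzweil integral as soon as \<open>f\<close> is
  twice differentiable everywhere, although the second derivative may fail to be Lebesgue integrable.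
  Bounding the remainder by the positive part of its integrand gives a Lebesgue integral again:
  \<open>ennreal\<close> sends negative values to \<open>0\<close>, and the bound is trivial if the right-hand side is infinite.
\<close>
lemma taylor_upper_bound:
  fixes f :: "real \<Rightarrow> real"
  assumes "is_interval S" "a \<in> S" "a + h \<in> S"
    and diff: "\<And>t. t \<in> S \<Longrightarrow> f differentiable (at t) \<and> deriv f differentiable (at t)"
    and meas: "(\<lambda>s. indicator {0..1} s * deriv (deriv f) (a + s * h)) \<in> borel_measurable borel"
  shows "ennreal (f (a + h) - f a - h * deriv f a)
    \<le> (\<integral>\<^sup>+s. ennreal (indicator {0..1} s * ((1 - s) * h\<^sup>2 * deriv (deriv f) (a + s * h))) \<partial>lborel)"
    (is "_ \<le> ?R")
proof (cases "?R = \<infinity>")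
  case False
  define \<phi> where "\<phi> s = indicator {0..1} s * ((1 - s) * h\<^sup>2 * deriv (deriv f) (a + s * h))" for s
  have \<phi>_meas [measurable]: "\<phi> \<in> borel_measurable borel"
  proof -
    have "\<phi> = (\<lambda>s. (1 - s) * h\<^sup>2 * (indicator {0..1} s * deriv (deriv f) (a + s * h)))"
      by (auto simp: \<phi>_def)
    then show ?thesis using meas by simp
  qed
  define I where "I = enn2real ?R"
  have R: "?R = ennreal I"
    using False unfolding I_def by (simp add: less_top)
  have "((\<lambda>s. max 0 (\<phi> s)) has_integral I) UNIV"
  proof (rule nn_integral_has_integral)
    show "(\<integral>\<^sup>+s. ennreal (max 0 (\<phi> s)) \<partial>lborel) = ennreal I"
      unfolding R[symmetric] \<phi>_def by simp
  qed (auto simp: I_def)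
  then have I: "((\<lambda>s. max 0 (\<phi> s)) has_integral I) {0..1}"
    by (subst has_integral_restrict_UNIV[symmetric], elim has_integral_eq[rotated])
       (auto simp: \<phi>_def)
  note in_S = segment_in_interval[OF assms(1-3)]
  \<comment> \<open>the primitive is \<open>s \<mapsto> f (a + s * h) + (1 - s) * h * f' (a + s * h)\<close>\<close>
  have "((\<lambda>s. (1 - s) * h\<^sup>2 * deriv (deriv f) (a + s * h)) has_integral
      (f (a + 1 * h) + (1 - 1) * h * deriv f (a + 1 * h)) - (f (a + 0 * h) + (1 - 0) * h * deriv f (a + 0 * h))) {0..1}"
  proof (rule fundamental_theorem_of_calculus)
    fix s :: real assume s: "s \<in> {0..1}"
    have f': "(f has_real_derivative deriv f (a + s * h)) (at (a + s * h))"
      "(deriv f has_real_derivative deriv (deriv f) (a + s * h)) (at (a + s * h))"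
      using diff[OF in_S[OF s]] by (auto simp: DERIV_deriv_iff_real_differentiable)
    have lin: "((\<lambda>s. a + s * h) has_real_derivative h) (at s within {0..1})"
      by (auto intro!: derivative_eq_intros)
    have 1: "((\<lambda>s. f (a + s * h)) has_real_derivative deriv f (a + s * h) * h) (at s within {0..1})"
      by (rule DERIV_chain2[OF _ lin]) (rule f')
    have 2: "((\<lambda>s. deriv f (a + s * h)) has_real_derivative deriv (deriv f) (a + s * h) * h) (at s within {0..1})"
      by (rule DERIV_chain2[OF _ lin]) (rule f')
    have 3: "((\<lambda>s. (1 - s) * h) has_real_derivative - h) (at s within {0..1})"
      by (auto intro!: derivative_eq_intros)
    show "((\<lambda>s. f (a + s * h) + (1 - s) * h * deriv f (a + s * h)) has_vector_derivative
        (1 - s) * h\<^sup>2 * deriv (deriv f) (a + s * h)) (at s within {0..1})"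
      unfolding has_real_derivative_iff_has_vector_derivative[symmetric]
      using DERIV_add[OF 1 DERIV_mult[OF 3 2]]
      by (rule DERIV_cong) (simp add: algebra_simps power2_eq_square)
  qed simp
  then have "((\<lambda>s. (1 - s) * h\<^sup>2 * deriv (deriv f) (a + s * h)) has_integral
      (f (a + h) - f a - h * deriv f a)) {0..1}"
    by (simp add: diff_diff_eq)
  then have "(\<phi> has_integral (f (a + h) - f a - h * deriv f a)) {0..1}"
    by (subst has_integral_cong[where g="\<lambda>s. (1 - s) * h\<^sup>2 * deriv (deriv f) (a + s * h)"])
       (simp_all add: \<phi>_def)
  then have "f (a + h) - f a - h * deriv f a \<le> I"
    using I by (rule has_integral_le) auto
  then show ?thesis unfolding R by (rule ennreal_leI)
qed simp

text \<open>
  A function that is measurable in \<open>x\<close> and continuous in \<open>t\<close> is the limit of the functions obtained by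
  rounding \<open>t\<close> down to the grid of mesh \<open>1 / (n + 1)\<close>, and these take \<open>t\<close> through countably many values
  only. The indicator confines the statement to \<open>S\<close>, where the values of \<open>u\<close> are meaningful.
\<close>
lemma joint_measurable_continuous:
  fixes u :: "'a::euclidean_space \<Rightarrow> real \<Rightarrow> real"
  assumes S: "open S"
    and meas: "\<And>t. t \<in> S \<Longrightarrow> (\<lambda>x. u x t) \<in> borel_measurable borel"
    and cont: "\<And>x t. t \<in> S \<Longrightarrow> isCont (u x) t"
  shows "(\<lambda>(x, t). indicator S t * u x t) \<in> borel_measurable (borel \<Otimes>\<^sub>M borel)"
proof -
  define r :: "nat \<Rightarrow> real \<Rightarrow> real" where "r n t = of_int \<lfloor>t * real (Suc n)\<rfloor> / real (Suc n)" for n t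
  define v where "v n z = indicator S (snd z) *
      (if r n (snd z) \<in> S then u (fst z) (r n (snd z)) else 0)" for n and z :: "'a \<times> real"
  have r_lim: "(\<lambda>n. r n t) \<longlonglongrightarrow> t" for t
  proof (rule LIMSEQ_I)
    have bd: "\<bar>r n t - t\<bar> \<le> 1 / real (Suc n)" for n
    proof -
      have "\<bar>of_int \<lfloor>t * real (Suc n)\<rfloor> - t * real (Suc n)\<bar> \<le> 1"
        by linarith
      moreover have "r n t - t = (of_int \<lfloor>t * real (Suc n)\<rfloor> - t * real (Suc n)) / real (Suc n)"
        by (simp add: r_def field_simps)
      ultimately show ?thesis
        by (simp add: divide_right_mono)
    qed
    fix e :: real assume "0 < e"
    then obtain N where "1 / real (Suc N) < e" using nat_approx_posE by blast
    then show "\<exists>no. \<forall>n\<ge>no. norm (r n t - t) < e"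
    proof (intro exI[of _ N] allI impI)
      fix n assume "N \<le> n"
      then have "1 / real (Suc n) \<le> 1 / real (Suc N)" by (simp add: frac_le)
      then show "norm (r n t - t) < e" using bd[of n] \<open>1 / real (Suc N) < e\<close> by simp
    qed
  qed
  have [measurable]: "S \<in> sets borel" using S by simp
  have "v n \<in> borel_measurable (borel \<Otimes>\<^sub>M borel)" for n
  proof -
    define F where "F k z = (if of_int k / real (Suc n) \<in> S then u (fst z) (of_int k / real (Suc n)) else 0)"
      for k :: int and z :: "'a \<times> real"
    have "F k \<in> borel_measurable (borel \<Otimes>\<^sub>M borel)" for k
      unfolding F_def
      using measurable_compose[OF measurable_fst meas, of "of_int k / real (Suc n)" borel]
      by (cases "of_int k / real (Suc n) \<in> S") simp_all
    moreover have "(\<lambda>z::'a \<times> real. \<lfloor>snd z * real (Suc n)\<rfloor>)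
        \<in> measurable (borel \<Otimes>\<^sub>M borel) (count_space UNIV)"
      by (rule measurable_compose[OF _ measurable_real_floor]) measurable
    ultimately have "(\<lambda>z. F \<lfloor>snd z * real (Suc n)\<rfloor> z) \<in> borel_measurable (borel \<Otimes>\<^sub>M borel)"
      by (rule measurable_compose_countable)
    then have [measurable]: "(\<lambda>z. if r n (snd z) \<in> S then u (fst z) (r n (snd z)) else 0)
        \<in> borel_measurable (borel \<Otimes>\<^sub>M borel)"
      unfolding r_def F_def .
    show ?thesis unfolding v_def by measurable
  qed
  moreover have "(\<lambda>n. v n z) \<longlonglongrightarrow> (case z of (x, t) \<Rightarrow> indicator S t * u x t)" for z
  proof (cases "snd z \<in> S")
    case True
    have "eventually (\<lambda>n. r n (snd z) \<in> S) sequentially"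
      by (rule topological_tendstoD[OF r_lim S True])
    then have "eventually (\<lambda>n. v n z = u (fst z) (r n (snd z))) sequentially"
      by eventually_elim (simp add: v_def True)
    moreover have "(\<lambda>n. u (fst z) (r n (snd z))) \<longlonglongrightarrow> u (fst z) (snd z)"
      by (rule isCont_tendsto_compose[OF cont[OF True] r_lim])
    ultimately show ?thesis
      using True by (auto simp: split_beta tendsto_cong)
  qed (simp add: v_def split_beta)
  ultimately show ?thesis
    by (rule borel_measurable_LIMSEQ_metric[where f=v])
qed

text \<open>
  The derivative is the limit of difference quotients with increments \<open>1 / (n + 1)\<close>. This works without
  continuity of the derivative, which makes it applicable to second derivatives.
\<close>
lemma joint_measurable_deriv:
  fixes u :: "'a::euclidean_space \<Rightarrow> real \<Rightarrow> real"
  assumes S: "open S"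
    and meas: "(\<lambda>(x, t). indicator S t * u x t) \<in> borel_measurable (borel \<Otimes>\<^sub>M borel)"
    and diff: "\<And>x t. t \<in> S \<Longrightarrow> u x differentiable (at t)"
  shows "(\<lambda>(x, t). indicator S t * deriv (u x) t) \<in> borel_measurable (borel \<Otimes>\<^sub>M borel)"
proof -
  define w where "w z = (case z of (x, t) \<Rightarrow> indicator S t * u x t)" for z
  define v where "v n z = indicator S (snd z) *
      ((w (fst z, snd z + 1 / real (Suc n)) - w z) / (1 / real (Suc n)))" for n z
  have [measurable]: "w \<in> borel_measurable (borel \<Otimes>\<^sub>M borel)"
    using meas unfolding w_def .
  have [measurable]: "S \<in> sets borel" using S by simp
  have "v n \<in> borel_measurable (borel \<Otimes>\<^sub>M borel)" for n
    unfolding v_def by measurable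
  moreover have "(\<lambda>n. v n z) \<longlonglongrightarrow> (case z of (x, t) \<Rightarrow> indicator S t * deriv (u x) t)" for z
  proof (cases "snd z \<in> S")
    case True
    obtain x t where z: "z = (x, t)" by force
    have lim0: "(\<lambda>n. 1 / real (Suc n)) \<longlonglongrightarrow> 0"
      using LIMSEQ_Suc[OF lim_1_over_n] by simp
    have "(\<lambda>n. t + 1 / real (Suc n)) \<longlonglongrightarrow> t + 0"
      by (intro tendsto_add tendsto_const lim0)
    then have "eventually (\<lambda>n. t + 1 / real (Suc n) \<in> S) sequentially"
      using S True z by (intro topological_tendstoD) auto
    then have "eventually (\<lambda>n. v n z = (u x (t + 1 / real (Suc n)) - u x t) / (1 / real (Suc n))) sequentially"
      by eventually_elim (use True z in \<open>simp add: v_def w_def\<close>)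
    moreover have "(\<lambda>n. (u x (t + 1 / real (Suc n)) - u x t) / (1 / real (Suc n))) \<longlonglongrightarrow> deriv (u x) t"
    proof -
      have "((\<lambda>h. (u x (t + h) - u x t) / h) \<longlongrightarrow> deriv (u x) t) (at 0)"
        using diff[of t x] True z by (simp add: DERIV_deriv_iff_real_differentiable[symmetric] DERIV_def)
      then show ?thesis
        by (rule filterlim_compose) (intro filterlim_atI lim0 always_eventually, simp)
    qed
    ultimately show ?thesis
      using True z by (auto simp: split_beta tendsto_cong)
  qed (simp add: v_def split_beta)
  ultimately show ?thesis
    by (rule borel_measurable_LIMSEQ_metric[where f=v])
qed

section \<open>The parametric family\<close>

lemma ennreal_integral_le_nn_integral:
  assumes "integrable M f"
  shows "ennreal (integral\<^sup>L M f) \<le> (\<integral>\<^sup>+x. ennreal (f x) \<partial>M)"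
proof -
  have "ennreal (integral\<^sup>L M f) \<le> ennreal (integral\<^sup>L M (\<lambda>x. max 0 (f x)))"
    using assms by (intro ennreal_leI integral_mono) auto
  also have "\<dots> = (\<integral>\<^sup>+x. ennreal (max 0 (f x)) \<partial>M)"
    using assms by (intro nn_integral_eq_integral[symmetric]) auto
  finally show ?thesis by simp
qed

text \<open>
  The value of the score where the density vanishes is fixed by the conventions \<open>ln 0 = 0\<close> and
  \<open>deriv f t = (SOME D. False)\<close> for \<open>f\<close> not differentiable at \<open>t\<close>. If \<open>ln \<circ> f\<close> is differentiable at a zero of \<open>f\<close>,
  it is continuous there with value \<open>0\<close>, whereas \<open>ln (f s)\<close> tends to \<open>-\<infinity>\<close> along nonzero values of \<open>f\<close>;
  so \<open>f\<close> vanishes near \<open>t\<close>. Thus the score takes one of two fixed values, which keeps it measurable.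
\<close>
lemma deriv_ln_at_zero:
  fixes f :: "real \<Rightarrow> real"
  assumes cont: "isCont f t" and zero: "f t = 0"
  shows "deriv (\<lambda>s. ln (f s)) t =
    (if eventually (\<lambda>s. f s = 0) (nhds t) then 0 else (SOME D. False))"
proof (cases "eventually (\<lambda>s. f s = 0) (nhds t)")
  case True
  have "eventually (\<lambda>s. ln (f s) = 0) (nhds t)"
    using True by eventually_elim simp
  then have "((\<lambda>s. ln (f s)) has_real_derivative 0) (at t) \<longleftrightarrow> ((\<lambda>s. 0) has_real_derivative 0) (at t)"
    by (intro DERIV_cong_ev) simp_all
  then have "((\<lambda>s. ln (f s)) has_real_derivative 0) (at t)" by simp
  then show ?thesis using True by (simp add: DERIV_imp_deriv)
next
  case False
  have no_deriv: "\<not> ((\<lambda>s. ln (f s)) has_real_derivative D) (at t)" for D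
  proof
    assume "((\<lambda>s. ln (f s)) has_real_derivative D) (at t)"
    then have "isCont (\<lambda>s. ln (f s)) t" by (rule DERIV_isCont)
    then have "((\<lambda>s. ln (f s)) \<longlongrightarrow> 0) (nhds t)"
      using zero tendsto_at_iff_tendsto_nhds[of "\<lambda>s. ln (f s)" t] by (simp add: isCont_def)
    then have "eventually (\<lambda>s. dist (ln (f s)) 0 < 1) (nhds t)"
      by (rule tendstoD) simp
    moreover have "(f \<longlongrightarrow> 0) (nhds t)"
      using cont zero tendsto_at_iff_tendsto_nhds[of f t] by (simp add: isCont_def)
    then have "eventually (\<lambda>s. dist (f s) 0 < exp (-1)) (nhds t)"
      by (rule tendstoD) simp
    ultimately have "eventually (\<lambda>s. f s = 0) (nhds t)"
    proof eventually_elim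
      case (elim s)
      show "f s = 0"
      proof (rule ccontr)
        assume "f s \<noteq> 0"
        then have "exp (ln (f s)) < exp (-1)"
          using elim(2) by (simp add: exp_ln_abs)
        then show False using elim(1) by simp
      qed
    qed
    then show False using False by simp
  qed
  then show ?thesis using False by (simp add: deriv_def)
qed

locale score_family =
  fixes \<mu> :: "'a::euclidean_space measure" and p :: "'a \<Rightarrow> real \<Rightarrow> real"
    and \<Theta> :: "real set" and C \<epsilon> :: real
  assumes sigma_finite_mu: "sigma_finite_measure \<mu>"
    and sets_mu [measurable_cong]: "sets \<mu> = sets borel"
    and open_Theta: "open \<Theta>" and interval_Theta: "is_interval \<Theta>"
    and family: "parametric_family \<mu> p \<Theta>"
    and smooth: "\<And>x t. t \<in> \<Theta> \<Longrightarrow> p x differentiable (at t) \<and> deriv (p x) differentiable (at t)"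
    and fisher_cont: "continuous_on \<Theta> (fisher \<mu> p)"
    and eps_pos: "0 < \<epsilon>"
    and fisher_bound: "\<And>t. t \<in> \<Theta> \<Longrightarrow>
      integrable (P_law \<mu> p t) (\<lambda>x. (score p x t)\<^sup>2) \<and> \<epsilon> < fisher \<mu> p t"
    and second_integrable: "\<And>t. t \<in> \<Theta> \<Longrightarrow> integrable \<mu> (\<lambda>x. deriv (deriv (p x)) t)"
    and second_bound: "\<And>t A. t \<in> \<Theta> \<Longrightarrow> A \<in> sets borel \<Longrightarrow>
      (LINT x:A|\<mu>. deriv (deriv (p x)) t) < C"
begin

sublocale sigma_finite_measure \<mu> by (rule sigma_finite_mu)

lemma Theta_borel [measurable]: "\<Theta> \<in> sets borel"
  using open_Theta by simp

lemma space_mu [simp]: "space \<mu> = UNIV"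
  using sets_eq_imp_space_eq[OF sets_mu] by simp

lemma p_measurable: "t \<in> \<Theta> \<Longrightarrow> (\<lambda>x. p x t) \<in> borel_measurable borel"
  and p_nonneg: "t \<in> \<Theta> \<Longrightarrow> 0 \<le> p x t"
  and prob_P_law: "t \<in> \<Theta> \<Longrightarrow> prob_space (P_law \<mu> p t)"
  using family by (auto simp: parametric_family_def)

lemma sets_P_law [simp, measurable_cong]: "sets (P_law \<mu> p t) = sets borel"
  by (simp add: P_law_def sets_mu)

lemma space_P_law [simp]: "space (P_law \<mu> p t) = UNIV"
  by (simp add: P_law_def)

lemma p_joint: "(\<lambda>(x, t). indicator \<Theta> t * p x t) \<in> borel_measurable (borel \<Otimes>\<^sub>M borel)"
  using p_measurable smooth
  by (intro joint_measurable_continuous open_Theta) (auto intro: differentiable_imp_continuous_within)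

lemma deriv_joint: "(\<lambda>(x, t). indicator \<Theta> t * deriv (p x) t) \<in> borel_measurable (borel \<Otimes>\<^sub>M borel)"
  using smooth by (intro joint_measurable_deriv open_Theta p_joint) auto

lemma second_deriv_joint:
  "(\<lambda>(x, t). indicator \<Theta> t * deriv (deriv (p x)) t) \<in> borel_measurable (borel \<Otimes>\<^sub>M borel)"
  using smooth by (intro joint_measurable_deriv open_Theta deriv_joint) auto

lemma measurable_section:
  assumes "(\<lambda>(x, t). indicator \<Theta> t * u x t :: real) \<in> borel_measurable (borel \<Otimes>\<^sub>M borel)" "t \<in> \<Theta>"
  shows "(\<lambda>x. u x t) \<in> borel_measurable borel"
proof -
  have "(\<lambda>x. (x, t)) \<in> borel \<rightarrow>\<^sub>M borel \<Otimes>\<^sub>M borel" by simp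
  from measurable_compose[OF this assms(1)] show ?thesis using assms(2) by simp
qed

text \<open>
  A zero of the nonnegative density is an interior minimum in the parameter.
\<close>
lemma deriv_zero:
  assumes "t \<in> \<Theta>" "p x t = 0"
  shows "deriv (p x) t = 0"
proof -
  obtain r where r: "0 < r" "ball t r \<subseteq> \<Theta>"
    using open_Theta assms(1) by (auto simp: open_contains_ball)
  have "(p x has_real_derivative deriv (p x) t) (at t)"
    using smooth[OF assms(1)] by (simp add: DERIV_deriv_iff_real_differentiable)
  then show ?thesis
  proof (rule DERIV_local_min[OF _ r(1)], intro allI impI)
    fix y assume "\<bar>t - y\<bar> < r"
    then have "y \<in> \<Theta>" using r(2) by (auto simp: dist_real_def)
    then show "p x t \<le> p x y" using p_nonneg assms by simp
  qed
qed

lemma score_positive: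
  assumes "t \<in> \<Theta>" "0 < p x t"
  shows "score p x t = deriv (p x) t / p x t"
proof -
  have "(p x has_real_derivative deriv (p x) t) (at t)"
    using smooth[OF assms(1)] by (simp add: DERIV_deriv_iff_real_differentiable)
  then have "((\<lambda>s. ln (p x s)) has_real_derivative (1 / p x t) * deriv (p x) t) (at t)"
    by (intro DERIV_chain2[where f=ln and g="p x"] DERIV_ln_divide assms(2))
  then show ?thesis unfolding score_def by (simp add: DERIV_imp_deriv)
qed

lemma p_times_score: "t \<in> \<Theta> \<Longrightarrow> p x t * score p x t = deriv (p x) t"
  using score_positive[of t x] deriv_zero[of t x] p_nonneg[of t x]
  by (cases "p x t = 0") auto

text \<open>
  The score has to be a Borel function, not just one up to null sets, because the estimates must be
  measurable with respect to the uncompleted natural filtration. Where the density vanishes, the score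
  depends on whether it vanishes for all nearby parameters (lemma \<open>deriv_ln_at_zero\<close>); by continuity it
  is enough to look at rational ones, so this is a measurable condition.
\<close>
lemma score_joint:
  "(\<lambda>(x, t). indicator \<Theta> t * score p x t) \<in> borel_measurable (borel \<Otimes>\<^sub>M borel)"
proof -
  define w where "w z = (case z of (x, t) \<Rightarrow> indicator \<Theta> t * p x t)" for z
  define w' where "w' z = (case z of (x, t) \<Rightarrow> indicator \<Theta> t * deriv (p x) t)" for z
  define vanish where "vanish z \<longleftrightarrow>
      (\<exists>m::nat. \<forall>q::rat. \<bar>of_rat q - snd z\<bar> < 1 / real (Suc m) \<longrightarrow> of_rat q \<in> \<Theta> \<longrightarrow> w (fst z, of_rat q) = 0)"
    for z :: "'a \<times> real"
  have [measurable]: "w \<in> borel_measurable (borel \<Otimes>\<^sub>M borel)"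
    using p_joint unfolding w_def .
  have [measurable]: "w' \<in> borel_measurable (borel \<Otimes>\<^sub>M borel)"
    using deriv_joint unfolding w'_def .
  have [measurable]: "Measurable.pred (borel \<Otimes>\<^sub>M borel) vanish"
    unfolding vanish_def by measurable
  have vanish: "vanish (x, t) \<longleftrightarrow> eventually (\<lambda>s. p x s = 0) (nhds t)" if t: "t \<in> \<Theta>" for x t
  proof
    assume "vanish (x, t)"
    then obtain m where m: "\<And>q::rat. \<bar>of_rat q - t\<bar> < 1 / real (Suc m) \<Longrightarrow> of_rat q \<in> \<Theta> \<Longrightarrow> p x (of_rat q) = 0"
      by (fastforce simp: vanish_def w_def)
    define U where "U = ball t (1 / real (Suc m)) \<inter> \<Theta>"
    have U: "open U" "t \<in> U"
      using open_Theta t by (auto simp: U_def)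
    have "p x s = 0" if s: "s \<in> U" for s
    proof (rule ccontr)
      assume "p x s \<noteq> 0"
      have "isCont (p x) s"
        using smooth[of s x] s by (auto simp: U_def intro: differentiable_imp_continuous_within)
      then have "eventually (\<lambda>y. p x y \<noteq> 0) (nhds s)"
        using \<open>p x s \<noteq> 0\<close>
        by (intro tendsto_imp_eventually_ne[where c="p x s"]) (simp_all add: isCont_def tendsto_at_iff_tendsto_nhds)
      then have "eventually (\<lambda>y. p x y \<noteq> 0 \<and> y \<in> U) (nhds s)"
        using U(1) s by (intro eventually_conj eventually_nhds_in_open) auto
      then obtain V where V: "open V" "s \<in> V" "\<And>y. y \<in> V \<Longrightarrow> p x y \<noteq> 0 \<and> y \<in> U"
        by (auto simp: eventually_nhds)
      obtain e where e: "0 < e" "ball s e \<subseteq> V"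
        using V(1,2) by (auto simp: open_contains_ball)
      obtain q :: rat where q: "s < of_rat q" "of_rat q < s + e"
        using of_rat_dense[of s "s + e"] e(1) by auto
      then have "of_rat q \<in> V" using e(2) by (auto simp: dist_real_def)
      then have "p x (of_rat q) \<noteq> 0" "of_rat q \<in> U" using V(3) by auto
      then show False using m[of q] by (auto simp: U_def dist_real_def abs_minus_commute)
    qed
    then show "eventually (\<lambda>s. p x s = 0) (nhds t)"
      using U by (auto simp: eventually_nhds)
  next
    assume "eventually (\<lambda>s. p x s = 0) (nhds t)"
    then obtain e where e: "0 < e" "\<And>s. dist s t < e \<Longrightarrow> p x s = 0"
      by (auto simp: eventually_nhds_metric)
    obtain m where "1 / real (Suc m) < e" using nat_approx_posE e(1) by blast
    then show "vanish (x, t)"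
      unfolding vanish_def w_def using e(2)
      by (intro exI[of _ m]) (force simp: dist_real_def)
  qed
  have "(\<lambda>(x, t). indicator \<Theta> t * score p x t) =
      (\<lambda>z. indicator \<Theta> (snd z) * (if w z = 0 then if vanish z then 0 else (SOME D. False) else w' z / w z))"
  proof (rule ext)
    fix z :: "'a \<times> real"
    obtain x t where z: "z = (x, t)" by force
    show "(case z of (x, t) \<Rightarrow> indicator \<Theta> t * score p x t) =
      indicator \<Theta> (snd z) * (if w z = 0 then if vanish z then 0 else (SOME D. False) else w' z / w z)"
    proof (cases "t \<in> \<Theta>")
      case True
      have cont: "isCont (p x) t"
        using smooth[OF True, of x] by (auto intro: differentiable_imp_continuous_within)
      then show ?thesis
        using True vanish[OF True, of x] deriv_ln_at_zero[OF cont] score_positive[OF True, of x]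
          p_nonneg[OF True, of x]
        by (auto simp: z w_def w'_def score_def less_le)
    qed (simp add: z)
  qed
  also have "\<dots> \<in> borel_measurable (borel \<Otimes>\<^sub>M borel)"
    by measurable
  finally show ?thesis .
qed

context
  fixes t assumes t: "t \<in> \<Theta>"
begin

lemma p_measurable' [measurable]: "(\<lambda>x. p x t) \<in> borel_measurable borel"
  using p_measurable t .
lemma deriv_measurable [measurable]: "(\<lambda>x. deriv (p x) t) \<in> borel_measurable borel"
  by (rule measurable_section[OF deriv_joint t])
lemma second_deriv_measurable [measurable]: "(\<lambda>x. deriv (deriv (p x)) t) \<in> borel_measurable borel"
  by (rule measurable_section[OF second_deriv_joint t])
lemma score_measurable [measurable]: "(\<lambda>x. score p x t) \<in> borel_measurable borel"
  by (rule measurable_section[OF score_joint t])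

lemma integral_P_law:
  assumes "f \<in> borel_measurable borel"
  shows "integrable (P_law \<mu> p t) f \<longleftrightarrow> integrable \<mu> (\<lambda>x. p x t * f x :: real)"
    "integral\<^sup>L (P_law \<mu> p t) f = (LINT x|\<mu>. p x t * f x)"
proof -
  have [measurable]: "f \<in> borel_measurable \<mu>" using assms by simp
  show "integrable (P_law \<mu> p t) f \<longleftrightarrow> integrable \<mu> (\<lambda>x. p x t * f x :: real)"
    "integral\<^sup>L (P_law \<mu> p t) f = (LINT x|\<mu>. p x t * f x)"
    unfolding P_law_def using p_nonneg[OF t]
    by (subst integrable_density integral_density; simp)+
qed

lemma score_square_integral:
  "integrable (P_law \<mu> p t) (\<lambda>x. (score p x t)\<^sup>2)" 
  "(LINT x|P_law \<mu> p t. (score p x t)\<^sup>2) = fisher \<mu> p t" "0 < fisher \<mu> p t" "\<epsilon> < fisher \<mu> p t"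
  using fisher_bound[OF t] eps_pos by (auto simp: fisher_def)

lemma score_integrable: "integrable (P_law \<mu> p t) (\<lambda>x. score p x t)"
proof -
  interpret P: prob_space "P_law \<mu> p t" by (rule prob_P_law[OF t])
  show ?thesis
    using score_square_integral(1) by (rule P.square_integrable_imp_integrable[rotated]) simp
qed

lemma deriv_integrable: "integrable \<mu> (\<lambda>x. deriv (p x) t)"
  using score_integrable integral_P_law(1)[of "\<lambda>x. score p x t"] p_times_score[OF t] by simp

lemma p_integrable: "integrable \<mu> (\<lambda>x. p x t)"
proof -
  interpret P: prob_space "P_law \<mu> p t" by (rule prob_P_law[OF t])
  show ?thesis using integral_P_law(1)[of "\<lambda>x. 1"] by simp
qed

lemma measure_P_law: 
  assumes A: "A \<in> sets borel" 
  shows "measure (P_law \<mu> p t) A = (LINT x:A|\<mu>. p x t)"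
proof -
  interpret P: prob_space "P_law \<mu> p t" by (rule prob_P_law[OF t])
  have "measure (P_law \<mu> p t) A = (LINT x|P_law \<mu> p t. indicator A x)"
    using A by simp
  also have "\<dots> = (LINT x:A|\<mu>. p x t)"
    using A by (subst integral_P_law) (simp_all add: set_lebesgue_integral_def mult.commute)
  finally show ?thesis .
qed

text \<open>
  The bound on the integral of \<open>p''\<close> over every Borel set is used for the set where \<open>p''\<close> is positive.
\<close>
lemma second_deriv_positive_part: "(\<integral>\<^sup>+x. ennreal (deriv (deriv (p x)) t) \<partial>\<mu>) \<le> ennreal C"
proof -
  define B where "B = {x. 0 < deriv (deriv (p x)) t}"
  have "B = {x \<in> space borel. 0 < deriv (deriv (p x)) t}" by (simp add: B_def)
  also have "\<dots> \<in> sets borel" by measurable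
  finally have B: "B \<in> sets borel" .
  have "(\<integral>\<^sup>+x. ennreal (deriv (deriv (p x)) t) \<partial>\<mu>) =
      (\<integral>\<^sup>+x. ennreal (indicator B x * deriv (deriv (p x)) t) \<partial>\<mu>)"
    by (intro nn_integral_cong) (auto simp: B_def indicator_def ennreal_neg)
  also have "\<dots> = ennreal (LINT x:B|\<mu>. deriv (deriv (p x)) t)"
    unfolding set_lebesgue_integral_def real_scaleR_def
  proof (rule nn_integral_eq_integral)
    show "integrable \<mu> (\<lambda>x. indicator B x * deriv (deriv (p x)) t)"
      using integrable_mult_indicator[OF _ second_integrable[OF t], of B] B by (simp add: sets_mu)
  qed (auto simp: B_def indicator_def)
  also have "\<dots> \<le> ennreal C"
    using second_bound[OF t B] by (intro ennreal_leI) simp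
  finally show ?thesis .
qed

end

lemmas segment_in_Theta = segment_in_interval[OF interval_Theta]

lemma C_pos: "t \<in> \<Theta> \<Longrightarrow> 0 < C"
  using second_bound[of t "{}"] by (simp add: set_lebesgue_integral_def)

text \<open>
  The Taylor bound integrated over \<open>A\<close>. On the remainder, \<open>A\<close> can be enlarged to the whole space
  because only positive parts are involved; Tonelli's theorem then leaves
  \<open>C * h^2\<close> times the integral of \<open>1 - s\<close> over the unit interval.
\<close>
lemma measure_upper_bound:
  assumes t: "t \<in> \<Theta>" and th: "t + h \<in> \<Theta>" and A [measurable]: "A \<in> sets borel"
  shows "measure (P_law \<mu> p (t + h)) A
    \<le> measure (P_law \<mu> p t) A + h * (LINT x:A|\<mu>. deriv (p x) t) + C * h\<^sup>2 / 2"
proof -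
  define g where "g x = p x (t + h) - p x t - h * deriv (p x) t" for x
  define k where "k s = indicator {0..1} s * ((1 - s) * h\<^sup>2)" for s :: real
  define w where "w z = (case z of (x, s) \<Rightarrow> indicator \<Theta> s * deriv (deriv (p x)) s)" for z
  have [measurable]: "w \<in> borel_measurable (borel \<Otimes>\<^sub>M borel)"
    using second_deriv_joint unfolding w_def .
  have k_nonneg: "0 \<le> k s" for s by (auto simp: k_def indicator_def)
  have [measurable]: "k \<in> borel_measurable borel" unfolding k_def by measurable
  have kw: "indicator {0..1} s * ((1 - s) * h\<^sup>2 * deriv (deriv (p x)) (t + s * h)) = k s * w (x, t + s * h)" for x s
    using segment_in_Theta[OF t th, of s] by (auto simp: k_def w_def indicator_def)
  have int_k: "(\<integral>\<^sup>+s. ennreal (k s) \<partial>lborel) = ennreal (h\<^sup>2 / 2)"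
  proof -
    have "(\<integral>\<^sup>+s. ennreal (k s) \<partial>lborel) = (\<integral>\<^sup>+s. ennreal ((1 - s) * h\<^sup>2) * indicator {0..1} s \<partial>lborel)"
      by (intro nn_integral_cong) (auto simp: k_def indicator_def)
    also have "\<dots> = ennreal ((- (1 - 1)\<^sup>2 / 2 * h\<^sup>2) - (- (1 - 0)\<^sup>2 / 2 * h\<^sup>2))"
      by (rule nn_integral_FTC_Icc[where F="\<lambda>s. - (1 - s)\<^sup>2 / 2 * h\<^sup>2"])
         (auto intro!: derivative_eq_intros simp: power2_eq_square field_simps mult_left_le_one_le)
    finally show ?thesis by simp
  qed
  have pointwise: "ennreal (g x) \<le> (\<integral>\<^sup>+s. ennreal (k s * w (x, t + s * h)) \<partial>lborel)" for x
  proof -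
    have "(\<lambda>s. indicator {0..1} s * w (x, t + s * h)) \<in> borel_measurable borel" by measurable
    also have "(\<lambda>s. indicator {0..1} s * w (x, t + s * h)) =
        (\<lambda>s. indicator {0..1} s * deriv (deriv (p x)) (t + s * h))"
      using segment_in_Theta[OF t th] by (auto simp: w_def indicator_def)
    finally have "ennreal (p x (t + h) - p x t - h * deriv (p x) t) \<le>
      (\<integral>\<^sup>+s. ennreal (indicator {0..1} s * ((1 - s) * h\<^sup>2 * deriv (deriv (p x)) (t + s * h))) \<partial>lborel)"
      using smooth by (intro taylor_upper_bound[OF interval_Theta t th]) auto
    then show ?thesis unfolding kw g_def .
  qed
  note [measurable] = p_measurable'[OF t] p_measurable'[OF th] deriv_measurable[OF t]
  have g_int: "integrable \<mu> g"
    unfolding g_def using p_integrable[OF t] p_integrable[OF th] deriv_integrable[OF t] by auto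
  have [measurable]: "A \<in> sets \<mu>" by (simp add: sets_mu)
  have "ennreal (LINT x:A|\<mu>. g x) \<le> (\<integral>\<^sup>+x. ennreal (indicator A x * g x) \<partial>\<mu>)"
    unfolding set_lebesgue_integral_def using integrable_mult_indicator[OF _ g_int, of A]
    by (simp add: ennreal_integral_le_nn_integral)
  also have "\<dots> \<le> (\<integral>\<^sup>+x. (\<integral>\<^sup>+s. ennreal (k s * w (x, t + s * h)) \<partial>lborel) \<partial>\<mu>)"
    by (intro nn_integral_mono) (auto simp: indicator_def pointwise)
  also have "\<dots> = (\<integral>\<^sup>+s. (\<integral>\<^sup>+x. ennreal (k s * w (x, t + s * h)) \<partial>\<mu>) \<partial>lborel)"
  proof -
    interpret pair_sigma_finite lborel \<mu> ..
    show ?thesis by (rule Fubini') measurable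
  qed
  also have "\<dots> \<le> (\<integral>\<^sup>+s. ennreal (k s) * ennreal C \<partial>lborel)"
  proof (intro nn_integral_mono)
    fix s :: real
    show "(\<integral>\<^sup>+x. ennreal (k s * w (x, t + s * h)) \<partial>\<mu>) \<le> ennreal (k s) * ennreal C"
    proof (cases "s \<in> {0..1}")
      case True
      have "(\<integral>\<^sup>+x. ennreal (k s * w (x, t + s * h)) \<partial>\<mu>) = (\<integral>\<^sup>+x. ennreal (k s) * ennreal (w (x, t + s * h)) \<partial>\<mu>)"
        by (simp add: ennreal_mult' k_nonneg)
      also have "\<dots> = ennreal (k s) * (\<integral>\<^sup>+x. ennreal (w (x, t + s * h)) \<partial>\<mu>)"
        by (rule nn_integral_cmult) measurable
      also have "\<dots> \<le> ennreal (k s) * ennreal C"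
        using second_deriv_positive_part[OF segment_in_Theta[OF t th True]] segment_in_Theta[OF t th True]
        by (intro mult_left_mono) (simp_all add: w_def)
      finally show ?thesis .
    qed (simp add: k_def)
  qed
  also have "\<dots> = ennreal (h\<^sup>2 / 2) * ennreal C"
    by (subst nn_integral_multc) (auto simp: int_k)
  also have "\<dots> = ennreal (C * h\<^sup>2 / 2)"
    using C_pos[OF t] by (subst ennreal_mult[symmetric]) (auto simp: mult.commute)
  finally have "(LINT x:A|\<mu>. g x) \<le> C * h\<^sup>2 / 2"
    using C_pos[OF t] by (subst (asm) ennreal_le_iff) auto
  moreover have "(LINT x:A|\<mu>. g x) = measure (P_law \<mu> p (t + h)) A - measure (P_law \<mu> p t) A
      - h * (LINT x:A|\<mu>. deriv (p x) t)"
  proof -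
    have si: "set_integrable \<mu> A f" if "integrable \<mu> f" for f :: "'a \<Rightarrow> real"
      unfolding set_integrable_def by (rule integrable_mult_indicator[OF _ that]) simp
    show ?thesis
      unfolding g_def measure_P_law[OF t A] measure_P_law[OF th A]
      by (subst set_integral_diff, (intro si set_integral_diff set_integral_mult_right; auto intro!: p_integrable[OF t] p_integrable[OF th] deriv_integrable[OF t])+)+
         simp
  qed
  ultimately show ?thesis by simp
qed

text \<open>
  The total mass is constantly \<open>1\<close>, so the upper bound reads \<open>0 \<le> h * d + C * h^2 / 2\<close> for all small \<open>h\<close>
  of either sign, where \<open>d\<close> is the integral of \<open>p'\<close>. This is only possible for \<open>d = 0\<close>.
\<close>
lemma deriv_integral_zero:
  assumes t: "t \<in> \<Theta>"
  shows "(LINT x|\<mu>. deriv (p x) t) = 0"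
proof -
  define d where "d = (LINT x|\<mu>. deriv (p x) t)"
  obtain r where r: "0 < r" "ball t r \<subseteq> \<Theta>"
    using open_Theta t by (auto simp: open_contains_ball)
  have total: "0 \<le> h * d + C * h\<^sup>2 / 2" if "\<bar>h\<bar> < r" for h
  proof -
    have th: "t + h \<in> \<Theta>" using r(2) that by (auto simp: dist_real_def)
    have "measure (P_law \<mu> p s) UNIV = 1" if "s \<in> \<Theta>" for s
      using prob_space.prob_space[OF prob_P_law[OF that]] by simp
    then show ?thesis
      using measure_upper_bound[OF t th, of UNIV] t th by (simp add: d_def set_lebesgue_integral_def)
  qed
  have "\<bar>d\<bar> \<le> 0 + e" if e: "0 < e" for e
  proof -
    define h where "h = min (r / 2) (e / C)"
    have h: "0 < h" "h < r" "C * h \<le> e"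
      using r(1) e C_pos[OF t] by (auto simp: h_def min_def field_simps)
    have "\<bar>h * d\<bar> \<le> C * h\<^sup>2 / 2"
      using total[of h] total[of "-h"] h(1,2) by (simp add: abs_le_iff)
    then have "h * \<bar>d\<bar> \<le> h * (C * h / 2)"
      using h(1) by (simp add: abs_mult power2_eq_square mult.left_commute)
    then have "\<bar>d\<bar> \<le> C * h / 2" using h(1) by simp
    then show ?thesis using h(3) e by linarith
  qed
  then have "\<bar>d\<bar> \<le> 0" by (rule field_le_epsilon)
  then show ?thesis by (simp add: d_def)
qed

text \<open>
  The lower bound is the upper bound for the complement of \<open>A\<close>, since the integrals of \<open>p'\<close> over \<open>A\<close> and
  over its complement add up to \<open>0\<close>.
\<close>
lemma measure_taylor:
  assumes t: "t \<in> \<Theta>" and th: "t + h \<in> \<Theta>" and A: "A \<in> sets borel"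
  shows "\<bar>measure (P_law \<mu> p (t + h)) A - measure (P_law \<mu> p t) A - h * (LINT x:A|\<mu>. deriv (p x) t)\<bar>
    \<le> C * h\<^sup>2 / 2"
proof -
  have compl: "measure (P_law \<mu> p s) (- A) = 1 - measure (P_law \<mu> p s) A" if "s \<in> \<Theta>" for s
    using prob_space.prob_compl[OF prob_P_law[OF that], of A] A by (simp add: Compl_eq_Diff_UNIV)
  have si: "set_integrable \<mu> B (\<lambda>x. deriv (p x) t)" if "B \<in> sets borel" for B
    unfolding set_integrable_def using that
    by (intro integrable_mult_indicator deriv_integrable[OF t]) (simp add: sets_mu)
  have "(LINT x:A|\<mu>. deriv (p x) t) + (LINT x:-A|\<mu>. deriv (p x) t) = (LINT x:A \<union> -A|\<mu>. deriv (p x) t)"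
    using A by (intro set_integral_Un[symmetric] si) auto
  also have "\<dots> = 0"
    using deriv_integral_zero[OF t] by (simp add: set_lebesgue_integral_def)
  finally have D: "(LINT x:-A|\<mu>. deriv (p x) t) = - (LINT x:A|\<mu>. deriv (p x) t)" by simp
  have "1 - measure (P_law \<mu> p (t + h)) A
      \<le> 1 - measure (P_law \<mu> p t) A - h * (LINT x:A|\<mu>. deriv (p x) t) + C * h\<^sup>2 / 2"
    using measure_upper_bound[OF t th, of "- A"] A by (simp add: compl[OF t] compl[OF th] D)
  with measure_upper_bound[OF t th A] show ?thesis
    unfolding abs_le_iff by linarith
qed

text \<open>
  Fix a radius \<open>r\<close> and a centre \<open>c\<close> with \<open>[c - r, c + r]\<close> inside \<open>\<Theta>\<close>. From any \<open>t\<close> in the interval \<open>\<Theta>\<close> one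
  can move by \<open>r\<close> towards \<open>c\<close> without leaving it. The probability of \<open>A\<close> changes by at most \<open>1\<close> on the way,
  so by \<open>measure_taylor\<close> its slope at \<open>t\<close> is at most \<open>K = (1 + C * r^2 / 2) / r\<close>, whatever \<open>A\<close> is.
\<close>
lemma measure_lipschitz:
  "\<exists>L. \<forall>t\<in>\<Theta>. \<forall>u\<in>\<Theta>. \<forall>A\<in>sets borel.
    \<bar>measure (P_law \<mu> p t) A - measure (P_law \<mu> p u) A\<bar> \<le> L * \<bar>t - u\<bar>"
proof (cases "\<Theta> = {}")
  case False
  then obtain c where c: "c \<in> \<Theta>" by auto
  obtain r where r: "0 < r" "cball c r \<subseteq> \<Theta>"
    using open_Theta c by (auto simp: open_contains_cball)
  define K where "K = (1 + C * r\<^sup>2 / 2) / r"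
  have Cp: "0 < C" using C_pos[OF c] .
  have le1: "measure (P_law \<mu> p t) A \<in> {0..1}" if "t \<in> \<Theta>" for t A
    using prob_space.prob_le_1[OF prob_P_law[OF that]] by simp
  have D: "\<bar>LINT x:A|\<mu>. deriv (p x) t\<bar> \<le> K" if t: "t \<in> \<Theta>" and A: "A \<in> sets borel" for t A
  proof -
    define h where "h = (if c \<le> t then - r else r)"
    have "c - r \<in> \<Theta>" "c + r \<in> \<Theta>" using r by (auto simp: dist_real_def)
    then have th: "t + h \<in> \<Theta>"
      using interval_Theta t r(1) unfolding is_interval_1 h_def
      by (smt (verit))
    have "\<bar>h * (LINT x:A|\<mu>. deriv (p x) t)\<bar> \<le> 1 + C * h\<^sup>2 / 2"
      using measure_taylor[OF t th A] le1[OF t, of A] le1[OF th, of A]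
      unfolding atLeastAtMost_iff by linarith
    then have "r * \<bar>LINT x:A|\<mu>. deriv (p x) t\<bar> \<le> 1 + C * r\<^sup>2 / 2"
      using r(1) by (simp add: abs_mult h_def split: if_splits)
    then show ?thesis using r(1) by (simp add: K_def field_simps)
  qed
  have K: "0 < K" using r(1) Cp by (auto simp: K_def intro!: divide_pos_pos add_pos_nonneg)
  show ?thesis
  proof (intro exI[of _ "1 + K + C"] ballI)
    fix t u A assume t: "t \<in> \<Theta>" and u: "u \<in> \<Theta>" and A: "A \<in> sets (borel :: 'a measure)"
    \<comment> \<open>the summand \<open>1\<close> of the constant takes care of parameters at distance more than \<open>1\<close>\<close>
    show "\<bar>measure (P_law \<mu> p t) A - measure (P_law \<mu> p u) A\<bar> \<le> (1 + K + C) * \<bar>t - u\<bar>"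
    proof (cases "\<bar>t - u\<bar> \<le> 1")
      case True
      have "\<bar>t - u\<bar> * \<bar>t - u\<bar> \<le> 1 * \<bar>t - u\<bar>" by (rule mult_right_mono[OF True]) simp
      then have sq: "(t - u)\<^sup>2 \<le> \<bar>t - u\<bar>" by (simp add: power2_eq_square)
      have "\<bar>measure (P_law \<mu> p t) A - measure (P_law \<mu> p u) A\<bar>
          \<le> \<bar>(t - u) * (LINT x:A|\<mu>. deriv (p x) u)\<bar> + C * (t - u)\<^sup>2 / 2"
      proof -
        have "u + (t - u) = t" by simp
        from measure_taylor[OF u, of "t - u" A, unfolded this] t A show ?thesis by linarith
      qed
      also have "\<dots> \<le> \<bar>t - u\<bar> * K + C * \<bar>t - u\<bar>"
      proof (rule add_mono)
        show "\<bar>(t - u) * (LINT x:A|\<mu>. deriv (p x) u)\<bar> \<le> \<bar>t - u\<bar> * K"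
          unfolding abs_mult by (intro mult_left_mono D[OF u A]) simp
        have "C * (t - u)\<^sup>2 \<le> C * \<bar>t - u\<bar>"
          using sq Cp by (intro mult_left_mono) auto
        then show "C * (t - u)\<^sup>2 / 2 \<le> C * \<bar>t - u\<bar>"
          using Cp by (smt (verit) divide_right_mono field_sum_of_halves mult_nonneg_nonneg abs_ge_zero)
      qed
      also have "\<dots> \<le> (1 + K + C) * \<bar>t - u\<bar>" by (simp add: algebra_simps)
      finally show ?thesis .
    next
      case False
      then have "1 * 1 \<le> (1 + K + C) * \<bar>t - u\<bar>"
        using K Cp by (intro mult_mono) auto
      then show ?thesis using le1[OF t, of A] le1[OF u, of A]
        unfolding atLeastAtMost_iff by linarith
    qed
  qed
qed auto

lemma score_step_moments:
  assumes t: "t \<in> \<Theta>"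
  shows "integrable (P_law \<mu> p t) (\<lambda>x. score_step \<mu> p x t)"
    "(LINT x|P_law \<mu> p t. score_step \<mu> p x t) = 0"
    "integrable (P_law \<mu> p t) (\<lambda>x. (score_step \<mu> p x t)\<^sup>2)"
    "(LINT x|P_law \<mu> p t. (score_step \<mu> p x t)\<^sup>2) = 1 / fisher \<mu> p t"
proof -
  note [measurable] = score_measurable[OF t]
  have "(LINT x|P_law \<mu> p t. score p x t) = 0"
    using deriv_integral_zero[OF t] p_times_score[OF t] by (simp add: integral_P_law[OF t])
  then show "integrable (P_law \<mu> p t) (\<lambda>x. score_step \<mu> p x t)"
    "(LINT x|P_law \<mu> p t. score_step \<mu> p x t) = 0"
    unfolding score_step_def using score_integrable[OF t] by auto
  show "integrable (P_law \<mu> p t) (\<lambda>x. (score_step \<mu> p x t)\<^sup>2)"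
    "(LINT x|P_law \<mu> p t. (score_step \<mu> p x t)\<^sup>2) = 1 / fisher \<mu> p t"
    unfolding score_step_def power_mult_distrib
    using score_square_integral[OF t] by (auto simp: power2_eq_square field_simps)
qed

lemma mean_square_step:
  assumes t: "t \<in> \<Theta>"
  shows "(\<integral>\<^sup>+x. ennreal ((c + e * score_step \<mu> p x t)\<^sup>2) \<partial>P_law \<mu> p t)
    = ennreal (c\<^sup>2 + e\<^sup>2 / fisher \<mu> p t)"
proof -
  interpret P: prob_space "P_law \<mu> p t" by (rule prob_P_law[OF t])
  have eq: "(c + e * score_step \<mu> p x t)\<^sup>2 =
      c\<^sup>2 + 2 * c * e * score_step \<mu> p x t + e\<^sup>2 * (score_step \<mu> p x t)\<^sup>2" for x
    by (simp add: power2_eq_square algebra_simps)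
  note mom = score_step_moments[OF t]
  have "(\<integral>\<^sup>+x. ennreal ((c + e * score_step \<mu> p x t)\<^sup>2) \<partial>P_law \<mu> p t) =
      ennreal (LINT x|P_law \<mu> p t. (c + e * score_step \<mu> p x t)\<^sup>2)"
  proof (rule nn_integral_eq_integral)
    show "integrable (P_law \<mu> p t) (\<lambda>x. (c + e * score_step \<mu> p x t)\<^sup>2)"
      unfolding eq using mom by auto
  qed simp
  also have "(LINT x|P_law \<mu> p t. (c + e * score_step \<mu> p x t)\<^sup>2) = c\<^sup>2 + e\<^sup>2 / fisher \<mu> p t"
    unfolding eq using mom P.prob_space by simp
  finally show ?thesis .
qed

text \<open>
  The key inequality averaged over one step: the score step is centred with second moment
  \<open>1 / fisher \<mu> p t\<close>. The function \<open>f\<close> stands for the probability of \<open>A\<close> after the step and is constrained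
  only where the step stays in \<open>\<Theta>\<close>, so that any measurable extension can be used.
\<close>
lemma mean_measure_after_step:
  assumes t: "t \<in> \<Theta>" and A: "A \<in> sets borel"
    and inside: "AE x in P_law \<mu> p t. t + e * score_step \<mu> p x t \<in> \<Theta>"
    and meas: "f \<in> borel_measurable borel"
    and f: "\<And>x. t + e * score_step \<mu> p x t \<in> \<Theta> \<Longrightarrow> f x = measure (P_law \<mu> p (t + e * score_step \<mu> p x t)) A"
  shows "(LINT x|P_law \<mu> p t. f x) \<le> measure (P_law \<mu> p t) A + C * (e\<^sup>2 / (2 * fisher \<mu> p t))"
proof -
  interpret P: prob_space "P_law \<mu> p t" by (rule prob_P_law[OF t])
  define d where "d = (LINT x:A|\<mu>. deriv (p x) t)"
  let ?g = "\<lambda>x. measure (P_law \<mu> p t) A + e * d * score_step \<mu> p x t + C * e\<^sup>2 / 2 * (score_step \<mu> p x t)\<^sup>2"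
  note mom = score_step_moments[OF t]
  have int_f: "integrable (P_law \<mu> p t) f"
  proof (rule P.integrable_const_bound[where B=1])
    show "AE x in P_law \<mu> p t. norm (f x) \<le> 1"
      using inside
    proof eventually_elim
      case (elim x)
      then show ?case
        using prob_space.prob_le_1[OF prob_P_law] f by simp
    qed
  qed (use meas in simp)
  have "(LINT x|P_law \<mu> p t. f x) \<le> (LINT x|P_law \<mu> p t. ?g x)"
  proof (rule integral_mono_AE[OF int_f])
    show "integrable (P_law \<mu> p t) ?g" using mom by auto
    show "AE x in P_law \<mu> p t. f x \<le> ?g x"
      using inside
    proof eventually_elim
      case (elim x)
      then show ?case
        using measure_upper_bound[OF t elim A] f[OF elim]
        by (simp add: d_def power_mult_distrib algebra_simps)
    qed
  qed
  also have "\<dots> = measure (P_law \<mu> p t) A + C * (e\<^sup>2 / (2 * fisher \<mu> p t))"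
    using mom P.prob_space by simp
  finally show ?thesis .
qed

end

section \<open>Limits of probability measures and of random variables\<close>

text \<open>
  A setwise limit that is uniform over all sets inherits countable additivity: continuity at the empty
  set passes through uniform limits.
\<close>
lemma uniform_limit_prob_measure:
  fixes f :: "'a set \<Rightarrow> real"
  assumes P: "\<And>n. prob_space (P n)" "\<And>n. sets (P n) = sets N"
    and unif: "\<And>e. 0 < e \<Longrightarrow> \<exists>n. \<forall>A\<in>sets N. \<bar>measure (P n) A - f A\<bar> \<le> e"
  shows "\<exists>Q. prob_space Q \<and> sets Q = sets N \<and> (\<forall>A\<in>sets N. measure Q A = f A)"
proof -
  have space: "space (P n) = space N" for n by (rule sets_eq_imp_space_eq[OF P(2)])
  interpret P: prob_space "P n" for n by (rule P(1))
  have nonneg: "0 \<le> f A" if A: "A \<in> sets N" for A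
  proof (rule field_le_epsilon)
    fix e :: real assume "0 < e"
    then obtain n where "\<bar>measure (P n) A - f A\<bar> \<le> e" using unif A by blast
    then show "0 \<le> f A + e" using measure_nonneg[of "P n" A] by linarith
  qed
  have zero: "a = 0" if "\<And>e. 0 < e \<Longrightarrow> \<bar>a\<bar> \<le> e" for a :: real
    using field_le_epsilon[of "\<bar>a\<bar>" 0] that by simp
  have additive: "f (A \<union> B) = f A + f B" if A: "A \<in> sets N" and B: "B \<in> sets N" and "A \<inter> B = {}" for A B
  proof -
    have "f (A \<union> B) - (f A + f B) = 0"
    proof (rule zero)
      fix e :: real assume "0 < e"
      then obtain n where n: "\<forall>A\<in>sets N. \<bar>measure (P n) A - f A\<bar> \<le> e / 3"
        using unif[of "e / 3"] by auto
      have "measure (P n) (A \<union> B) = measure (P n) A + measure (P n) B"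
        using A B that(3) P(2) by (intro P.finite_measure_Union) auto
      moreover have "\<bar>measure (P n) (A \<union> B) - f (A \<union> B)\<bar> \<le> e / 3"
        "\<bar>measure (P n) A - f A\<bar> \<le> e / 3" "\<bar>measure (P n) B - f B\<bar> \<le> e / 3"
        using n A B by auto
      ultimately show "\<bar>f (A \<union> B) - (f A + f B)\<bar> \<le> e" by linarith
    qed
    then show ?thesis by simp
  qed
  have total: "f (space N) = 1"
  proof -
    have "f (space N) - 1 = 0"
    proof (rule zero)
      fix e :: real assume "0 < e"
      then obtain n where "\<bar>measure (P n) (space N) - f (space N)\<bar> \<le> e" using unif by blast
      then show "\<bar>f (space N) - 1\<bar> \<le> e" using P.prob_space[of n] space[of n] by (simp add: abs_minus_commute)
    qed
    then show ?thesis by simp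
  qed
  have empty: "f {} = 0" using additive[of "{}" "{}"] by simp
  define Q where "Q = measure_of (space N) (sets N) (\<lambda>A. ennreal (f A))"
  have pos: "positive (sets N) (\<lambda>A. ennreal (f A))"
    by (simp add: positive_def empty)
  have "countably_additive (sets N) (\<lambda>A. ennreal (f A))"
  proof (rule sets.empty_continuous_imp_countably_additive[OF pos])
    show "Measure_Space.additive (sets N) (\<lambda>A. ennreal (f A))"
      using additive nonneg by (auto simp: additive_def)
    fix A :: "nat \<Rightarrow> 'a set" assume A: "range A \<subseteq> sets N" "decseq A" "(\<Inter>i. A i) = {}"
    have "(\<lambda>i. f (A i)) \<longlonglongrightarrow> 0"
    proof (rule LIMSEQ_I)
      fix e :: real assume "0 < e"
      then obtain n where n: "\<forall>A\<in>sets N. \<bar>measure (P n) A - f A\<bar> \<le> e / 2"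
        using unif[of "e / 2"] by auto
      have "(\<lambda>i. measure (P n) (A i)) \<longlonglongrightarrow> measure (P n) (\<Inter>i. A i)"
        using A P(2) by (intro P.finite_Lim_measure_decseq) auto
      then obtain m where m: "\<And>i. m \<le> i \<Longrightarrow> measure (P n) (A i) < e / 2"
        using A(3) \<open>0 < e\<close> by (force dest: LIMSEQ_D[where r="e / 2"])
      show "\<exists>m. \<forall>i\<ge>m. norm (f (A i) - 0) < e"
      proof (intro exI[of _ m] allI impI)
        fix i assume "m \<le> i"
        have "A i \<in> sets N" using A(1) by auto
        then have "\<bar>measure (P n) (A i) - f (A i)\<bar> \<le> e / 2" "0 \<le> f (A i)"
          using n nonneg by auto
        then show "norm (f (A i) - 0) < e" using m[OF \<open>m \<le> i\<close>] unfolding real_norm_def by linarith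
      qed
    qed
    then show "(\<lambda>i. ennreal (f (A i))) \<longlonglongrightarrow> 0"
      using tendsto_ennrealI by fastforce
  qed simp
  then have em: "emeasure Q A = ennreal (f A)" if "A \<in> sets N" for A
    unfolding Q_def using that pos
    by (intro emeasure_measure_of_sigma sets.sigma_algebra_axioms)
  have setsQ: "sets Q = sets N" by (simp add: Q_def)
  moreover have "space Q = space N" by (simp add: Q_def)
  then have "prob_space Q"
    by (intro prob_spaceI) (simp add: em total)
  moreover have "\<forall>A\<in>sets N. measure Q A = f A"
    by (simp add: measure_def em nonneg)
  ultimately show ?thesis by blast
qed

text \<open>
  Along a sequence in \<open>T\<close> converging to a point of the closure, the probabilities are uniformly Cauchy.
\<close>
lemma lipschitz_family_extends_to_closure:
  fixes T :: "real set" and P :: "real \<Rightarrow> 'a measure"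
  assumes P: "\<And>t. t \<in> T \<Longrightarrow> prob_space (P t)" "\<And>t. t \<in> T \<Longrightarrow> sets (P t) = sets N"
    and lip: "\<And>t u A. t \<in> T \<Longrightarrow> u \<in> T \<Longrightarrow> A \<in> sets N \<Longrightarrow> \<bar>measure (P t) A - measure (P u) A\<bar> \<le> L * \<bar>t - u\<bar>"
  shows "\<exists>Q. \<forall>t\<in>closure T. prob_space (Q t) \<and> sets (Q t) = sets N \<and>
    (\<forall>u\<in>T. \<forall>A\<in>sets N. \<bar>measure (Q t) A - measure (P u) A\<bar> \<le> L * \<bar>t - u\<bar>)"
proof (rule bchoice, rule ballI)
  fix t assume "t \<in> closure T"
  then obtain x where x: "\<And>n. x n \<in> T" "x \<longlonglongrightarrow> t"
    by (auto simp: closure_sequential)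
  have abs_lim: "(\<lambda>m. L * \<bar>u - x m\<bar>) \<longlonglongrightarrow> L * \<bar>u - t\<bar>" for u
    by (intro tendsto_intros x(2))
  have "Cauchy (\<lambda>m. measure (P (x m)) A)" if A: "A \<in> sets N" for A
  proof (rule metric_CauchyI)
    fix e :: real assume "0 < e"
    define d where "d = e / (\<bar>L\<bar> + 1)"
    have "0 < d" using \<open>0 < e\<close> by (simp add: d_def)
    then obtain M where M: "\<And>m n. M \<le> m \<Longrightarrow> M \<le> n \<Longrightarrow> dist (x m) (x n) < d"
      using metric_CauchyD[OF LIMSEQ_imp_Cauchy[OF x(2)]] by blast
    show "\<exists>M. \<forall>m\<ge>M. \<forall>n\<ge>M. dist (measure (P (x m)) A) (measure (P (x n)) A) < e"
    proof (intro exI[of _ M] allI impI)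
      fix m n assume "M \<le> m" "M \<le> n"
      have "\<bar>measure (P (x m)) A - measure (P (x n)) A\<bar> \<le> L * \<bar>x m - x n\<bar>"
        by (rule lip[OF x(1) x(1) A])
      also have "\<dots> \<le> (\<bar>L\<bar> + 1) * \<bar>x m - x n\<bar>"
        by (intro mult_right_mono) auto
      also have "\<dots> < (\<bar>L\<bar> + 1) * d"
        using M[OF \<open>M \<le> m\<close> \<open>M \<le> n\<close>]
        by (intro mult_strict_left_mono) (auto simp: dist_real_def)
      also have "\<dots> = e" by (simp add: d_def)
      finally show "dist (measure (P (x m)) A) (measure (P (x n)) A) < e"
        by (simp add: dist_real_def)
    qed
  qed
  then have "\<exists>l. (\<lambda>m. measure (P (x m)) A) \<longlonglongrightarrow> l" if "A \<in> sets N" for A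
    using that by (simp add: Cauchy_convergent_iff convergent_def)
  then obtain f where f: "\<And>A. A \<in> sets N \<Longrightarrow> (\<lambda>m. measure (P (x m)) A) \<longlonglongrightarrow> f A" by metis
  have bound: "\<bar>f A - measure (P u) A\<bar> \<le> L * \<bar>t - u\<bar>" if u: "u \<in> T" and A: "A \<in> sets N" for u A
  proof (rule tendsto_le[OF sequentially_bot])
    show "(\<lambda>m. L * \<bar>x m - u\<bar>) \<longlonglongrightarrow> L * \<bar>t - u\<bar>"
      using x(2) by (intro tendsto_intros)
    show "(\<lambda>m. \<bar>measure (P (x m)) A - measure (P u) A\<bar>) \<longlonglongrightarrow> \<bar>f A - measure (P u) A\<bar>"
      using f[OF A] by (intro tendsto_intros)
    show "\<forall>\<^sub>F m in sequentially. \<bar>measure (P (x m)) A - measure (P u) A\<bar> \<le> L * \<bar>x m - u\<bar>"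
      using lip[OF x(1) u A] by simp
  qed
  have "\<exists>Q. prob_space Q \<and> sets Q = sets N \<and> (\<forall>A\<in>sets N. measure Q A = f A)"
  proof (rule uniform_limit_prob_measure[where P="\<lambda>n. P (x n)"])
    fix e :: real assume "0 < e"
    have "(\<lambda>m. L * \<bar>t - x m\<bar>) \<longlonglongrightarrow> 0" using abs_lim[of t] by simp
    then have "\<forall>\<^sub>F m in sequentially. L * \<bar>t - x m\<bar> < e" using \<open>0 < e\<close> by (rule order_tendstoD)
    then obtain m where m: "L * \<bar>t - x m\<bar> < e" by (auto simp: eventually_sequentially)
    show "\<exists>n. \<forall>A\<in>sets N. \<bar>measure (P (x n)) A - f A\<bar> \<le> e"
      using bound[OF x(1)[of m]] m by (intro exI[of _ m]) (fastforce simp: abs_minus_commute)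
  qed (use P x(1) in auto)
  then show "\<exists>Q. prob_space Q \<and> sets Q = sets N \<and>
    (\<forall>u\<in>T. \<forall>A\<in>sets N. \<bar>measure Q A - measure (P u) A\<bar> \<le> L * \<bar>t - u\<bar>)"
    using bound by metis
qed

text \<open>
  Completeness of \<open>L\<^sup>1\<close> in a form that keeps the rate and also provides a subsequence converging almost
  everywhere, which is what locates the limit in the closure of \<open>\<Theta>\<close> later on. Along a subsequence with
  \<open>\<delta> (r k) < 2^-k\<close> the distances of successive terms have a finite sum almost everywhere; the rate
  follows by Fatou's lemma.
\<close>
lemma L1_Cauchy_limit:
  fixes Y :: "nat \<Rightarrow> 'a \<Rightarrow> real"
  assumes [measurable]: "\<And>n. Y n \<in> borel_measurable M"
    and cauchy: "\<And>n m. n \<le> m \<Longrightarrow> (\<integral>\<^sup>+x. ennreal \<bar>Y m x - Y n x\<bar> \<partial>M) \<le> ennreal (\<delta> n)"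
    and \<delta>: "\<delta> \<longlonglongrightarrow> 0"
  shows "\<exists>Z r. Z \<in> borel_measurable M \<and> (AE x in M. (\<lambda>k. Y (r k) x) \<longlonglongrightarrow> Z x) \<and>
    (\<forall>n. (\<integral>\<^sup>+x. ennreal \<bar>Y n x - Z x\<bar> \<partial>M) \<le> ennreal (\<delta> n))"
proof -
  have "\<exists>N. \<forall>n\<ge>N. \<delta> n < (1 / 2) ^ k" for k :: nat
    using order_tendstoD(2)[OF \<delta>, of "(1 / 2) ^ k"] by (auto simp: eventually_sequentially)
  then obtain N where N: "\<And>k n. N k \<le> n \<Longrightarrow> \<delta> n < (1 / 2) ^ k" by metis
  define r where "r k = k + (\<Sum>i\<le>k. N i)" for k
  have r: "N k \<le> r k" "k \<le> r k" "r k \<le> r (Suc k)" for k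
    using member_le_sum[of k "{..k}" N] by (auto simp: r_def)
  define d where "d k x = \<bar>Y (r (Suc k)) x - Y (r k) x\<bar>" for k x
  have [measurable]: "d k \<in> borel_measurable M" for k unfolding d_def by measurable
  have "(\<integral>\<^sup>+x. (\<Sum>k. ennreal (d k x)) \<partial>M) = (\<Sum>k. \<integral>\<^sup>+x. ennreal (d k x) \<partial>M)"
    by (rule nn_integral_suminf) measurable
  also have "\<dots> \<le> (\<Sum>k. ennreal ((1 / 2) ^ k))"
  proof (intro suminf_le)
    fix k
    have "(\<integral>\<^sup>+x. ennreal (d k x) \<partial>M) \<le> ennreal (\<delta> (r k))"
      unfolding d_def by (rule cauchy[OF r(3)])
    also have "\<dots> \<le> ennreal ((1 / 2) ^ k)" using N[OF r(1)] by (intro ennreal_leI) (simp add: less_imp_le)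
    finally show "(\<integral>\<^sup>+x. ennreal (d k x) \<partial>M) \<le> ennreal ((1 / 2) ^ k)" .
  qed auto
  also have "\<dots> = ennreal (\<Sum>k. (1 / 2) ^ k)"
    by (rule suminf_ennreal2) (auto simp: summable_geometric)
  finally have "(\<integral>\<^sup>+x. (\<Sum>k. ennreal (d k x)) \<partial>M) \<noteq> \<infinity>"
    by (auto simp: top_unique)
  then have "AE x in M. (\<Sum>k. ennreal (d k x)) \<noteq> \<infinity>"
    by (intro nn_integral_PInf_AE) auto
  then have conv: "AE x in M. (\<lambda>k. Y (r k) x) \<longlonglongrightarrow> lim (\<lambda>k. Y (r k) x)"
  proof eventually_elim
    case (elim x)
    then have "summable (\<lambda>k. d k x)"
      by (intro summable_suminf_not_top) (auto simp: d_def)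
    then have "summable (\<lambda>k. Y (r (Suc k)) x - Y (r k) x)"
      unfolding d_def by (rule summable_rabs_cancel)
    then have "convergent (\<lambda>n. \<Sum>k<n. Y (r (Suc k)) x - Y (r k) x)"
      by (simp add: summable_iff_convergent)
    then have "convergent (\<lambda>n. Y (r n) x - Y (r 0) x)"
      by (simp only: sum_lessThan_telescope[of "\<lambda>k. Y (r k) x"])
    from convergent_add[OF this convergent_const[of "Y (r 0) x"]]
    have "convergent (\<lambda>n. Y (r n) x)" by simp
    then show ?case by (simp add: convergent_LIMSEQ_iff)
  qed
  define Z where "Z x = lim (\<lambda>k. Y (r k) x)" for x
  have [measurable]: "Z \<in> borel_measurable M" unfolding Z_def by measurable
  have "(\<integral>\<^sup>+x. ennreal \<bar>Y n x - Z x\<bar> \<partial>M) \<le> ennreal (\<delta> n)" for n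
  proof -
    have "(\<integral>\<^sup>+x. ennreal \<bar>Y n x - Z x\<bar> \<partial>M) = (\<integral>\<^sup>+x. liminf (\<lambda>k. ennreal \<bar>Y (r k) x - Y n x\<bar>) \<partial>M)"
    proof (intro nn_integral_cong_AE)
      show "AE x in M. ennreal \<bar>Y n x - Z x\<bar> = liminf (\<lambda>k. ennreal \<bar>Y (r k) x - Y n x\<bar>)"
        using conv
      proof eventually_elim
        case (elim x)
        then have "(\<lambda>k. ennreal \<bar>Y (r k) x - Y n x\<bar>) \<longlonglongrightarrow> ennreal \<bar>Z x - Y n x\<bar>"
          unfolding Z_def by (intro tendsto_intros)
        from lim_imp_Liminf[OF _ this] show ?case by (simp add: abs_minus_commute)
      qed
    qed
    also have "\<dots> \<le> liminf (\<lambda>k. \<integral>\<^sup>+x. ennreal \<bar>Y (r k) x - Y n x\<bar> \<partial>M)"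
      by (rule nn_integral_liminf) measurable
    also have "\<dots> \<le> liminf (\<lambda>k. ennreal (\<delta> n))"
    proof (rule Liminf_mono)
      show "\<forall>\<^sub>F k in sequentially. (\<integral>\<^sup>+x. ennreal \<bar>Y (r k) x - Y n x\<bar> \<partial>M) \<le> ennreal (\<delta> n)"
        using eventually_ge_at_top[of n]
        by eventually_elim (use r(2) in \<open>auto intro!: cauchy intro: order_trans\<close>)
    qed
    finally show ?thesis by (simp add: Liminf_const)
  qed
  then show ?thesis using conv unfolding Z_def[symmetric]
    by (intro exI[of _ Z] exI[of _ r]) auto
qed

section \<open>Weak convergence from convergence on a multiplicative class\<close>

text \<open>
  Inclusion-exclusion, one set at a time. The set \<open>V\<close> makes the induction work: after splitting off \<open>U\<close>, the
  intersection with \<open>U\<close> is again of the same form.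
\<close>
lemma measure_finite_Union_tendsto:
  fixes L :: "nat \<Rightarrow> 'b measure"
  assumes fin: "\<And>n. finite_measure (L n)" "finite_measure N"
    and sets: "\<And>n. E \<subseteq> sets (L n)" "E \<subseteq> sets N"
    and Int: "\<And>U V. U \<in> E \<Longrightarrow> V \<in> E \<Longrightarrow> U \<inter> V \<in> E"
    and conv: "\<And>U. U \<in> E \<Longrightarrow> (\<lambda>n. measure (L n) U) \<longlonglongrightarrow> measure N U"
    and S: "finite S" "S \<subseteq> E" and V: "V \<in> E"
  shows "(\<lambda>n. measure (L n) (V \<inter> \<Union>S)) \<longlonglongrightarrow> measure N (V \<inter> \<Union>S)"
  using S V
proof (induction S arbitrary: V rule: finite_induct)
  case (insert U S)
  have split: "measure K (V \<inter> \<Union>(insert U S)) =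
      measure K (V \<inter> U) + (measure K (V \<inter> \<Union>S) - measure K ((V \<inter> U) \<inter> \<Union>S))"
    if "finite_measure K" "E \<subseteq> sets K" for K
  proof -
    interpret finite_measure K by fact
    have in_sets: "V \<inter> U \<in> sets K" "V \<inter> \<Union>S \<in> sets K"
      using that(2) insert.prems insert.hyps(1) by (auto intro!: sets.Int sets.finite_Union)
    have eq: "V \<inter> \<Union>(insert U S) = (V \<inter> U) \<union> (V \<inter> \<Union>S)"
      "(V \<inter> \<Union>S) \<inter> (V \<inter> U) = (V \<inter> U) \<inter> \<Union>S" by auto
    show ?thesis
      unfolding eq(1) eq(2)[symmetric]
      using in_sets by (simp only: finite_measure_Union' finite_measure_Diff')
  qed
  have "V \<inter> U \<in> E" using insert.prems by (auto intro: Int)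
  then have "(\<lambda>n. measure (L n) (V \<inter> U) + (measure (L n) (V \<inter> \<Union>S) - measure (L n) ((V \<inter> U) \<inter> \<Union>S)))
     \<longlonglongrightarrow> measure N (V \<inter> U) + (measure N (V \<inter> \<Union>S) - measure N ((V \<inter> U) \<inter> \<Union>S))"
    using insert.prems by (intro tendsto_intros insert.IH conv) auto
  then show ?case
    using fin sets by (simp only: split)
qed simp

text \<open>
  An open set is exhausted from inside by finite unions of members of \<open>E\<close>, for which convergence is known.
\<close>
lemma open_measure_liminf:
  fixes L :: "nat \<Rightarrow> 'b::topological_space measure"
  assumes fin: "\<And>n. finite_measure (L n)" "finite_measure N"
    and sets: "\<And>n. sets (L n) = sets borel" "sets N = sets borel"
    and E: "E \<subseteq> sets borel" "UNIV \<in> E"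
    and Int: "\<And>U V. U \<in> E \<Longrightarrow> V \<in> E \<Longrightarrow> U \<inter> V \<in> E"
    and conv: "\<And>U. U \<in> E \<Longrightarrow> (\<lambda>n. measure (L n) U) \<longlonglongrightarrow> measure N U"
    and U: "countable K" "K \<subseteq> E" "U = \<Union>K"
    and e: "0 < e"
  shows "\<forall>\<^sub>F n in sequentially. measure N U - e < measure (L n) U"
proof (cases "K = {}")
  case True
  then show ?thesis using U(3) e by simp
next
  case False
  define S where "S m = from_nat_into K ` {..m}" for m :: nat
  have S: "finite (S m)" "S m \<subseteq> K" for m
    using from_nat_into[OF False] by (auto simp: S_def)
  have Union: "(\<Union>m. \<Union>(S m)) = U"
  proof -
    have "K = range (from_nat_into K)" using False U(1) by simp
    also have "\<dots> = (\<Union>m. S m)" by (auto simp: S_def)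
    finally show ?thesis using U(3) by auto
  qed
  have S_sets: "\<Union>(S m) \<in> sets borel" for m
    using S[of m] U(2) E(1) by (intro sets.finite_Union) auto
  interpret N: finite_measure N by (rule fin(2))
  have "(\<lambda>m. measure N (\<Union>(S m))) \<longlonglongrightarrow> measure N (\<Union>m. \<Union>(S m))"
    using S_sets sets(2) by (intro N.finite_Lim_measure_incseq)
      (auto simp: incseq_def S_def intro!: Union_mono image_mono)
  then have "\<forall>\<^sub>F m in sequentially. measure N U - e / 2 < measure N (\<Union>(S m))"
    unfolding Union using e by (intro order_tendstoD(1)) auto
  then obtain m where m: "measure N U - e / 2 < measure N (\<Union>(S m))"
    by (auto simp: eventually_sequentially)
  have "(\<lambda>n. measure (L n) (UNIV \<inter> \<Union>(S m))) \<longlonglongrightarrow> measure N (UNIV \<inter> \<Union>(S m))"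
    using sets E S[of m] U(2) by (intro measure_finite_Union_tendsto[where E=E] fin Int conv) auto
  then have "\<forall>\<^sub>F n in sequentially. measure N (\<Union>(S m)) - e / 2 < measure (L n) (\<Union>(S m))"
    using e by (intro order_tendstoD(1)) auto
  then show ?thesis
  proof eventually_elim
    case (elim n)
    interpret L: finite_measure "L n" by (rule fin(1))
    have "U \<in> sets borel"
      unfolding Union[symmetric] using S_sets by auto
    then have "measure (L n) (\<Union>(S m)) \<le> measure (L n) U"
      using sets(1) Union by (intro L.finite_measure_mono) auto
    then show ?case using elim m by linarith
  qed
qed

lemma unit_step_approximation:
  fixes y :: real
  assumes "0 \<le> y" "y \<le> 1" "0 < m"
  shows "(\<Sum>j\<in>{1..m}. indicator {real j / real m<..} y) / real m \<le> y"
    "y \<le> (\<Sum>j\<in>{1..m}. indicator {real j / real m<..} y) / real m + 1 / real m"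
proof -
  define c where "c = \<lceil>real m * y\<rceil>"
  have c: "real m * y \<le> real_of_int c" "real_of_int c < real m * y + 1" 
    unfolding c_def by linarith+
  have c0: "0 \<le> c" using ceiling_mono[of 0 "real m * y"] assms by (simp add: c_def)
  have cm: "c \<le> int m" unfolding c_def ceiling_le_iff using assms mult_left_le[of y "real m"] by simp
  have iff: "real j / real m < y \<longleftrightarrow> int j < c" for j
    using assms(3) unfolding c_def less_ceiling_iff by (simp add: field_simps)
  have "(\<Sum>j\<in>{1..m}. indicator {real j / real m<..} y :: real) = (\<Sum>j\<in>{1..m}. if j \<in> {1..nat (c - 1)} then 1 else 0)"
    by (intro sum.cong) (auto simp: indicator_def iff)
  also have "\<dots> = real (card ({1..m} \<inter> {1..nat (c - 1)}))"
    by (subst sum.inter_restrict[symmetric]) auto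
  also have "{1..m} \<inter> {1..nat (c - 1)} = {1..nat (c - 1)}" using cm by auto
  finally have sum: "(\<Sum>j\<in>{1..m}. indicator {real j / real m<..} y :: real) = real (nat (c - 1))" by simp
  have bounds: "real (nat (c - 1)) \<le> real m * y" "real m * y \<le> real (nat (c - 1)) + 1"
  proof -
    have "0 \<le> real m * y" using assms by simp
    moreover have "real (nat (c - 1)) = (if c = 0 then 0 else real_of_int c - 1)" using c0 by simp
    ultimately show "real (nat (c - 1)) \<le> real m * y" "real m * y \<le> real (nat (c - 1)) + 1"
      using c by (simp_all split: if_splits)
  qed
  then show "(\<Sum>j\<in>{1..m}. indicator {real j / real m<..} y) / real m \<le> y"
    "y \<le> (\<Sum>j\<in>{1..m}. indicator {real j / real m<..} y) / real m + 1 / real m"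
    unfolding sum using assms(3) by (simp_all add: field_simps)
qed

text \<open>
  The integral of \<open>f\<close> is, up to \<open>1 / m\<close>, the average of the measures of the open sets \<open>{f > j / m}\<close> for
  \<open>j = 1..m\<close>.
\<close>
lemma integral_liminf_of_open_liminf:
  fixes L :: "nat \<Rightarrow> 'b::topological_space measure" and f :: "'b \<Rightarrow> real"
  assumes prob: "\<And>n. prob_space (L n)" "prob_space N"
    and sets: "\<And>n. sets (L n) = sets borel" "sets N = sets borel"
    and open_liminf: "\<And>U e. open U \<Longrightarrow> 0 < e \<Longrightarrow> \<forall>\<^sub>F n in sequentially. measure N U - e < measure (L n) U"
    and f: "continuous_on UNIV f" "\<And>x. 0 \<le> f x" "\<And>x. f x \<le> 1"
    and e: "0 < e"
  shows "\<forall>\<^sub>F n in sequentially. integral\<^sup>L N f - e < integral\<^sup>L (L n) f"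
proof -
  obtain k where k: "1 / real (Suc k) < e / 2" using nat_approx_posE[of "e / 2"] e by auto
  define m where "m = Suc k"
  define U where "U j = {x. real j / real m < f x}" for j
  have m: "0 < m" "1 / real m < e / 2" using k by (auto simp: m_def)
  have open_U: "open (U j)" for j
    unfolding U_def using f(1) by (intro open_Collect_less continuous_on_const)
  have f_meas: "f \<in> borel_measurable borel" by (rule borel_measurable_continuous_onI[OF f(1)])
  have int: "(\<Sum>j\<in>{1..m}. measure K (U j)) / real m \<le> integral\<^sup>L K f"
    "integral\<^sup>L K f \<le> (\<Sum>j\<in>{1..m}. measure K (U j)) / real m + 1 / real m"
    if K: "prob_space K" "sets K = sets borel" for K
  proof -
    interpret prob_space K by fact
    have [measurable]: "U j \<in> sets K" for j using open_U K(2) by simp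
    have [measurable]: "f \<in> borel_measurable K" using f_meas K(2) by (simp cong: measurable_cong_sets)
    have int_f: "integrable K f"
      using f(2,3) by (intro integrable_const_bound[where B=1]) auto
    define s where "s x = (\<Sum>j\<in>{1..m}. indicator (U j) x :: real) / real m" for x
    have int_s: "integrable K s" unfolding s_def by (auto simp: emeasure_eq_measure)
    have s_eq: "s x = (\<Sum>j\<in>{1..m}. indicator {real j / real m<..} (f x)) / real m" for x
      unfolding s_def by (intro arg_cong2[where f="(/)"] sum.cong) (auto simp: U_def indicator_def)
    have "integral\<^sup>L K s = (\<Sum>j\<in>{1..m}. measure K (U j)) / real m"
      unfolding s_def by (simp add: emeasure_eq_measure)
    moreover have "integral\<^sup>L K s \<le> integral\<^sup>L K f"
      using unit_step_approximation(1)[OF f(2,3) m(1)] by (intro integral_mono int_s int_f) (simp only: s_eq)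
    moreover have "integral\<^sup>L K f \<le> (LINT x|K. s x + 1 / real m)"
    proof (rule integral_mono[OF int_f])
      show "integrable K (\<lambda>x. s x + 1 / real m)" using int_s by simp
      show "f x \<le> s x + 1 / real m" for x
        unfolding s_eq by (rule unit_step_approximation(2)[OF f(2,3) m(1)])
    qed
    moreover have "(LINT x|K. s x + 1 / real m) = integral\<^sup>L K s + 1 / real m"
      using int_s prob_space by simp
    ultimately show "(\<Sum>j\<in>{1..m}. measure K (U j)) / real m \<le> integral\<^sup>L K f"
      "integral\<^sup>L K f \<le> (\<Sum>j\<in>{1..m}. measure K (U j)) / real m + 1 / real m" by linarith+
  qed
  have "\<forall>\<^sub>F n in sequentially. \<forall>j\<in>{1..m}. measure N (U j) - e / 2 < measure (L n) (U j)"
    using open_liminf[OF open_U] e by (intro eventually_ball_finite) auto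
  then show ?thesis
  proof eventually_elim
    case (elim n)
    have "(\<Sum>j\<in>{1..m}. measure N (U j)) - real m * (e / 2) = (\<Sum>j\<in>{1..m}. measure N (U j) - e / 2)"
      by (simp add: sum_subtractf)
    also have "\<dots> \<le> (\<Sum>j\<in>{1..m}. measure (L n) (U j))"
      using elim by (intro sum_mono) (auto intro: less_imp_le)
    finally have "((\<Sum>j\<in>{1..m}. measure N (U j)) - real m * (e / 2)) / real m \<le> (\<Sum>j\<in>{1..m}. measure (L n) (U j)) / real m"
      by (rule divide_right_mono) simp
    then have "(\<Sum>j\<in>{1..m}. measure N (U j)) / real m - e / 2 \<le> (\<Sum>j\<in>{1..m}. measure (L n) (U j)) / real m"
      using m(1) by (simp add: diff_divide_distrib)
    then show ?case
      using int[OF prob(2) sets(2)] int[OF prob(1) sets(1), of n] m(2) by linarith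
  qed
qed

text \<open>
  The half of the portmanteau theorem that starts from open sets: lower bounds for \<open>g\<close> and for \<open>1 - g\<close>,
  where \<open>g\<close> is \<open>f\<close> rescaled into the unit interval.
\<close>
lemma converges_weakly_of_open_liminf:
  fixes L :: "nat \<Rightarrow> 'b::topological_space measure"
  assumes prob: "\<And>n. prob_space (L n)" "prob_space N"
    and sets: "\<And>n. sets (L n) = sets borel" "sets N = sets borel"
    and open_liminf: "\<And>U e. open U \<Longrightarrow> 0 < e \<Longrightarrow> \<forall>\<^sub>F n in sequentially. measure N U - e < measure (L n) U"
  shows "converges_weakly L N"
  unfolding converges_weakly_def
proof (intro allI impI, elim conjE)
  fix f :: "'b \<Rightarrow> real"
  assume f: "continuous_on UNIV f" and "bounded (range f)"
  then obtain B where B: "0 < B" "\<And>x. \<bar>f x\<bar> \<le> B" by (auto simp: bounded_pos)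
  define g where "g x = (f x + B) / (2 * B)" for x
  have g: "continuous_on UNIV g" "0 \<le> g x" "g x \<le> 1" for x
    proof -
    have "- B \<le> f x" "f x \<le> B" using B(2)[of x] by (auto simp: abs_le_iff)
    then show "0 \<le> g x" "g x \<le> 1" using B(1) by (auto simp: g_def field_simps)
    show "continuous_on UNIV g"
      unfolding g_def using f B(1) by (intro continuous_intros) auto
  qed
  have g_meas: "g \<in> borel_measurable borel" by (rule borel_measurable_continuous_onI[OF g(1)])
  have int: "integrable K g" if "prob_space K" "sets K = sets borel" for K
  proof -
    interpret prob_space K by fact
    show ?thesis using g g_meas that(2)
      by (intro integrable_const_bound[where B=1]) (auto cong: measurable_cong_sets)
  qed
  have compl: "(LINT x|K. 1 - g x) = 1 - integral\<^sup>L K g" if "prob_space K" "sets K = sets borel" for K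
    using int[OF that] prob_space.prob_space[OF that(1)] prob_space.finite_measure[OF that(1)]
    by (simp add: finite_measure.integrable_const)
  have "(\<lambda>n. integral\<^sup>L (L n) g) \<longlonglongrightarrow> integral\<^sup>L N g"
  proof (rule LIMSEQ_I)
    fix e :: real assume e: "0 < e"
    have 1: "\<forall>\<^sub>F n in sequentially. integral\<^sup>L N g - e < integral\<^sup>L (L n) g"
      by (rule integral_liminf_of_open_liminf[OF prob sets open_liminf g e])
    have "\<forall>\<^sub>F n in sequentially. (LINT x|N. 1 - g x) - e < (LINT x|L n. 1 - g x)"
      using g by (intro integral_liminf_of_open_liminf[OF prob sets open_liminf] continuous_intros e) auto
    with 1 have "\<forall>\<^sub>F n in sequentially. norm (integral\<^sup>L (L n) g - integral\<^sup>L N g) < e"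
    proof eventually_elim
      case (elim n)
      then show ?case using compl[OF prob(2) sets(2)] compl[OF prob(1) sets(1), of n] by auto
    qed
    then show "\<exists>no. \<forall>n\<ge>no. norm (integral\<^sup>L (L n) g - integral\<^sup>L N g) < e"
      by (simp add: eventually_sequentially)
  qed
  then have "(\<lambda>n. 2 * B * integral\<^sup>L (L n) g - B) \<longlonglongrightarrow> 2 * B * integral\<^sup>L N g - B"
    by (intro tendsto_intros)
  moreover have "2 * B * integral\<^sup>L K g - B = integral\<^sup>L K f" if K: "prob_space K" "sets K = sets borel" for K
  proof -
    have "(LINT x|K. 2 * B * g x - B) = 2 * B * integral\<^sup>L K g - B"
      using int[OF K] prob_space.prob_space[OF K(1)] prob_space.finite_measure[OF K(1)]
      by (simp add: finite_measure.integrable_const)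
    moreover have "2 * B * g x - B = f x" for x using B(1) by (simp add: g_def)
    ultimately show ?thesis by simp
  qed
  ultimately show "(\<lambda>n. integral\<^sup>L (L n) f) \<longlonglongrightarrow> integral\<^sup>L N f"
    using prob sets by simp
qed

section \<open>Mixtures of i.i.d. sequences\<close>

lemma prod_emb_UNIV_borel:
  "prod_emb UNIV (\<lambda>_. borel) J (Pi\<^sub>E J A) = {x. \<forall>i\<in>J. x i \<in> A i}"
  by (auto simp: prod_emb_def PiE_iff)

text \<open>
  Draw \<open>\<omega>\<close> from \<open>M\<close> and then an i.i.d. sequence with law \<open>Q \<omega>\<close>. The product measure depends measurably on
  \<open>\<omega>\<close> because this can be checked on cylinders, where it is a finite product.
\<close>
lemma mixture_of_iid:
  fixes Q :: "'w \<Rightarrow> 'a::second_countable_topology measure"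
  assumes M: "prob_space M"
    and Q: "\<And>\<omega>. \<omega> \<in> space M \<Longrightarrow> prob_space (Q \<omega>)" "\<And>\<omega>. \<omega> \<in> space M \<Longrightarrow> sets (Q \<omega>) = sets borel"
    and meas: "\<And>A. A \<in> sets borel \<Longrightarrow> (\<lambda>\<omega>. emeasure (Q \<omega>) A) \<in> borel_measurable M"
  shows "\<exists>N :: (nat \<Rightarrow> 'a) measure. prob_space N \<and> sets N = sets borel \<and>
    (\<forall>J A. finite J \<longrightarrow> (\<forall>i\<in>J. A i \<in> sets borel) \<longrightarrow>
      emeasure N {x. \<forall>i\<in>J. x i \<in> A i} = (\<integral>\<^sup>+\<omega>. (\<Prod>i\<in>J. emeasure (Q \<omega>) (A i)) \<partial>M))"
proof -
  let ?B = "\<Pi>\<^sub>M i\<in>(UNIV::nat set). (borel :: 'a measure)"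
  define K where "K \<omega> = (\<Pi>\<^sub>M i\<in>(UNIV::nat set). Q \<omega>)" for \<omega>
  interpret M: prob_space M by (rule M)
  have K_prob: "prob_space (K \<omega>)" if "\<omega> \<in> space M" for \<omega>
    unfolding K_def using Q(1)[OF that] by (rule prob_space_PiM)
  have K_sets: "sets (K \<omega>) = sets ?B" if "\<omega> \<in> space M" for \<omega>
    unfolding K_def using Q(2)[OF that] by (intro sets_PiM_cong) auto
  have K_cyl: "emeasure (K \<omega>) {x. \<forall>i\<in>J. x i \<in> A i} = (\<Prod>i\<in>J. emeasure (Q \<omega>) (A i))"
    if \<omega>: "\<omega> \<in> space M" and J: "finite J" "\<And>i. i \<in> J \<Longrightarrow> A i \<in> sets borel" for \<omega> J A
  proof -
    have "space (Q \<omega>) = UNIV" using sets_eq_imp_space_eq[OF Q(2)[OF \<omega>]] by simp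
    then have "{x. \<forall>i\<in>J. x i \<in> A i} = prod_emb UNIV (\<lambda>_. Q \<omega>) J (Pi\<^sub>E J A)"
      by (auto simp: prod_emb_def PiE_iff)
    then show ?thesis
      unfolding K_def using Q[OF \<omega>] J by (simp only:) (intro emeasure_PiM_emb, auto)
  qed
  have K: "K \<in> M \<rightarrow>\<^sub>M prob_algebra ?B"
  proof (rule measurable_prob_algebra_generated[OF sets_PiM Int_stable_prod_algebra prod_algebra_sets_into_space])
    fix S assume "S \<in> prod_algebra (UNIV::nat set) (\<lambda>_. borel :: 'a measure)"
    then obtain J A where S: "S = prod_emb UNIV (\<lambda>_. borel) J (Pi\<^sub>E J A)" "finite J"
      "\<And>i. i \<in> J \<Longrightarrow> A i \<in> sets borel"
      by (rule prod_algebraE) auto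
    have "(\<lambda>\<omega>. \<Prod>i\<in>J. emeasure (Q \<omega>) (A i)) \<in> borel_measurable M"
      using S by (intro borel_measurable_prod_ennreal meas) auto
    then show "(\<lambda>\<omega>. emeasure (K \<omega>) S) \<in> borel_measurable M"
      unfolding S(1) prod_emb_UNIV_borel
      by (rule measurable_cong[THEN iffD1, rotated]) (rule K_cyl[symmetric], use S in auto)
  qed (use K_prob K_sets in auto)
  define N where "N = M \<bind> K"
  have M_alg: "M \<in> space (prob_algebra M)" by (simp add: space_prob_algebra M)
  have "prob_space N"
    unfolding N_def using K_prob by (intro M.prob_space_bind[OF _ measurable_prob_algebraD[OF K]] AE_I2)
  moreover have "sets N = sets borel"
    unfolding N_def sets_PiM_equal_borel[symmetric] by (rule sets_bind[OF K_sets M.not_empty])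
  moreover have "emeasure N {x. \<forall>i\<in>J. x i \<in> A i} = (\<integral>\<^sup>+\<omega>. (\<Prod>i\<in>J. emeasure (Q \<omega>) (A i)) \<partial>M)"
    if J: "finite J" "\<forall>i\<in>J. A i \<in> sets borel" for J A
  proof -
    have "prod_emb UNIV (\<lambda>_. borel) J (Pi\<^sub>E J A) \<in> sets ?B"
      using J by (intro sets_PiM_I) auto
    then have "emeasure N {x. \<forall>i\<in>J. x i \<in> A i} = (\<integral>\<^sup>+\<omega>. emeasure (K \<omega>) {x. \<forall>i\<in>J. x i \<in> A i} \<partial>M)"
      unfolding N_def prod_emb_UNIV_borel by (rule emeasure_bind_prob_algebra[OF M_alg K])
    also have "\<dots> = (\<integral>\<^sup>+\<omega>. (\<Prod>i\<in>J. emeasure (Q \<omega>) (A i)) \<partial>M)"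
      using J by (intro nn_integral_cong K_cyl) auto
    finally show ?thesis .
  qed
  ultimately show ?thesis by blast
qed

text \<open>
  Permuting the coordinates permutes the factors of a product.
\<close>
lemma exchangeable_of_product_formula:
  fixes N :: "(nat \<Rightarrow> 'a::euclidean_space) measure"
  assumes N: "prob_space N" "sets N = sets borel"
    and formula: "\<And>J A. finite J \<Longrightarrow> (\<And>i. i \<in> J \<Longrightarrow> A i \<in> sets borel) \<Longrightarrow>
      emeasure N {x. \<forall>i\<in>J. x i \<in> A i} = (\<integral>\<^sup>+\<omega>. (\<Prod>i\<in>J. emeasure (Q \<omega>) (A i)) \<partial>M)"
  shows "exchangeable N (\<lambda>k x. x k)"
  unfolding exchangeable_def
proof (intro allI impI)
  fix m and \<pi> :: "nat \<Rightarrow> nat" assume \<pi>: "\<pi> permutes {..<m}"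
  let ?B = "\<Pi>\<^sub>M i\<in>(UNIV::nat set). (borel :: 'a measure)"
  have sets_B: "sets ?B = sets (borel :: (nat \<Rightarrow> 'a) measure)" by (rule sets_PiM_equal_borel)
  have space_N: "space N = UNIV" using sets_eq_imp_space_eq[OF N(2)] by simp
  have reindex: "(\<lambda>x k. x (\<sigma> k)) \<in> N \<rightarrow>\<^sub>M borel" for \<sigma> :: "nat \<Rightarrow> nat"
  proof -
    have "(\<lambda>x. \<lambda>k\<in>UNIV. x (\<sigma> k)) \<in> ?B \<rightarrow>\<^sub>M ?B" by measurable
    then show ?thesis
      using N(2) sets_B by (simp add: restrict_def cong: measurable_cong_sets)
  qed
  interpret N: prob_space N by (rule N(1))
  show "distr N borel (\<lambda>x k. x (\<pi> k)) = distr N borel (\<lambda>x k. x k)"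
  proof (rule measure_eqI_PiM_infinite[where I=UNIV and M="\<lambda>_. borel"])
    fix A :: "nat \<Rightarrow> 'a set" and J assume J: "finite J" "\<And>i. i \<in> J \<Longrightarrow> A i \<in> sets borel"
    have cyl: "{x. \<forall>i\<in>J. x i \<in> A i} \<in> sets (borel :: (nat \<Rightarrow> 'a) measure)"
      unfolding sets_B[symmetric] prod_emb_UNIV_borel[symmetric] using J by (intro sets_PiM_I) auto
    have inj: "inj \<pi>" using \<pi> by (rule permutes_inj)
    have "emeasure (distr N borel (\<lambda>x k. x (\<pi> k))) {x. \<forall>i\<in>J. x i \<in> A i} =
        emeasure N {x. \<forall>i\<in>J. x (\<pi> i) \<in> A i}"
      using cyl reindex[of \<pi>] by (subst emeasure_distr) (auto simp: space_N vimage_def)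
    also have "{x::nat \<Rightarrow> 'a. \<forall>i\<in>J. x (\<pi> i) \<in> A i} = {x. \<forall>i\<in>\<pi> ` J. x i \<in> A (inv \<pi> i)}"
      by (simp add: permutes_inverses(2)[OF \<pi>])
    also have "emeasure N \<dots> = (\<integral>\<^sup>+\<omega>. (\<Prod>i\<in>\<pi> ` J. emeasure (Q \<omega>) (A (inv \<pi> i))) \<partial>M)"
      using J by (intro formula) (auto simp: permutes_inverses(2)[OF \<pi>])
    also have "\<dots> = (\<integral>\<^sup>+\<omega>. (\<Prod>i\<in>J. emeasure (Q \<omega>) (A i)) \<partial>M)"
      using inj by (simp add: prod.reindex inj_on_subset permutes_inverses(2)[OF \<pi>])
    also have "\<dots> = emeasure N {x. \<forall>i\<in>J. x i \<in> A i}"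
      using J by (intro formula[symmetric]) auto
    also have "\<dots> = emeasure (distr N borel (\<lambda>x k. x k)) {x. \<forall>i\<in>J. x i \<in> A i}"
      using cyl reindex[of "\<lambda>k. k"] by (subst emeasure_distr) (auto simp: space_N vimage_def)
    finally show "emeasure (distr N borel (\<lambda>x k. x (\<pi> k))) (prod_emb UNIV (\<lambda>_. borel) J (Pi\<^sub>E J A)) =
        emeasure (distr N borel (\<lambda>x k. x k)) (prod_emb UNIV (\<lambda>_. borel) J (Pi\<^sub>E J A))"
      unfolding prod_emb_UNIV_borel .
  next
    show "finite_measure (distr N borel (\<lambda>x k. x (\<pi> k)))"
      using reindex by (intro finite_measure.finite_measure_distr N.finite_measure)
  qed (simp_all add: sets_B)
qed

text \<open>
  The product topology has a countable basis of open rectangles that constrain finitely many coordinates,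
  and finite-dimensional rectangles are closed under intersection.
\<close>
lemma converges_weakly_of_cylinders:
  fixes L :: "nat \<Rightarrow> (nat \<Rightarrow> 'a::euclidean_space) measure"
  assumes prob: "\<And>n. prob_space (L n)" "prob_space N"
    and sets: "\<And>n. sets (L n) = sets borel" "sets N = sets borel"
    and conv: "\<And>k A. (\<And>i. A i \<in> sets borel) \<Longrightarrow>
      (\<lambda>n. measure (L n) {x. \<forall>i<k. x i \<in> A i}) \<longlonglongrightarrow> measure N {x. \<forall>i<k. x i \<in> A i}"
  shows "converges_weakly L N"
proof (rule converges_weakly_of_open_liminf[OF prob sets])
  fix U :: "(nat \<Rightarrow> 'a) set" and e :: real assume U: "open U" and e: "0 < e"
  define E :: "(nat \<Rightarrow> 'a) set set" where
    "E = {{x. \<forall>i<k. x i \<in> A i} | k A. \<forall>i. A i \<in> sets borel}"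
  obtain B :: "(nat \<Rightarrow> 'a) set set" where B: "topological_basis B" "countable B"
    "\<And>b. b \<in> B \<Longrightarrow> \<exists>X. b = Pi\<^sub>E UNIV X \<and> (\<forall>i. open (X i)) \<and> finite {i. X i \<noteq> UNIV}"
    using product_topology_countable_basis by fast
  have "B \<subseteq> E"
  proof
    fix b assume "b \<in> B"
    then obtain X where X: "b = Pi\<^sub>E UNIV X" "\<And>i. open (X i)" "finite {i. X i \<noteq> UNIV}" using B(3) by blast
    obtain k where k: "\<And>i. X i \<noteq> UNIV \<Longrightarrow> i < k"
      using X(3) finite_nat_iff_bounded[of "{i. X i \<noteq> UNIV}"] by auto
    have "b = {x. \<forall>i<k. x i \<in> X i}"
      unfolding X(1) using k by (auto simp: PiE_iff)
    then show "b \<in> E" unfolding E_def using X(2) by (blast intro: borel_open)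
  qed
  obtain K where K: "K \<subseteq> B" "\<Union>K = U" using B(1) U by (auto simp: topological_basis_def)
  show "\<forall>\<^sub>F n in sequentially. measure N U - e < measure (L n) U"
  proof (rule open_measure_liminf[where E=E and K=K])
    show "finite_measure (L n)" "finite_measure N" for n
      using prob by (auto intro: prob_space.finite_measure)
    show "E \<subseteq> sets borel"
    proof
      fix S assume "S \<in> E"
      then obtain k A where S: "S = {x. \<forall>i\<in>{..<k}. x i \<in> A i}" "\<And>i. A i \<in> sets borel"
        by (auto simp: E_def)
      show "S \<in> sets borel"
        unfolding S(1) prod_emb_UNIV_borel[symmetric] sets_PiM_equal_borel[symmetric]
        using S(2) by (intro sets_PiM_I) auto
    qed
    show "UNIV \<in> E" unfolding E_def by (auto intro!: exI[of _ 0])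
    show "V \<inter> W \<in> E" if VW: "V \<in> E" "W \<in> E" for V W
    proof -
      obtain k A where V: "V = {x. \<forall>i<k. x i \<in> A i}" "\<And>i. A i \<in> sets borel"
        using VW(1) by (auto simp: E_def)
      obtain l A' where W: "W = {x. \<forall>i<l. x i \<in> A' i}" "\<And>i. A' i \<in> sets borel"
        using VW(2) by (auto simp: E_def)
      define D where "D i = (if i < k then A i else UNIV) \<inter> (if i < l then A' i else UNIV)" for i
      have "D i \<in> sets borel" for i using V(2) W(2) by (auto simp: D_def)
      moreover have "V \<inter> W = {x. \<forall>i<max k l. x i \<in> D i}"
      proof -
        have "y \<in> D i \<longleftrightarrow> (i < k \<longrightarrow> y \<in> A i) \<and> (i < l \<longrightarrow> y \<in> A' i)" for y i by (simp add: D_def)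
        then show ?thesis unfolding V(1) W(1) less_max_iff_disj by blast
      qed
      ultimately show ?thesis
        unfolding E_def mem_Collect_eq by (intro exI[of _ "max k l"] exI[of _ D]) simp
    qed
    show "(\<lambda>n. measure (L n) V) \<longlonglongrightarrow> measure N V" if "V \<in> E" for V
      using that conv by (auto simp: E_def)
    show "countable K" using K(1) B(2) by (rule countable_subset)
    show "K \<subseteq> E" using K(1) \<open>B \<subseteq> E\<close> by auto
  qed (use sets K e in auto)
qed

section \<open>Disintegration along a conditional law\<close>

text \<open>
  If \<open>K\<close> is the conditional law of \<open>X\<close> given \<open>G\<close>, then the joint law of \<open>X\<close> and the identity on \<open>(\<Omega>, G)\<close> is
  the law obtained by drawing \<open>\<omega>\<close> first and then \<open>x\<close> from \<open>K \<omega>\<close>. The two measures agree on rectangles by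
  the definition of the conditional law, and rectangles generate the product.
\<close>
lemma disintegration:
  fixes X :: "'w \<Rightarrow> 'a"
  assumes M: "prob_space M" and G: "subalgebra M G"
    and X [measurable]: "X \<in> M \<rightarrow>\<^sub>M S" and K [measurable]: "K \<in> G \<rightarrow>\<^sub>M prob_algebra S"
    and cond: "\<And>A. A \<in> sets S \<Longrightarrow>
      AE \<omega> in M. real_cond_exp M G (indicator (X -` A \<inter> space M)) \<omega> = measure (K \<omega>) A"
    and g: "g \<in> borel_measurable (G \<Otimes>\<^sub>M S)"
  shows "(\<integral>\<^sup>+\<omega>. g (\<omega>, X \<omega>) \<partial>M) = (\<integral>\<^sup>+\<omega>. (\<integral>\<^sup>+x. g (\<omega>, x) \<partial>K \<omega>) \<partial>M)"
proof -
  interpret M: prob_space M by (rule M)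
  interpret G: finite_measure_subalgebra M G using G by unfold_locales
  define R where "R = restr_to_subalg M G"
  have space_G: "space G = space M" using G by (simp add: subalgebra_def)
  have sets_R [measurable_cong]: "sets R = sets G" unfolding R_def by (rule sets_restr_to_subalg[OF G])
  have space_R: "space R = space M" using sets_eq_imp_space_eq[OF sets_R] space_G by simp
  have id_G: "(\<lambda>\<omega>. \<omega>) \<in> M \<rightarrow>\<^sub>M G" using G by (rule measurable_from_subalg) simp
  have pair [measurable]: "(\<lambda>\<omega>. (\<omega>, X \<omega>)) \<in> M \<rightarrow>\<^sub>M G \<Otimes>\<^sub>M S"
    using id_G X by (rule measurable_Pair)
  have K_sub [measurable]: "K \<in> G \<rightarrow>\<^sub>M subprob_algebra S" by (rule measurable_prob_algebraD[OF K])
  have K_prob: "prob_space (K \<omega>)" "sets (K \<omega>) = sets S" if "\<omega> \<in> space M" for \<omega>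
    using measurable_space[OF K, of \<omega>] that space_G by (auto simp: space_prob_algebra)
  define \<kappa> where "\<kappa> \<omega> = distr (K \<omega>) (G \<Otimes>\<^sub>M S) (Pair \<omega>)" for \<omega>
  have "\<kappa> \<in> G \<rightarrow>\<^sub>M subprob_algebra (G \<Otimes>\<^sub>M S)"
    unfolding \<kappa>_def by (rule measurable_distr2[OF _ K_sub]) simp
  then have \<kappa>: "\<kappa> \<in> R \<rightarrow>\<^sub>M subprob_algebra (G \<Otimes>\<^sub>M S)"
    by (simp only: measurable_cong_sets[OF sets_R refl])
  have Pair_meas: "Pair \<omega> \<in> K \<omega> \<rightarrow>\<^sub>M G \<Otimes>\<^sub>M S" if "\<omega> \<in> space M" for \<omega>
    using that K_prob(2)[OF that] space_G by (simp cong: measurable_cong_sets)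
  have eq: "distr M (G \<Otimes>\<^sub>M S) (\<lambda>\<omega>. (\<omega>, X \<omega>)) = R \<bind> \<kappa>"
  proof (rule measure_eqI_generator_eq[OF Int_stable_pair_measure_generator[of G S]])
    have "R \<noteq> R \<or> space R \<noteq> {}" using M.not_empty space_R by simp
    then show "sets (R \<bind> \<kappa>) = sigma_sets (space G \<times> space S) {a \<times> b |a b. a \<in> sets G \<and> b \<in> sets S}"
      unfolding sets_pair_measure[symmetric] using \<kappa> by (subst sets_bind[where N="G \<Otimes>\<^sub>M S"])
        (auto dest: sets_kernel)
    show "{a \<times> b |a b. a \<in> sets G \<and> b \<in> sets S} \<subseteq> Pow (space G \<times> space S)"
      by (rule pair_measure_closed)
    fix E assume "E \<in> {a \<times> b |a b. a \<in> sets G \<and> b \<in> sets S}"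
    then obtain B A where E: "E = B \<times> A" "B \<in> sets G" "A \<in> sets S" by auto
    have B: "B \<in> sets M" using E(2) G by (auto simp: subalgebra_def)
    have XA: "X -` A \<inter> space M \<in> sets M" using E(3) by measurable
    have "emeasure (distr M (G \<Otimes>\<^sub>M S) (\<lambda>\<omega>. (\<omega>, X \<omega>))) E = emeasure M (B \<inter> (X -` A \<inter> space M))"
      using E sets.sets_into_space[OF B] by (subst emeasure_distr) (auto intro!: arg_cong[where f="emeasure M"])
    also have "\<dots> = ennreal (LINT \<omega>|M. indicator B \<omega> * indicator (X -` A \<inter> space M) \<omega>)"
      using B XA by (simp add: indicator_inter_arith[symmetric] M.emeasure_eq_measure)
    also have "(LINT \<omega>|M. indicator B \<omega> * indicator (X -` A \<inter> space M) \<omega>) =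
        (LINT \<omega>|M. indicator B \<omega> * real_cond_exp M G (indicator (X -` A \<inter> space M)) \<omega>)"
      using B XA E(2) by (intro G.real_cond_exp_intg(2)[symmetric])
        (auto simp: indicator_inter_arith[symmetric] M.emeasure_eq_measure)
    also have "\<dots> = (LINT \<omega>|M. indicator B \<omega> * measure (K \<omega>) A)"
    proof (rule integral_cong_AE)
      have "(\<lambda>\<omega>. measure (K \<omega>) A) \<in> borel_measurable G" using E(3) by measurable
      then have "(\<lambda>\<omega>. measure (K \<omega>) A) \<in> borel_measurable M" by (rule measurable_from_subalg[OF G])
      then show "(\<lambda>\<omega>. indicator B \<omega> * measure (K \<omega>) A) \<in> borel_measurable M" using B by measurable
      show "AE \<omega> in M. indicator B \<omega> * real_cond_exp M G (indicator (X -` A \<inter> space M)) \<omega> =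
          indicator B \<omega> * measure (K \<omega>) A"
        using cond[OF E(3)] by eventually_elim simp
      show "(\<lambda>\<omega>. indicator B \<omega> * real_cond_exp M G (indicator (X -` A \<inter> space M)) \<omega>) \<in> borel_measurable M"
        using B by measurable
    qed
    also have "ennreal (LINT \<omega>|M. indicator B \<omega> * measure (K \<omega>) A) =
        (\<integral>\<^sup>+\<omega>. ennreal (indicator B \<omega> * measure (K \<omega>) A) \<partial>M)"
    proof (rule nn_integral_eq_integral[symmetric])
      have "(\<lambda>\<omega>. measure (K \<omega>) A) \<in> borel_measurable G" using E(3) by measurable
      then have [measurable]: "(\<lambda>\<omega>. measure (K \<omega>) A) \<in> borel_measurable M" by (rule measurable_from_subalg[OF G])
      show "integrable M (\<lambda>\<omega>. indicator B \<omega> * measure (K \<omega>) A)"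
        using B prob_space.prob_le_1[OF K_prob(1)]
        by (intro M.integrable_const_bound[where B=1]) (simp_all add: indicator_def)
    qed simp
    also have "\<dots> = (\<integral>\<^sup>+\<omega>. emeasure (\<kappa> \<omega>) E \<partial>M)"
    proof (rule nn_integral_cong)
      fix \<omega> assume \<omega>: "\<omega> \<in> space M"
      interpret K: prob_space "K \<omega>" by (rule K_prob(1)[OF \<omega>])
      have "emeasure (\<kappa> \<omega>) E = emeasure (K \<omega>) (Pair \<omega> -` E \<inter> space (K \<omega>))"
        unfolding \<kappa>_def by (rule emeasure_distr[OF Pair_meas[OF \<omega>]]) (simp add: E)
      also have "Pair \<omega> -` E \<inter> space (K \<omega>) = (if \<omega> \<in> B then A else {})"
        using sets.sets_into_space[OF E(3)]
        unfolding E(1) sets_eq_imp_space_eq[OF K_prob(2)[OF \<omega>]] by auto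
      finally show "ennreal (indicator B \<omega> * measure (K \<omega>) A) = emeasure (\<kappa> \<omega>) E"
        by (simp add: K.emeasure_eq_measure)
    qed
    also have "\<dots> = (\<integral>\<^sup>+\<omega>. emeasure (\<kappa> \<omega>) E \<partial>R)"
    proof -
      have "(\<lambda>\<omega>. emeasure (\<kappa> \<omega>) E) \<in> borel_measurable R"
        by (rule measurable_emeasure_kernel[OF \<kappa>]) (simp add: E)
      then have "(\<lambda>\<omega>. emeasure (\<kappa> \<omega>) E) \<in> borel_measurable G" by (simp only: measurable_cong_sets[OF sets_R refl])
      then show ?thesis unfolding R_def by (rule nn_integral_subalgebra2[OF G, symmetric])
    qed
    also have "\<dots> = emeasure (R \<bind> \<kappa>) E"
      using E M.not_empty space_R by (intro emeasure_bind[symmetric, OF _ \<kappa>]) auto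
    finally show "emeasure (distr M (G \<Otimes>\<^sub>M S) (\<lambda>\<omega>. (\<omega>, X \<omega>))) E = emeasure (R \<bind> \<kappa>) E" .
  next
    show "sets (distr M (G \<Otimes>\<^sub>M S) (\<lambda>\<omega>. (\<omega>, X \<omega>))) =
        sigma_sets (space G \<times> space S) {a \<times> b |a b. a \<in> sets G \<and> b \<in> sets S}"
      by (simp add: sets_pair_measure)
    show "range (\<lambda>_::nat. space G \<times> space S) \<subseteq> {a \<times> b |a b. a \<in> sets G \<and> b \<in> sets S}" by auto
    interpret D: prob_space "distr M (G \<Otimes>\<^sub>M S) (\<lambda>\<omega>. (\<omega>, X \<omega>))"
      by (rule M.prob_space_distr[OF pair])
    show "emeasure (distr M (G \<Otimes>\<^sub>M S) (\<lambda>\<omega>. (\<omega>, X \<omega>))) (space G \<times> space S) \<noteq> \<infinity>"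
      using D.emeasure_finite by simp
  qed simp
  have "(\<integral>\<^sup>+\<omega>. g (\<omega>, X \<omega>) \<partial>M) = (\<integral>\<^sup>+z. g z \<partial>distr M (G \<Otimes>\<^sub>M S) (\<lambda>\<omega>. (\<omega>, X \<omega>)))"
    using g by (subst nn_integral_distr) auto
  also have "\<dots> = (\<integral>\<^sup>+\<omega>. \<integral>\<^sup>+z. g z \<partial>\<kappa> \<omega> \<partial>R)"
    unfolding eq by (rule nn_integral_bind[OF g \<kappa>])
  also have "\<dots> = (\<integral>\<^sup>+\<omega>. \<integral>\<^sup>+z. g z \<partial>\<kappa> \<omega> \<partial>M)"
  proof -
    have "(\<lambda>\<omega>. \<integral>\<^sup>+z. g z \<partial>\<kappa> \<omega>) \<in> borel_measurable R"
      by (rule measurable_compose[OF \<kappa> nn_integral_measurable_subprob_algebra[OF g]])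
    then have "(\<lambda>\<omega>. \<integral>\<^sup>+z. g z \<partial>\<kappa> \<omega>) \<in> borel_measurable G" by (simp only: measurable_cong_sets[OF sets_R refl])
    then show ?thesis unfolding R_def by (rule nn_integral_subalgebra2[OF G])
  qed
  also have "\<dots> = (\<integral>\<^sup>+\<omega>. (\<integral>\<^sup>+x. g (\<omega>, x) \<partial>K \<omega>) \<partial>M)"
    unfolding \<kappa>_def by (rule nn_integral_cong) (simp add: nn_integral_distr[OF Pair_meas] g)
  finally show ?thesis .
qed

text \<open>
  The consequence for conditional expectations: given \<open>G\<close>, integrate the second argument against \<open>K \<omega>\<close>.
\<close>
lemma real_cond_exp_disintegration:
  fixes X :: "'w \<Rightarrow> 'a" and h :: "'w \<times> 'a \<Rightarrow> real"
  assumes M: "prob_space M" and G: "subalgebra M G"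
    and X: "X \<in> M \<rightarrow>\<^sub>M S" and K: "K \<in> G \<rightarrow>\<^sub>M prob_algebra S"
    and cond: "\<And>A. A \<in> sets S \<Longrightarrow>
      AE \<omega> in M. real_cond_exp M G (indicator (X -` A \<inter> space M)) \<omega> = measure (K \<omega>) A"
    and h: "h \<in> borel_measurable (G \<Otimes>\<^sub>M S)" and h01: "\<And>z. 0 \<le> h z" "\<And>z. h z \<le> 1"
  shows "AE \<omega> in M. real_cond_exp M G (\<lambda>\<omega>. h (\<omega>, X \<omega>)) \<omega> = (LINT x|K \<omega>. h (\<omega>, x))"
proof -
  interpret M: prob_space M by (rule M)
  interpret G: finite_measure_subalgebra M G using G by unfold_locales
  have space_G: "space G = space M" using G by (simp add: subalgebra_def)
  have id_G: "(\<lambda>\<omega>. \<omega>) \<in> M \<rightarrow>\<^sub>M G" using G by (rule measurable_from_subalg) simp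
  have hX: "(\<lambda>\<omega>. h (\<omega>, X \<omega>)) \<in> borel_measurable M"
    by (rule measurable_compose[OF measurable_Pair[OF id_G X] h])
  have K_prob: "prob_space (K \<omega>)" "sets (K \<omega>) = sets S" if "\<omega> \<in> space M" for \<omega>
    using measurable_space[OF K, of \<omega>] that space_G by (auto simp: space_prob_algebra)
  have sect: "(\<lambda>x. h (\<omega>, x)) \<in> borel_measurable (K \<omega>)" if "\<omega> \<in> space M" for \<omega>
  proof -
    have "(\<lambda>x. h (\<omega>, x)) \<in> borel_measurable S"
      using that space_G by (intro measurable_compose[OF measurable_Pair1' h]) simp
    then show ?thesis by (simp only: measurable_cong_sets[OF K_prob(2)[OF that] refl])
  qed
  define H where "H \<omega> = (LINT x|K \<omega>. h (\<omega>, x))" for \<omega>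
  have H01: "0 \<le> H \<omega>" "H \<omega> \<le> 1" if "\<omega> \<in> space M" for \<omega>
  proof -
    interpret K: prob_space "K \<omega>" by (rule K_prob(1)[OF that])
    show "0 \<le> H \<omega>" unfolding H_def using h01 by simp
    show "H \<omega> \<le> 1" unfolding H_def
      using h01 sect[OF that] by (intro K.integral_le_const K.integrable_const_bound[where B=1]) auto
  qed
  have nn_H: "(\<integral>\<^sup>+x. ennreal (h (\<omega>, x)) \<partial>K \<omega>) = ennreal (H \<omega>)" if "\<omega> \<in> space M" for \<omega>
  proof -
    interpret K: prob_space "K \<omega>" by (rule K_prob(1)[OF that])
    show ?thesis unfolding H_def
      using h01 sect[OF that] by (intro nn_integral_eq_integral K.integrable_const_bound[where B=1]) auto
  qed
  have H_meas: "H \<in> borel_measurable G"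
  proof -
    have "(\<lambda>\<omega>. \<integral>\<^sup>+x. ennreal (h (\<omega>, x)) \<partial>K \<omega>) \<in> borel_measurable G"
      by (rule nn_integral_measurable_subprob_algebra2[OF _ measurable_prob_algebraD[OF K]])
         (use h in simp)
    then have "(\<lambda>\<omega>. enn2real (\<integral>\<^sup>+x. ennreal (h (\<omega>, x)) \<partial>K \<omega>)) \<in> borel_measurable G" by measurable
    then show ?thesis
      by (rule measurable_cong[THEN iffD1, rotated]) (simp add: nn_H H01 space_G)
  qed
  have H_meas_M: "H \<in> borel_measurable M" by (rule measurable_from_subalg[OF G H_meas])
  have "AE \<omega> in M. real_cond_exp M G (\<lambda>\<omega>. h (\<omega>, X \<omega>)) \<omega> = H \<omega>"
  proof (rule G.real_cond_exp_charact)
    show "integrable M (\<lambda>\<omega>. h (\<omega>, X \<omega>))"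
      using h01 hX by (intro M.integrable_const_bound[where B=1]) auto
    show "integrable M H"
      using H01 H_meas_M by (intro M.integrable_const_bound[where B=1]) auto
    fix B assume B: "B \<in> sets G"
    then have BM: "B \<in> sets M" using G by (auto simp: subalgebra_def)
    have "(\<integral>\<^sup>+\<omega>. ennreal (indicator B \<omega> * h (\<omega>, X \<omega>)) \<partial>M) =
        (\<integral>\<^sup>+\<omega>. (\<integral>\<^sup>+x. ennreal (indicator B \<omega> * h (\<omega>, x)) \<partial>K \<omega>) \<partial>M)"
    proof (rule disintegration[OF M G X K cond, where g="\<lambda>z. ennreal (indicator B (fst z) * h z)", simplified])
      show "(\<lambda>z. ennreal (indicator B (fst z) * h z)) \<in> borel_measurable (G \<Otimes>\<^sub>M S)"
        using h B by measurable
    qed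
    also have "\<dots> = (\<integral>\<^sup>+\<omega>. ennreal (indicator B \<omega> * H \<omega>) \<partial>M)"
      by (intro nn_integral_cong) (auto simp: indicator_def nn_H)
    finally have nn: "(\<integral>\<^sup>+\<omega>. ennreal (indicator B \<omega> * h (\<omega>, X \<omega>)) \<partial>M) =
        (\<integral>\<^sup>+\<omega>. ennreal (indicator B \<omega> * H \<omega>) \<partial>M)" .
    have "(LINT \<omega>|M. indicator B \<omega> * h (\<omega>, X \<omega>)) =
        enn2real (\<integral>\<^sup>+\<omega>. ennreal (indicator B \<omega> * h (\<omega>, X \<omega>)) \<partial>M)"
      using BM hX h01 by (intro integral_eq_nn_integral) (auto simp: indicator_def)
    moreover have "(LINT \<omega>|M. indicator B \<omega> * H \<omega>) =
        enn2real (\<integral>\<^sup>+\<omega>. ennreal (indicator B \<omega> * H \<omega>) \<partial>M)"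
      using BM H_meas_M H01 by (intro integral_eq_nn_integral) (auto simp: indicator_def)
    ultimately show "(LINT \<omega>:B|M. h (\<omega>, X \<omega>)) = (LINT \<omega>:B|M. H \<omega>)"
      unfolding set_lebesgue_integral_def by (simp add: nn)
  qed (rule H_meas)
  then show ?thesis unfolding H_def .
qed

section \<open>The a.c.i.d. property\<close>

locale recursive_sampling = score_family \<mu> p \<Theta> C \<epsilon> + M: prob_space M
  for \<mu> :: "'a::euclidean_space measure" and p :: "'a \<Rightarrow> real \<Rightarrow> real"
    and \<Theta> :: "real set" and C \<epsilon> :: real and M :: "'w measure" +
  fixes \<eta> :: "nat \<Rightarrow> real" and \<theta>0 :: real and X :: "nat \<Rightarrow> 'w \<Rightarrow> 'a"
  assumes sampled: "recursively_sampled M \<mu> p \<Theta> \<eta> \<theta>0 X"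
    and eta_square_summable: "summable (\<lambda>n. (\<eta> (n + 1))\<^sup>2)"
begin

abbreviation G where "G \<equiv> natural_filtration M X"
abbreviation \<theta> where "\<theta> \<equiv> theta_hat \<mu> p \<eta> \<theta>0 X"
abbreviation law where "law \<equiv> P_law \<mu> p"

lemma X_measurable: "X (Suc n) \<in> borel_measurable M"
  using sampled by (simp add: recursively_sampled_def)

lemma theta_in: "\<omega> \<in> space M \<Longrightarrow> \<theta> n \<omega> \<in> \<Theta>"
  using sampled by (simp add: recursively_sampled_def)

lemma theta0_in: "\<theta>0 \<in> \<Theta>"
  using M.not_empty theta_in[of _ 0] by auto

lemma space_G [simp]: "space (G n) = space M"
  by (simp add: natural_filtration_def space_measure_of_conv)

lemma sets_G: "sets (G n) =
    sigma_sets (space M) {X i -` A \<inter> space M | i A. i \<in> {1..n} \<and> A \<in> sets borel}"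
  unfolding natural_filtration_def by (rule sets_measure_of) auto

lemma subalgebra_G: "subalgebra M (G n)"
  unfolding subalgebra_def
proof
  show "sets (G n) \<subseteq> sets M"
    unfolding sets_G
  proof (rule sets.sigma_sets_subset, safe)
    fix i and A :: "'a set" assume "i \<in> {1..n}" "A \<in> sets borel"
    then show "X i -` A \<inter> space M \<in> sets M"
      using X_measurable[of "i - 1"] by (auto intro: measurable_sets)
  qed
qed simp

lemma subalgebra_G_mono: "m \<le> n \<Longrightarrow> subalgebra (G n) (G m)"
  unfolding subalgebra_def sets_G space_G
  by (intro conjI refl sigma_sets_mono' Collect_mono impI, elim exE conjE, intro exI conjI, assumption) auto

lemma X_measurable_G: "i < n \<Longrightarrow> X (Suc i) \<in> borel_measurable (G n)"
  by (intro measurableI) (auto simp: sets_G intro!: sigma_sets.Basic exI[of _ "Suc i"])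

text \<open>
  The score step, set to \<open>0\<close> outside \<open>\<Theta>\<close> so that it is a Borel function on the whole space.
\<close>
definition step where "step x t = indicator \<Theta> t * score_step \<mu> p x t"

lemma step_eq: "t \<in> \<Theta> \<Longrightarrow> step x t = score_step \<mu> p x t"
  by (simp add: step_def)

lemma fisher_measurable [measurable]: "(\<lambda>t. indicator \<Theta> t * fisher \<mu> p t) \<in> borel_measurable borel"
  using borel_measurable_continuous_on_indicator[OF Theta_borel fisher_cont] by simp

lemma step_joint [measurable]: "(\<lambda>(x, t). step x t) \<in> borel_measurable (borel \<Otimes>\<^sub>M borel)"
proof -
  have "(\<lambda>(x, t). step x t) = (\<lambda>z. inverse (indicator \<Theta> (snd z) * fisher \<mu> p (snd z)) *
      (case z of (x, t) \<Rightarrow> indicator \<Theta> t * score p x t))"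
    by (auto simp: step_def score_step_def indicator_def)
  also have "\<dots> \<in> borel_measurable (borel \<Otimes>\<^sub>M borel)"
    by (intro borel_measurable_times borel_measurable_inverse score_joint
        measurable_compose[OF measurable_snd fisher_measurable])
  finally show ?thesis .
qed

lemma theta_measurable: "\<theta> n \<in> borel_measurable (G n)"
proof (induction n)
  case (Suc n)
  have [measurable]: "\<theta> n \<in> borel_measurable (G (Suc n))"
    by (rule measurable_from_subalg[OF subalgebra_G_mono Suc]) simp
  have [measurable]: "X (Suc n) \<in> borel_measurable (G (Suc n))" by (rule X_measurable_G) simp
  have "(\<lambda>\<omega>. step (X (Suc n) \<omega>) (\<theta> n \<omega>)) \<in> borel_measurable (G (Suc n))"
    using measurable_compose[OF measurable_Pair step_joint, of "X (Suc n)" "G (Suc n)" "\<theta> n"] by simp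
  then have "(\<lambda>\<omega>. \<theta> n \<omega> + \<eta> (Suc n) * step (X (Suc n) \<omega>) (\<theta> n \<omega>)) \<in> borel_measurable (G (Suc n))"
    by measurable
  then show ?case
    by (rule measurable_cong[THEN iffD1, rotated]) (simp add: step_eq theta_in)
qed simp

lemma theta_measurable_G: "n \<le> m \<Longrightarrow> \<theta> n \<in> borel_measurable (G m)"
  by (rule measurable_from_subalg[OF subalgebra_G_mono theta_measurable])

lemma theta_measurable_M [measurable]: "\<theta> n \<in> borel_measurable M"
  by (rule measurable_from_subalg[OF subalgebra_G theta_measurable])

lemma law_kernel: "(\<lambda>\<omega>. law (\<theta> n \<omega>)) \<in> G n \<rightarrow>\<^sub>M prob_algebra borel"
proof (rule measurable_prob_algebra_generated[where \<Omega>=UNIV and G="sets borel"])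
  show "sets borel = sigma_sets UNIV (sets (borel :: 'a measure))"
    using sets.sigma_sets_eq[of "borel :: 'a measure"] by simp
  fix A :: "'a set" assume A [measurable]: "A \<in> sets borel"
  note [measurable] = theta_measurable[of n]
  define w where "w z = (case z of (x, t) \<Rightarrow> indicator \<Theta> t * p x t)" for z
  have [measurable]: "w \<in> borel_measurable (borel \<Otimes>\<^sub>M borel)"
    using p_joint unfolding w_def .
  have int: "(\<lambda>\<omega>. \<integral>\<^sup>+x. ennreal (w (x, \<theta> n \<omega>)) * indicator A x \<partial>\<mu>) \<in> borel_measurable (G n)"
    by measurable
  have eq: "emeasure (law (\<theta> n \<omega>)) A = (\<integral>\<^sup>+x. ennreal (w (x, \<theta> n \<omega>)) * indicator A x \<partial>\<mu>)"
    if "\<omega> \<in> space (G n)" for \<omega>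
    using theta_in[of \<omega> n] that p_measurable[of "\<theta> n \<omega>"]
    unfolding P_law_def by (subst emeasure_density) (auto simp: w_def sets_mu)
  show "(\<lambda>\<omega>. emeasure (law (\<theta> n \<omega>)) A) \<in> borel_measurable (G n)"
    by (rule iffD2[OF measurable_cong[OF eq] int])
qed (auto simp: Int_stable_def prob_P_law theta_in)

lemma cond_law:
  assumes "A \<in> sets borel"
  shows "AE \<omega> in M. real_cond_exp M (G n) (indicator (X (Suc n) -` A \<inter> space M)) \<omega> = measure (law (\<theta> n \<omega>)) A"
  using sampled assms unfolding recursively_sampled_def conditional_prob_def
  by (auto dest!: spec[of _ "Suc n"])

lemma nn_disintegration:
  assumes "g \<in> borel_measurable (G n \<Otimes>\<^sub>M borel)"
  shows "(\<integral>\<^sup>+\<omega>. g (\<omega>, X (Suc n) \<omega>) \<partial>M) = (\<integral>\<^sup>+\<omega>. (\<integral>\<^sup>+x. g (\<omega>, x) \<partial>law (\<theta> n \<omega>)) \<partial>M)"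
  by (rule disintegration[OF M.prob_space_axioms subalgebra_G X_measurable law_kernel cond_law assms])

lemma cond_exp_disintegration:
  assumes "h \<in> borel_measurable (G n \<Otimes>\<^sub>M borel)" "\<And>z. 0 \<le> h z" "\<And>z. h z \<le> 1"
  shows "AE \<omega> in M. real_cond_exp M (G n) (\<lambda>\<omega>. h (\<omega>, X (Suc n) \<omega>)) \<omega> = (LINT x|law (\<theta> n \<omega>). h (\<omega>, x))"
  by (rule real_cond_exp_disintegration[OF M.prob_space_axioms subalgebra_G X_measurable law_kernel cond_law assms])

text \<open>
  The estimates lie in \<open>\<Theta>\<close> at every time; by disintegration, almost every observation that could have been
  drawn at time \<open>n + 1\<close> keeps the next estimate in \<open>\<Theta>\<close>.
\<close>
lemma stays_inside:
  "AE \<omega> in M. AE x in law (\<theta> n \<omega>). \<theta> n \<omega> + \<eta> (Suc n) * score_step \<mu> p x (\<theta> n \<omega>) \<in> \<Theta>"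
proof -
  note [measurable] = theta_measurable[of n]
  define g where "g z = (indicator (- \<Theta>) (\<theta> n (fst z) + \<eta> (Suc n) * (\<lambda>(x, t). step x t) (snd z, \<theta> n (fst z))) :: ennreal)" for z
  have g: "g \<in> borel_measurable (G n \<Otimes>\<^sub>M borel)"
    unfolding g_def by measurable
  have "(\<integral>\<^sup>+\<omega>. (\<integral>\<^sup>+x. g (\<omega>, x) \<partial>law (\<theta> n \<omega>)) \<partial>M) = (\<integral>\<^sup>+\<omega>. g (\<omega>, X (Suc n) \<omega>) \<partial>M)"
    by (rule nn_disintegration[OF g, symmetric])
  also have "\<dots> = (\<integral>\<^sup>+\<omega>. 0 \<partial>M)"
    using theta_in[of _ "Suc n"] by (intro nn_integral_cong) (simp add: g_def step_eq theta_in)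
  finally have "(\<integral>\<^sup>+\<omega>. (\<integral>\<^sup>+x. g (\<omega>, x) \<partial>law (\<theta> n \<omega>)) \<partial>M) = 0" by simp
  moreover have "(\<lambda>\<omega>. \<integral>\<^sup>+x. g (\<omega>, x) \<partial>law (\<theta> n \<omega>)) \<in> borel_measurable M"
    by (rule measurable_from_subalg[OF subalgebra_G[of n]],
        rule nn_integral_measurable_subprob_algebra2[OF _ measurable_prob_algebraD[OF law_kernel]])
       (use g in simp)
  ultimately have ae: "AE \<omega> in M. (\<integral>\<^sup>+x. g (\<omega>, x) \<partial>law (\<theta> n \<omega>)) = 0"
    by (simp add: nn_integral_0_iff_AE)
  show ?thesis
  proof (rule AE_mp[OF ae], rule AE_I2, rule impI)
    fix \<omega> assume \<omega>: "\<omega> \<in> space M" and zero: "(\<integral>\<^sup>+x. g (\<omega>, x) \<partial>law (\<theta> n \<omega>)) = 0"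
    have "(\<lambda>x. g (\<omega>, x)) \<in> borel_measurable borel"
      using \<omega> by (intro measurable_compose[OF measurable_Pair1' g]) simp
    then have "AE x in law (\<theta> n \<omega>). g (\<omega>, x) = 0"
      using zero by (subst (asm) nn_integral_0_iff_AE) simp_all
    then show "AE x in law (\<theta> n \<omega>). \<theta> n \<omega> + \<eta> (Suc n) * score_step \<mu> p x (\<theta> n \<omega>) \<in> \<Theta>"
      by eventually_elim (use theta_in[OF \<omega>, of n] in \<open>simp add: g_def step_eq indicator_def split: if_splits\<close>)
  qed
qed

lemma measure_law_continuous:
  assumes A: "A \<in> sets borel"
  shows "continuous_on \<Theta> (\<lambda>t. measure (law t) A)"
proof -
  obtain L where L: "\<And>t u. t \<in> \<Theta> \<Longrightarrow> u \<in> \<Theta> \<Longrightarrow> \<bar>measure (law t) A - measure (law u) A\<bar> \<le> L * \<bar>t - u\<bar>"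
    using measure_lipschitz A by blast
  have "(\<bar>L\<bar>)-lipschitz_on \<Theta> (\<lambda>t. measure (law t) A)"
  proof (rule lipschitz_onI)
    fix t u assume "t \<in> \<Theta>" "u \<in> \<Theta>"
    then have "\<bar>measure (law t) A - measure (law u) A\<bar> \<le> L * \<bar>t - u\<bar>" by (rule L)
    also have "\<dots> \<le> \<bar>L\<bar> * \<bar>t - u\<bar>" by (intro mult_right_mono) auto
    finally show "dist (measure (law t) A) (measure (law u) A) \<le> \<bar>L\<bar> * dist t u"
      by (simp add: dist_real_def)
  qed simp
  then show ?thesis by (rule lipschitz_on_continuous_on)
qed

lemma measure_law_measurable:
  assumes "A \<in> sets borel"
  shows "(\<lambda>t. indicator \<Theta> t * measure (law t) A) \<in> borel_measurable borel"
  using borel_measurable_continuous_on_indicator[OF Theta_borel measure_law_continuous[OF assms]] by simp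

lemma measure_law_theta_measurable:
  assumes "A \<in> sets borel"
  shows "(\<lambda>\<omega>. measure (law (\<theta> n \<omega>)) A) \<in> borel_measurable (G n)"
proof -
  have "(\<lambda>\<omega>. indicator \<Theta> (\<theta> n \<omega>) * measure (law (\<theta> n \<omega>)) A) \<in> borel_measurable (G n)"
    by (rule measurable_compose[OF theta_measurable measure_law_measurable[OF assms]])
  then show ?thesis
    by (rule measurable_cong[THEN iffD1, rotated]) (simp add: theta_in)
qed

definition \<xi> where "\<xi> n \<omega> = C * ((\<eta> (n + 1))\<^sup>2 / (2 * fisher \<mu> p (\<theta> n \<omega>)))"

lemma xi_measurable: "\<xi> n \<in> borel_measurable (G n)"
proof -
  note [measurable] = theta_measurable[of n]
  have "(\<lambda>\<omega>. indicator \<Theta> (\<theta> n \<omega>) * fisher \<mu> p (\<theta> n \<omega>)) \<in> borel_measurable (G n)"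
    by (rule measurable_compose[OF theta_measurable fisher_measurable])
  then have "(\<lambda>\<omega>. C * ((\<eta> (n + 1))\<^sup>2 / (2 * (indicator \<Theta> (\<theta> n \<omega>) * fisher \<mu> p (\<theta> n \<omega>))))) \<in> borel_measurable (G n)"
    by measurable
  then show ?thesis
    by (rule measurable_cong[THEN iffD1, rotated]) (simp add: theta_in \<xi>_def)
qed

lemma xi_bounds:
  assumes "\<omega> \<in> space M"
  shows "0 \<le> \<xi> n \<omega>" "\<xi> n \<omega> \<le> C / (2 * \<epsilon>) * (\<eta> (n + 1))\<^sup>2"
proof -
  have t: "\<theta> n \<omega> \<in> \<Theta>" using theta_in[OF assms] .
  note I = score_square_integral(3,4)[OF t]
  have Cp: "0 < C" using C_pos[OF t] .
  show "0 \<le> \<xi> n \<omega>" using I Cp by (simp add: \<xi>_def)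
  have "(\<eta> (n + 1))\<^sup>2 / (2 * fisher \<mu> p (\<theta> n \<omega>)) \<le> (\<eta> (n + 1))\<^sup>2 / (2 * \<epsilon>)"
    using I eps_pos by (intro divide_left_mono) auto
  then have "\<xi> n \<omega> \<le> C * ((\<eta> (n + 1))\<^sup>2 / (2 * \<epsilon>))"
    unfolding \<xi>_def using Cp by (intro mult_left_mono) auto
  then show "\<xi> n \<omega> \<le> C / (2 * \<epsilon>) * (\<eta> (n + 1))\<^sup>2" by simp
qed

lemma xi_summable: "\<omega> \<in> space M \<Longrightarrow> summable (\<lambda>n. \<xi> n \<omega>)"
  using summable_mult[OF eta_square_summable, of "C / (2 * \<epsilon>)"]
  by (rule summable_comparison_test'[where N=0]) (simp only: real_norm_def abs_of_nonneg xi_bounds)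

text \<open>
  The conditional probability at time \<open>n + 2\<close> given the past is the probability of \<open>A\<close> at the estimate
  \<open>\<theta> (n + 1)\<close>, which is a function of \<open>\<theta> n\<close> and \<open>X (n + 1)\<close>. Its conditional expectation is the average over one step,
  bounded in \<open>mean_measure_after_step\<close>.
\<close>
theorem acid_sampling: "acid M G \<xi> X"
  unfolding acid_def
proof (intro conjI allI ballI)
  fix A :: "'a set" and n assume A: "A \<in> sets borel"
  interpret Gn: finite_measure_subalgebra M "G n" using subalgebra_G by unfold_locales
  note [measurable] = theta_measurable[of n] measure_law_measurable[OF A]
  define F where "F t = indicator \<Theta> t * measure (law t) A" for t
  define h where "h z = F (\<theta> n (fst z) + \<eta> (Suc n) * (\<lambda>(x, t). step x t) (snd z, \<theta> n (fst z)))" for z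
  have F01: "0 \<le> F t" "F t \<le> 1" for t
    using prob_space.prob_le_1[OF prob_P_law] by (auto simp: F_def indicator_def)
  have F_meas [measurable]: "F \<in> borel_measurable borel" unfolding F_def by measurable
  have h_meas: "h \<in> borel_measurable (G n \<Otimes>\<^sub>M borel)" unfolding h_def by measurable
  have hX: "h (\<omega>, X (Suc n) \<omega>) = measure (law (\<theta> (Suc n) \<omega>)) A" if "\<omega> \<in> space M" for \<omega>
    using theta_in[OF that, of n] theta_in[OF that, of "Suc n"] by (simp add: h_def F_def step_eq)
  have ae: "AE \<omega> in M. conditional_prob M (G (n + 1)) (X (n + 2) -` A \<inter> space M) \<omega> = h (\<omega>, X (Suc n) \<omega>)"
    using cond_law[OF A, of "Suc n"] by (rule AE_mp) (simp add: hX conditional_prob_def)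
  have hX_meas: "(\<lambda>\<omega>. h (\<omega>, X (Suc n) \<omega>)) \<in> borel_measurable M"
    using measurable_from_subalg[OF subalgebra_G measure_law_theta_measurable[OF A, of "Suc n"]]
    by (rule measurable_cong[THEN iffD1, rotated]) (simp only: hX)
  have "AE \<omega> in M. real_cond_exp M (G n) (conditional_prob M (G (n + 1)) (X (n + 2) -` A \<inter> space M)) \<omega> =
      real_cond_exp M (G n) (\<lambda>\<omega>. h (\<omega>, X (Suc n) \<omega>)) \<omega>"
    using ae hX_meas by (intro Gn.real_cond_exp_cong) (simp_all add: conditional_prob_def)
  moreover have "AE \<omega> in M. real_cond_exp M (G n) (\<lambda>\<omega>. h (\<omega>, X (Suc n) \<omega>)) \<omega> =
      (LINT x|law (\<theta> n \<omega>). h (\<omega>, x))"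
    using F01 by (intro cond_exp_disintegration h_meas) (auto simp: h_def)
  moreover have "AE \<omega> in M. \<omega> \<in> space M" by simp
  moreover note stays_inside[of n] cond_law[OF A, of n]
  ultimately show "AE \<omega> in M.
        real_cond_exp M (G n) (conditional_prob M (G (n + 1)) (X (n + 2) -` A \<inter> space M)) \<omega>
        \<le> conditional_prob M (G n) (X (n + 1) -` A \<inter> space M) \<omega> + \<xi> n \<omega>"
  proof eventually_elim
    case (elim \<omega>)
    have t: "\<theta> n \<omega> \<in> \<Theta>" using theta_in elim(3) .
    have "(LINT x|law (\<theta> n \<omega>). h (\<omega>, x)) \<le>
        measure (law (\<theta> n \<omega>)) A + C * ((\<eta> (Suc n))\<^sup>2 / (2 * fisher \<mu> p (\<theta> n \<omega>)))"
    proof (rule mean_measure_after_step[OF t A elim(4)])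
      show "(\<lambda>x. h (\<omega>, x)) \<in> borel_measurable borel"
        using elim(3) by (intro measurable_compose[OF measurable_Pair1' h_meas]) simp
      show "h (\<omega>, x) = measure (law (\<theta> n \<omega> + \<eta> (Suc n) * score_step \<mu> p x (\<theta> n \<omega>))) A"
        if "\<theta> n \<omega> + \<eta> (Suc n) * score_step \<mu> p x (\<theta> n \<omega>) \<in> \<Theta>" for x
        using that t by (simp add: h_def F_def step_eq)
    qed
    then show ?case using elim by (simp add: conditional_prob_def \<xi>_def)
  qed
qed (auto simp: xi_measurable xi_bounds)

end

section \<open>The limit law\<close>

context recursive_sampling
begin

text \<open>
  Martingale orthogonality: the score step is centred given the past, so the square of the increment adds
  its conditional mean \<open>\<eta>^2 / fisher\<close> and no cross term.
\<close>
lemma mean_square_increment: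
  assumes "n \<le> m"
  shows "(\<integral>\<^sup>+\<omega>. ennreal ((\<theta> (Suc m) \<omega> - \<theta> n \<omega>)\<^sup>2) \<partial>M)
    \<le> (\<integral>\<^sup>+\<omega>. ennreal ((\<theta> m \<omega> - \<theta> n \<omega>)\<^sup>2) \<partial>M) + ennreal ((\<eta> (Suc m))\<^sup>2 / \<epsilon>)"
proof -
  note [measurable] = theta_measurable[of m] theta_measurable_G[OF assms]
  define g where "g z = ennreal ((\<theta> m (fst z) - \<theta> n (fst z) +
      \<eta> (Suc m) * (\<lambda>(x, t). step x t) (snd z, \<theta> m (fst z)))\<^sup>2)" for z
  have g: "g \<in> borel_measurable (G m \<Otimes>\<^sub>M borel)" unfolding g_def by measurable
  have "(\<integral>\<^sup>+\<omega>. ennreal ((\<theta> (Suc m) \<omega> - \<theta> n \<omega>)\<^sup>2) \<partial>M) = (\<integral>\<^sup>+\<omega>. g (\<omega>, X (Suc m) \<omega>) \<partial>M)"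
    by (intro nn_integral_cong) (simp add: g_def step_eq theta_in algebra_simps)
  also have "\<dots> = (\<integral>\<^sup>+\<omega>. (\<integral>\<^sup>+x. g (\<omega>, x) \<partial>law (\<theta> m \<omega>)) \<partial>M)"
    by (rule nn_disintegration[OF g])
  also have "\<dots> \<le> (\<integral>\<^sup>+\<omega>. ennreal ((\<theta> m \<omega> - \<theta> n \<omega>)\<^sup>2) + ennreal ((\<eta> (Suc m))\<^sup>2 / \<epsilon>) \<partial>M)"
  proof (rule nn_integral_mono)
    fix \<omega> assume "\<omega> \<in> space M"
    then have t: "\<theta> m \<omega> \<in> \<Theta>" by (rule theta_in)
    have "(\<integral>\<^sup>+x. g (\<omega>, x) \<partial>law (\<theta> m \<omega>)) = ennreal ((\<theta> m \<omega> - \<theta> n \<omega>)\<^sup>2 + (\<eta> (Suc m))\<^sup>2 / fisher \<mu> p (\<theta> m \<omega>))"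
      unfolding mean_square_step[OF t, symmetric] by (simp add: g_def step_eq[OF t])
    also have "\<dots> \<le> ennreal ((\<theta> m \<omega> - \<theta> n \<omega>)\<^sup>2 + (\<eta> (Suc m))\<^sup>2 / \<epsilon>)"
      using score_square_integral(3,4)[OF t] eps_pos
      by (intro ennreal_leI add_left_mono divide_left_mono) auto
    also have "\<dots> = ennreal ((\<theta> m \<omega> - \<theta> n \<omega>)\<^sup>2) + ennreal ((\<eta> (Suc m))\<^sup>2 / \<epsilon>)"
      using eps_pos by (intro ennreal_plus) auto
    finally show "(\<integral>\<^sup>+x. g (\<omega>, x) \<partial>law (\<theta> m \<omega>)) \<le> \<dots>" .
  qed
  also have "\<dots> = (\<integral>\<^sup>+\<omega>. ennreal ((\<theta> m \<omega> - \<theta> n \<omega>)\<^sup>2) \<partial>M) + ennreal ((\<eta> (Suc m))\<^sup>2 / \<epsilon>)"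
    by (subst nn_integral_add) (auto simp: M.emeasure_space_1)
  finally show ?thesis .
qed

lemma mean_square_le:
  assumes "n \<le> m"
  shows "(\<integral>\<^sup>+\<omega>. ennreal ((\<theta> m \<omega> - \<theta> n \<omega>)\<^sup>2) \<partial>M) \<le> ennreal (\<Sum>k\<in>{n..<m}. (\<eta> (Suc k))\<^sup>2 / \<epsilon>)"
  using assms
proof (induction m rule: dec_induct)
  case (step m)
  have "(\<integral>\<^sup>+\<omega>. ennreal ((\<theta> (Suc m) \<omega> - \<theta> n \<omega>)\<^sup>2) \<partial>M)
      \<le> ennreal (\<Sum>k\<in>{n..<m}. (\<eta> (Suc k))\<^sup>2 / \<epsilon>) + ennreal ((\<eta> (Suc m))\<^sup>2 / \<epsilon>)"
    using mean_square_increment[OF step.hyps(1)] step.IH by (rule order_trans[OF _ add_right_mono])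
  also have "\<dots> = ennreal (\<Sum>k\<in>{n..<Suc m}. (\<eta> (Suc k))\<^sup>2 / \<epsilon>)"
    using step.hyps(1) eps_pos by (simp add: sum_nonneg flip: ennreal_plus)
  finally show ?case .
qed simp

text \<open>
  The resulting bound for the \<open>L\<^sup>2\<close> distance of \<open>\<theta> n\<close> to all later estimates.
\<close>
definition \<delta> where "\<delta> n = sqrt ((\<Sum>k. (\<eta> (k + n + 1))\<^sup>2) / \<epsilon>)"

lemma delta_tendsto: "\<delta> \<longlonglongrightarrow> 0"
proof -
  have "(\<lambda>n. \<Sum>k. (\<eta> (k + n + 1))\<^sup>2) \<longlonglongrightarrow> 0"
    using suminf_exist_split2[OF eta_square_summable] by simp
  then have "\<delta> \<longlonglongrightarrow> sqrt (0 / \<epsilon>)"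
    unfolding \<delta>_def using eps_pos by (intro tendsto_intros) auto
  then show ?thesis by simp
qed

lemma mean_abs_le:
  assumes "n \<le> m"
  shows "(\<integral>\<^sup>+\<omega>. ennreal \<bar>\<theta> m \<omega> - \<theta> n \<omega>\<bar> \<partial>M) \<le> ennreal (\<delta> n)"
proof -
  define s where "s = (\<Sum>k. (\<eta> (k + n + 1))\<^sup>2) / \<epsilon>"
  have summable: "summable (\<lambda>k. (\<eta> (k + n + 1))\<^sup>2)"
    using summable_ignore_initial_segment[OF eta_square_summable, of n] by simp
  have "(\<Sum>k\<in>{n..<m}. (\<eta> (Suc k))\<^sup>2) = (\<Sum>k<m - n. (\<eta> (k + n + 1))\<^sup>2)"
    using sum.shift_bounds_nat_ivl[of "\<lambda>k. (\<eta> (Suc k))\<^sup>2" 0 n "m - n"] assms by (simp add: atLeast0LessThan)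
  also have "\<dots> \<le> (\<Sum>k. (\<eta> (k + n + 1))\<^sup>2)"
    by (intro sum_le_suminf summable) auto
  finally have "(\<Sum>k\<in>{n..<m}. (\<eta> (Suc k))\<^sup>2 / \<epsilon>) \<le> s"
    using eps_pos unfolding s_def sum_divide_distrib[symmetric] by (intro divide_right_mono) auto
  then have sq: "(\<integral>\<^sup>+\<omega>. ennreal ((\<theta> m \<omega> - \<theta> n \<omega>)\<^sup>2) \<partial>M) \<le> ennreal s"
    by (intro order_trans[OF mean_square_le[OF assms]] ennreal_leI)
  have s0: "0 \<le> s" unfolding s_def using eps_pos summable by (auto intro!: divide_nonneg_pos suminf_nonneg)
  define a where "a = (\<integral>\<^sup>+\<omega>. ennreal \<bar>\<theta> m \<omega> - \<theta> n \<omega>\<bar> \<partial>M)"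
  have "a\<^sup>2 \<le> (\<integral>\<^sup>+\<omega>. (ennreal \<bar>\<theta> m \<omega> - \<theta> n \<omega>\<bar>)\<^sup>2 \<partial>M)"
    unfolding a_def
    using Cauchy_Schwarz_nn_integral[of "\<lambda>\<omega>. ennreal \<bar>\<theta> m \<omega> - \<theta> n \<omega>\<bar>" M "\<lambda>_. 1"]
    by (simp add: M.emeasure_space_1)
  also have "\<dots> = (\<integral>\<^sup>+\<omega>. ennreal ((\<theta> m \<omega> - \<theta> n \<omega>)\<^sup>2) \<partial>M)"
    by (simp add: ennreal_power)
  finally have "a\<^sup>2 \<le> ennreal s" using sq by (rule order_trans)
  then have "a \<le> ennreal (sqrt s)"
  proof (cases a rule: ennreal_cases)
    case (real r)
    with \<open>a\<^sup>2 \<le> ennreal s\<close> s0 have "r\<^sup>2 \<le> s" by (simp add: ennreal_power)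
    then show ?thesis using real by (simp add: real_le_rsqrt ennreal_leI)
  qed (auto simp: top_unique power2_eq_square ennreal_top_mult)
  then show ?thesis by (simp add: a_def \<delta>_def s_def)
qed

text \<open>
  The estimates have an \<open>L\<^sup>1\<close> limit with values in the closure of \<open>\<Theta>\<close>, and the limit kernel is the extended
  family evaluated there. The Lipschitz bound turns the rate for the estimates into a rate for
  probabilities.
\<close>
lemma limit_kernel:
  "\<exists>Q. (\<forall>\<omega>\<in>space M. prob_space (Q \<omega>) \<and> sets (Q \<omega>) = sets borel) \<and>
    (\<forall>A\<in>sets borel. (\<lambda>\<omega>. measure (Q \<omega>) A) \<in> borel_measurable M \<and>
      (\<lambda>n. LINT \<omega>|M. \<bar>measure (law (\<theta> n \<omega>)) A - measure (Q \<omega>) A\<bar>) \<longlonglongrightarrow> 0)"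
proof -
  obtain L where L: "\<forall>t\<in>\<Theta>. \<forall>u\<in>\<Theta>. \<forall>A\<in>sets borel.
      \<bar>measure (law t) A - measure (law u) A\<bar> \<le> L * \<bar>t - u\<bar>"
    using measure_lipschitz by (elim exE)
  have "\<exists>P. \<forall>t\<in>closure \<Theta>. prob_space (P t) \<and> sets (P t) = sets borel \<and>
      (\<forall>u\<in>\<Theta>. \<forall>A\<in>sets borel. \<bar>measure (P t) A - measure (law u) A\<bar> \<le> L * \<bar>t - u\<bar>)"
    using L by (intro lipschitz_family_extends_to_closure prob_P_law sets_P_law) auto
  then obtain P where P0: "\<forall>t\<in>closure \<Theta>. prob_space (P t) \<and> sets (P t) = sets borel \<and>
      (\<forall>u\<in>\<Theta>. \<forall>A\<in>sets borel. \<bar>measure (P t) A - measure (law u) A\<bar> \<le> L * \<bar>t - u\<bar>)"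
    by (elim exE)
  have P: "prob_space (P t)" "sets (P t) = sets borel"
    "u \<in> \<Theta> \<Longrightarrow> A \<in> sets borel \<Longrightarrow> \<bar>measure (P t) A - measure (law u) A\<bar> \<le> L * \<bar>t - u\<bar>"
    if "t \<in> closure \<Theta>" for t u A
    using P0 that by auto
  obtain Z r where Z [measurable]: "Z \<in> borel_measurable M"
    and lim: "AE \<omega> in M. (\<lambda>k. \<theta> (r k) \<omega>) \<longlonglongrightarrow> Z \<omega>"
    and L1: "\<And>n. (\<integral>\<^sup>+\<omega>. ennreal \<bar>\<theta> n \<omega> - Z \<omega>\<bar> \<partial>M) \<le> ennreal (\<delta> n)"
  proof -
    have "\<exists>Z r. Z \<in> borel_measurable M \<and> (AE \<omega> in M. (\<lambda>k. \<theta> (r k) \<omega>) \<longlonglongrightarrow> Z \<omega>) \<and>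
        (\<forall>n. (\<integral>\<^sup>+\<omega>. ennreal \<bar>\<theta> n \<omega> - Z \<omega>\<bar> \<partial>M) \<le> ennreal (\<delta> n))"
      by (intro L1_Cauchy_limit theta_measurable_M mean_abs_le delta_tendsto)
    then show ?thesis by (elim exE conjE) (rule that, auto)
  qed
  \<comment> \<open>\<open>Z\<close> lies in the closure of \<open>\<Theta>\<close> almost surely only; \<open>T\<close> corrects it on a null set\<close>
  define T where "T \<omega> = (if Z \<omega> \<in> closure \<Theta> then Z \<omega> else \<theta>0)" for \<omega>
  have T_in: "T \<omega> \<in> closure \<Theta>" for \<omega>
    using theta0_in closure_subset[of \<Theta>] by (auto simp: T_def)
  have [measurable]: "closure \<Theta> \<in> sets borel" by simp
  have T_meas: "T \<in> borel_measurable M" unfolding T_def by measurable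
  have "AE \<omega> in M. \<omega> \<in> space M" by simp
  with lim have T_Z: "AE \<omega> in M. T \<omega> = Z \<omega>"
  proof eventually_elim
    case (elim \<omega>)
    then have "Z \<omega> \<in> closure \<Theta>" 
      unfolding closure_sequential by (intro exI[of _ "\<lambda>k. \<theta> (r k) \<omega>"]) (simp add: theta_in)
    then show ?case by (simp add: T_def)
  qed
  have meas: "(\<lambda>\<omega>. measure (P (T \<omega>)) A) \<in> borel_measurable M" if A: "A \<in> sets borel" for A
  proof -
    have lip: "\<bar>measure (P t) A - measure (P s) A\<bar> \<le> \<bar>L\<bar> * \<bar>t - s\<bar>"
      if t: "t \<in> closure \<Theta>" and s: "s \<in> closure \<Theta>" for t s
    proof -
      obtain x where x: "\<And>n. x n \<in> \<Theta>" "x \<longlonglongrightarrow> s" using s by (auto simp: closure_sequential)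
      have "\<bar>measure (P t) A - measure (P s) A\<bar> \<le> \<bar>L\<bar> * \<bar>t - x n\<bar> + \<bar>L\<bar> * \<bar>s - x n\<bar>" for n
      proof -
        have "L * \<bar>y\<bar> \<le> \<bar>L\<bar> * \<bar>y\<bar>" for y :: real by (intro mult_right_mono) auto
        from P(3)[OF t x(1)[of n] A] P(3)[OF s x(1)[of n] A] this[of "t - x n"] this[of "s - x n"]
        show ?thesis by linarith
      qed
      moreover have "(\<lambda>n. \<bar>L\<bar> * \<bar>t - x n\<bar> + \<bar>L\<bar> * \<bar>s - x n\<bar>) \<longlonglongrightarrow> \<bar>L\<bar> * \<bar>t - s\<bar> + \<bar>L\<bar> * \<bar>s - s\<bar>"
        by (intro tendsto_intros x(2))
      ultimately have "\<bar>measure (P t) A - measure (P s) A\<bar> \<le> \<bar>L\<bar> * \<bar>t - s\<bar> + \<bar>L\<bar> * \<bar>s - s\<bar>"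
        by (intro LIMSEQ_le_const) auto
      then show ?thesis by simp
    qed
    have "\<bar>L\<bar>-lipschitz_on (closure \<Theta>) (\<lambda>t. measure (P t) A)"
      by (rule lipschitz_onI) (use lip in \<open>simp_all add: dist_real_def\<close>)
    then have "continuous_on (closure \<Theta>) (\<lambda>t. measure (P t) A)"
      by (rule lipschitz_on_continuous_on)
    then have "(\<lambda>t. indicator (closure \<Theta>) t *\<^sub>R measure (P t) A) \<in> borel_measurable borel"
      by (intro borel_measurable_continuous_on_indicator) auto
    from measurable_compose[OF T_meas this] show ?thesis by (simp add: T_in)
  qed
  have conv: "(\<lambda>n. LINT \<omega>|M. \<bar>measure (law (\<theta> n \<omega>)) A - measure (P (T \<omega>)) A\<bar>) \<longlonglongrightarrow> 0"
    if A: "A \<in> sets borel" for A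
  proof (rule tendsto_sandwich[OF _ _ tendsto_const])
    have bound: "(LINT \<omega>|M. \<bar>measure (law (\<theta> n \<omega>)) A - measure (P (T \<omega>)) A\<bar>) \<le> \<bar>L\<bar> * \<delta> n" for n
    proof -
      have "0 \<le> \<delta> n" unfolding \<delta>_def using eps_pos
        summable_ignore_initial_segment[OF eta_square_summable, of n] by (auto intro!: divide_nonneg_pos suminf_nonneg)
      have [measurable]: "(\<lambda>\<omega>. measure (law (\<theta> n \<omega>)) A) \<in> borel_measurable M"
        by (rule measurable_from_subalg[OF subalgebra_G measure_law_theta_measurable[OF A]])
      note [measurable] = meas[OF A]
      have "(\<integral>\<^sup>+\<omega>. ennreal \<bar>measure (law (\<theta> n \<omega>)) A - measure (P (T \<omega>)) A\<bar> \<partial>M)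
          \<le> (\<integral>\<^sup>+\<omega>. ennreal \<bar>L\<bar> * ennreal \<bar>\<theta> n \<omega> - Z \<omega>\<bar> \<partial>M)"
      proof (rule nn_integral_mono_AE)
        have "AE \<omega> in M. \<omega> \<in> space M" by simp
        with T_Z show "AE \<omega> in M. ennreal \<bar>measure (law (\<theta> n \<omega>)) A - measure (P (T \<omega>)) A\<bar>
            \<le> ennreal \<bar>L\<bar> * ennreal \<bar>\<theta> n \<omega> - Z \<omega>\<bar>"
        proof eventually_elim
          case (elim \<omega>)
          have "\<bar>measure (P (T \<omega>)) A - measure (law (\<theta> n \<omega>)) A\<bar> \<le> L * \<bar>T \<omega> - \<theta> n \<omega>\<bar>"
            by (rule P(3)[OF T_in theta_in[OF elim(2)] A])
          also have "\<dots> \<le> \<bar>L\<bar> * \<bar>\<theta> n \<omega> - Z \<omega>\<bar>"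
            unfolding elim(1) by (subst abs_minus_commute) (intro mult_right_mono, auto)
          finally show ?case
            by (simp add: ennreal_mult[symmetric] abs_minus_commute ennreal_leI)
        qed
      qed
      also have "\<dots> = ennreal \<bar>L\<bar> * (\<integral>\<^sup>+\<omega>. ennreal \<bar>\<theta> n \<omega> - Z \<omega>\<bar> \<partial>M)"
        by (rule nn_integral_cmult) measurable
      also have "\<dots> \<le> ennreal \<bar>L\<bar> * ennreal (\<delta> n)"
        by (intro mult_left_mono L1) simp
      also have "\<dots> = ennreal (\<bar>L\<bar> * \<delta> n)" using \<open>0 \<le> \<delta> n\<close> by (simp add: ennreal_mult)
      finally have nn: "(\<integral>\<^sup>+\<omega>. ennreal \<bar>measure (law (\<theta> n \<omega>)) A - measure (P (T \<omega>)) A\<bar> \<partial>M)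
          \<le> ennreal (\<bar>L\<bar> * \<delta> n)" .
      have "(LINT \<omega>|M. \<bar>measure (law (\<theta> n \<omega>)) A - measure (P (T \<omega>)) A\<bar>) =
          enn2real (\<integral>\<^sup>+\<omega>. ennreal \<bar>measure (law (\<theta> n \<omega>)) A - measure (P (T \<omega>)) A\<bar> \<partial>M)"
        by (rule integral_eq_nn_integral) auto
      also have "\<dots> \<le> \<bar>L\<bar> * \<delta> n"
        using nn \<open>0 \<le> \<delta> n\<close> by (intro enn2real_leI) auto
      finally show ?thesis .
    qed
    then show "\<forall>\<^sub>F n in sequentially. (LINT \<omega>|M. \<bar>measure (law (\<theta> n \<omega>)) A - measure (P (T \<omega>)) A\<bar>) \<le> \<bar>L\<bar> * \<delta> n"
      by simp
    show "(\<lambda>n. \<bar>L\<bar> * \<delta> n) \<longlonglongrightarrow> 0"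
      using tendsto_mult_left[OF delta_tendsto, of "\<bar>L\<bar>"] by simp
  qed simp
  show ?thesis
    by (rule exI[of _ "\<lambda>\<omega>. P (T \<omega>)"]) (use P T_in meas conv in auto)
qed

lemma integral_law_step:
  assumes B: "B \<in> borel_measurable (G n)" "\<And>\<omega>. \<omega> \<in> space M \<Longrightarrow> \<bar>B \<omega>\<bar> \<le> 1" and A: "A \<in> sets borel"
  shows "(LINT \<omega>|M. B \<omega> * indicator A (X (Suc n) \<omega>)) = (LINT \<omega>|M. B \<omega> * measure (law (\<theta> n \<omega>)) A)"
proof -
  interpret Gn: finite_measure_subalgebra M "G n" using subalgebra_G by unfold_locales
  let ?E = "X (Suc n) -` A \<inter> space M"
  have E [measurable]: "?E \<in> sets M" using X_measurable A by (rule measurable_sets)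
  have [measurable]: "B \<in> borel_measurable M" by (rule measurable_from_subalg[OF subalgebra_G B(1)])
  have [measurable]: "(\<lambda>\<omega>. measure (law (\<theta> n \<omega>)) A) \<in> borel_measurable M"
    by (rule measurable_from_subalg[OF subalgebra_G measure_law_theta_measurable[OF A]])
  have "(LINT \<omega>|M. B \<omega> * indicator A (X (Suc n) \<omega>)) = (LINT \<omega>|M. B \<omega> * indicator ?E \<omega>)"
    by (intro Bochner_Integration.integral_cong) (auto simp: indicator_def)
  also have "\<dots> = (LINT \<omega>|M. B \<omega> * real_cond_exp M (G n) (indicator ?E) \<omega>)"
  proof (rule Gn.real_cond_exp_intg(2)[symmetric, OF _ B(1)])
    show "integrable M (\<lambda>\<omega>. B \<omega> * indicator ?E \<omega>)"
    proof (rule M.integrable_const_bound[where B=1])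
      show "AE \<omega> in M. norm (B \<omega> * indicator ?E \<omega>) \<le> 1"
        using B(2) by (intro AE_I2) (simp add: indicator_def)
    qed measurable
  qed measurable
  also have "\<dots> = (LINT \<omega>|M. B \<omega> * measure (law (\<theta> n \<omega>)) A)"
  proof (rule integral_cong_AE)
    show "AE \<omega> in M. B \<omega> * real_cond_exp M (G n) (indicator ?E) \<omega> = B \<omega> * measure (law (\<theta> n \<omega>)) A"
      using cond_law[OF A, of n] by eventually_elim simp
  qed measurable
  finally show ?thesis .
qed

end

section \<open>Asymptotic exchangeability\<close>

lemma (in prob_space) integral_product_perturbation:
  fixes B f g :: "'a \<Rightarrow> real"
  assumes "B \<in> borel_measurable M" "f \<in> borel_measurable M" "g \<in> borel_measurable M"
    and bounds: "\<And>x. x \<in> space M \<Longrightarrow> \<bar>B x\<bar> \<le> 1" "\<And>x. x \<in> space M \<Longrightarrow> \<bar>f x\<bar> \<le> 1" "\<And>x. x \<in> space M \<Longrightarrow> \<bar>g x\<bar> \<le> 1"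
  shows "\<bar>(LINT x|M. B x * f x) - (LINT x|M. B x * g x)\<bar> \<le> (LINT x|M. \<bar>f x - g x\<bar>)"
proof -
  note [measurable] = assms(1-3)
  have int: "integrable M f" "integrable M g"
    using bounds by (auto intro!: integrable_const_bound[where B=1])
  have intB: "integrable M (\<lambda>x. B x * f x)" "integrable M (\<lambda>x. B x * g x)"
    using bounds by (auto intro!: integrable_const_bound[where B=1] AE_I2 mult_le_one simp: abs_mult)
  have "\<bar>(LINT x|M. B x * f x) - (LINT x|M. B x * g x)\<bar> = \<bar>LINT x|M. B x * f x - B x * g x\<bar>"
    using intB by simp
  also have "\<dots> \<le> (LINT x|M. \<bar>B x * f x - B x * g x\<bar>)"
    by (rule integral_abs_bound)
  also have "\<dots> \<le> (LINT x|M. \<bar>f x - g x\<bar>)"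
  proof (rule integral_mono)
    fix x assume "x \<in> space M"
    then have "\<bar>B x\<bar> * \<bar>f x - g x\<bar> \<le> 1 * \<bar>f x - g x\<bar>" using bounds(1) by (intro mult_right_mono) auto
    then show "\<bar>B x * f x - B x * g x\<bar> \<le> \<bar>f x - g x\<bar>"
      by (simp add: right_diff_distrib[symmetric] abs_mult)
  qed (use int intB in auto)
  finally show ?thesis .
qed

context recursive_sampling
begin

text \<open>
  Induction on the length \<open>k\<close> of the block, removing its last observation. The weight \<open>W\<close> is an \<open>L\<^sup>1\<close> limit
  of weights \<open>w n\<close> known at time \<open>n\<close>; replacing \<open>W\<close> by \<open>w (n + k)\<close> allows conditioning on the past, which
  turns the last indicator into a probability at \<open>\<theta> (n + k)\<close>. This probability times the weight is again a
  weight of the same kind, with limit \<open>V k * W\<close>, to which the induction hypothesis for the shorter block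
  applies.
\<close>
lemma block_converges:
  assumes A: "\<And>i. A i \<in> sets borel"
    and V: "\<And>i. V i \<in> borel_measurable M" "\<And>i \<omega>. \<omega> \<in> space M \<Longrightarrow> V i \<omega> \<in> {0..1}"
      "\<And>i. (\<lambda>n. LINT \<omega>|M. \<bar>measure (law (\<theta> n \<omega>)) (A i) - V i \<omega>\<bar>) \<longlonglongrightarrow> 0"
    and W: "\<And>n. w n \<in> borel_measurable (G n)" "\<And>n \<omega>. \<omega> \<in> space M \<Longrightarrow> w n \<omega> \<in> {0..1}"
      "W \<in> borel_measurable M" "\<And>\<omega>. \<omega> \<in> space M \<Longrightarrow> W \<omega> \<in> {0..1}"
      "(\<lambda>n. LINT \<omega>|M. \<bar>w n \<omega> - W \<omega>\<bar>) \<longlonglongrightarrow> 0"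
  shows "(\<lambda>n. LINT \<omega>|M. (\<Prod>i<k. indicator (A i) (X (Suc (n + i)) \<omega>)) * W \<omega>)
    \<longlonglongrightarrow> (LINT \<omega>|M. (\<Prod>i<k. V i \<omega>) * W \<omega>)"
  using W
proof (induction k arbitrary: w W)
  case (Suc k)
  define F where "F n \<omega> = measure (law (\<theta> n \<omega>)) (A k)" for n \<omega>
  define w' where "w' n \<omega> = F n \<omega> * w n \<omega>" for n \<omega>
  define W' where "W' \<omega> = V k \<omega> * W \<omega>" for \<omega>
  define B where "B n \<omega> = (\<Prod>i<k. indicator (A i) (X (Suc (n + i)) \<omega>) :: real)" for n \<omega>
  define J where "J n \<omega> = (indicator (A k) (X (Suc (n + k)) \<omega>) :: real)" for n \<omega>
  note w = Suc.prems(1,2) and W = Suc.prems(3,4,5)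
  have F: "F n \<in> borel_measurable (G n)" "\<omega> \<in> space M \<Longrightarrow> F n \<omega> \<in> {0..1}" for n \<omega>
    unfolding F_def using measure_law_theta_measurable[OF A] prob_space.prob_le_1[OF prob_P_law[OF theta_in]] by auto
  have w': "w' n \<in> borel_measurable (G n)" "\<omega> \<in> space M \<Longrightarrow> w' n \<omega> \<in> {0..1}" for n \<omega>
    unfolding w'_def using F w by (auto intro!: mult_le_one mult_nonneg_nonneg)
  have W': "W' \<in> borel_measurable M" "\<omega> \<in> space M \<Longrightarrow> W' \<omega> \<in> {0..1}" for \<omega>
    unfolding W'_def using V(1)[of k] V(2)[of _ k] W(1,2) by (auto intro!: mult_le_one mult_nonneg_nonneg)
  have from_G: "f \<in> borel_measurable M" if "f \<in> borel_measurable (G n)" for f :: "'w \<Rightarrow> real" and n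
    by (rule measurable_from_subalg[OF subalgebra_G that])
  have B: "B n \<in> borel_measurable (G (n + k))" "B n \<omega> \<in> {0..1}" for n \<omega>
  proof -
    show "B n \<in> borel_measurable (G (n + k))"
      unfolding B_def using A
      by (intro borel_measurable_prod measurable_compose[OF X_measurable_G borel_measurable_indicator]) auto
    show "B n \<omega> \<in> {0..1}"
      unfolding B_def by (auto intro!: prod_nonneg prod_le_1)
  qed
  have J: "J n \<in> borel_measurable M" "J n \<omega> \<in> {0..1}" for n \<omega>
  proof -
    show "J n \<in> borel_measurable M"
      unfolding J_def using A by (intro measurable_compose[OF X_measurable borel_measurable_indicator])
  qed (simp add: J_def)
  have w'_lim: "(\<lambda>n. LINT \<omega>|M. \<bar>w' n \<omega> - W' \<omega>\<bar>) \<longlonglongrightarrow> 0"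
  proof (rule tendsto_sandwich[OF _ _ tendsto_const])
    have "(LINT \<omega>|M. \<bar>w' n \<omega> - W' \<omega>\<bar>) \<le> (LINT \<omega>|M. \<bar>F n \<omega> - V k \<omega>\<bar>) + (LINT \<omega>|M. \<bar>w n \<omega> - W \<omega>\<bar>)" for n
    proof -
      note [measurable] = from_G[OF F(1)[of n]] from_G[OF w(1)[of n]] from_G[OF w'(1)[of n]] W'(1) W(1) V(1)[of k]
      have le1: "\<bar>a - b\<bar> \<le> 1" if "a \<in> {0..1}" "b \<in> {0..1}" for a b :: real using that by auto
      have int: "integrable M (\<lambda>\<omega>. \<bar>F n \<omega> - V k \<omega>\<bar>)" "integrable M (\<lambda>\<omega>. \<bar>w n \<omega> - W \<omega>\<bar>)"
        "integrable M (\<lambda>\<omega>. \<bar>w' n \<omega> - W' \<omega>\<bar>)"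
        using F(2) V(2) w(2) W(2) w'(2) W'(2)
        by (auto intro!: M.integrable_const_bound[where B=1] AE_I2 le1 simp del: atLeastAtMost_iff)
      have "(LINT \<omega>|M. \<bar>w' n \<omega> - W' \<omega>\<bar>) \<le> (LINT \<omega>|M. \<bar>F n \<omega> - V k \<omega>\<bar> + \<bar>w n \<omega> - W \<omega>\<bar>)"
      proof (rule integral_mono)
        fix \<omega> assume \<omega>: "\<omega> \<in> space M"
        have "w' n \<omega> - W' \<omega> = (F n \<omega> - V k \<omega>) * w n \<omega> + V k \<omega> * (w n \<omega> - W \<omega>)"
          by (simp add: w'_def W'_def algebra_simps)
        then have "\<bar>w' n \<omega> - W' \<omega>\<bar> \<le> \<bar>F n \<omega> - V k \<omega>\<bar> * \<bar>w n \<omega>\<bar> + \<bar>V k \<omega>\<bar> * \<bar>w n \<omega> - W \<omega>\<bar>"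
          by (metis abs_mult abs_triangle_ineq)
        also have "\<dots> \<le> \<bar>F n \<omega> - V k \<omega>\<bar> * 1 + 1 * \<bar>w n \<omega> - W \<omega>\<bar>"
          using w(2)[OF \<omega>, of n] V(2)[OF \<omega>, of k] by (intro add_mono mult_left_mono mult_right_mono) auto
        finally show "\<bar>w' n \<omega> - W' \<omega>\<bar> \<le> \<bar>F n \<omega> - V k \<omega>\<bar> + \<bar>w n \<omega> - W \<omega>\<bar>" by simp
      qed (use int in auto)
      then show ?thesis using int by simp
    qed
    then show "\<forall>\<^sub>F n in sequentially. (LINT \<omega>|M. \<bar>w' n \<omega> - W' \<omega>\<bar>) \<le>
        (LINT \<omega>|M. \<bar>F n \<omega> - V k \<omega>\<bar>) + (LINT \<omega>|M. \<bar>w n \<omega> - W \<omega>\<bar>)" by simp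
    show "(\<lambda>n. (LINT \<omega>|M. \<bar>F n \<omega> - V k \<omega>\<bar>) + (LINT \<omega>|M. \<bar>w n \<omega> - W \<omega>\<bar>)) \<longlonglongrightarrow> 0"
      using tendsto_add[OF V(3)[of k] W(3)] by (simp add: F_def)
  qed simp
  have IH: "(\<lambda>n. LINT \<omega>|M. B n \<omega> * W' \<omega>) \<longlonglongrightarrow> (LINT \<omega>|M. (\<Prod>i<k. V i \<omega>) * W' \<omega>)"
    unfolding B_def using w' W' w'_lim by (intro Suc.IH[of w' W']) auto
  have diff: "\<bar>(LINT \<omega>|M. (B n \<omega> * J n \<omega>) * W \<omega>) - (LINT \<omega>|M. B n \<omega> * W' \<omega>)\<bar> \<le>
      (LINT \<omega>|M. \<bar>w (n + k) \<omega> - W \<omega>\<bar>) + (LINT \<omega>|M. \<bar>w' (n + k) \<omega> - W' \<omega>\<bar>)" for n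
  proof -
    have abs1: "\<bar>a\<bar> \<le> 1" if "a \<in> {0..1}" for a :: real using that by auto
    have mult01: "a * b \<in> {0..1}" if "a \<in> {0..1}" "b \<in> {0..1}" for a b :: real
      using that by (auto intro!: mult_le_one)
    note [measurable] = from_G[OF B(1)[of n]] J(1)[of n] from_G[OF w(1)[of "n + k"]]
      from_G[OF w'(1)[of "n + k"]] W'(1) W(1)
    have "\<bar>(LINT \<omega>|M. (B n \<omega> * J n \<omega>) * W \<omega>) - (LINT \<omega>|M. (B n \<omega> * J n \<omega>) * w (n + k) \<omega>)\<bar>
        \<le> (LINT \<omega>|M. \<bar>W \<omega> - w (n + k) \<omega>\<bar>)"
      using B(2) J(2) W(2) w(2)
      by (intro M.integral_product_perturbation abs1 mult01) measurable
    moreover have "(LINT \<omega>|M. (B n \<omega> * J n \<omega>) * w (n + k) \<omega>) = (LINT \<omega>|M. B n \<omega> * w' (n + k) \<omega>)"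
    proof -
      have "(LINT \<omega>|M. (B n \<omega> * w (n + k) \<omega>) * J n \<omega>) = (LINT \<omega>|M. (B n \<omega> * w (n + k) \<omega>) * F (n + k) \<omega>)"
        unfolding J_def F_def using B w
        by (intro integral_law_step borel_measurable_times A abs1 mult01) auto
      then show ?thesis by (simp add: w'_def mult_ac)
    qed
    moreover have "\<bar>(LINT \<omega>|M. B n \<omega> * w' (n + k) \<omega>) - (LINT \<omega>|M. B n \<omega> * W' \<omega>)\<bar>
        \<le> (LINT \<omega>|M. \<bar>w' (n + k) \<omega> - W' \<omega>\<bar>)"
      using B(2) W'(2) w'(2)
      by (intro M.integral_product_perturbation abs1) measurable
    moreover have "(LINT \<omega>|M. \<bar>W \<omega> - w (n + k) \<omega>\<bar>) = (LINT \<omega>|M. \<bar>w (n + k) \<omega> - W \<omega>\<bar>)"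
      by (simp add: abs_minus_commute)
    ultimately show ?thesis by linarith
  qed
  have "(\<lambda>n. (LINT \<omega>|M. (B n \<omega> * J n \<omega>) * W \<omega>) - (LINT \<omega>|M. B n \<omega> * W' \<omega>)) \<longlonglongrightarrow> 0"
  proof (rule Lim_null_comparison)
    show "\<forall>\<^sub>F n in sequentially. norm ((LINT \<omega>|M. (B n \<omega> * J n \<omega>) * W \<omega>) - (LINT \<omega>|M. B n \<omega> * W' \<omega>)) \<le>
      (LINT \<omega>|M. \<bar>w (n + k) \<omega> - W \<omega>\<bar>) + (LINT \<omega>|M. \<bar>w' (n + k) \<omega> - W' \<omega>\<bar>)"
      using diff by simp
    show "(\<lambda>n. (LINT \<omega>|M. \<bar>w (n + k) \<omega> - W \<omega>\<bar>) + (LINT \<omega>|M. \<bar>w' (n + k) \<omega> - W' \<omega>\<bar>)) \<longlonglongrightarrow> 0"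
      using tendsto_add[OF LIMSEQ_ignore_initial_segment[OF W(3), of k] LIMSEQ_ignore_initial_segment[OF w'_lim, of k]]
      by simp
  qed
  from tendsto_add[OF this IH] show ?case
    by (simp add: B_def J_def W'_def mult_ac)
qed simp

text \<open>
  The limit is the mixture of i.i.d. sequences directed by the limit kernel. The paths are shifted by
  one throughout, because \<open>X 0\<close> need not be measurable.
\<close>
theorem asymptotically_exchangeable_sampling: "asymptotically_exchangeable M X"
proof -
  obtain Q where Q: "\<And>\<omega>. \<omega> \<in> space M \<Longrightarrow> prob_space (Q \<omega>)"
    "\<And>\<omega>. \<omega> \<in> space M \<Longrightarrow> sets (Q \<omega>) = sets borel"
    "\<And>A. A \<in> sets borel \<Longrightarrow> (\<lambda>\<omega>. measure (Q \<omega>) A) \<in> borel_measurable M"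
    "\<And>A. A \<in> sets borel \<Longrightarrow> (\<lambda>n. LINT \<omega>|M. \<bar>measure (law (\<theta> n \<omega>)) A - measure (Q \<omega>) A\<bar>) \<longlonglongrightarrow> 0"
    using limit_kernel by blast
  have emeasure_Q: "emeasure (Q \<omega>) A = ennreal (measure (Q \<omega>) A)" if "\<omega> \<in> space M" for \<omega> A
    using finite_measure.emeasure_eq_measure[OF prob_space.finite_measure[OF Q(1)[OF that]]] .
  have "(\<lambda>\<omega>. emeasure (Q \<omega>) A) \<in> borel_measurable M" if "A \<in> sets borel" for A
  proof -
    have "(\<lambda>\<omega>. ennreal (measure (Q \<omega>) A)) \<in> borel_measurable M" using Q(3)[OF that] by measurable
    from iffD2[OF measurable_cong[OF emeasure_Q] this] show ?thesis .
  qed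
  from mixture_of_iid[OF M.prob_space_axioms Q(1,2) this]
  obtain N :: "(nat \<Rightarrow> 'a) measure" where N: "prob_space N" "sets N = sets borel"
    and formula: "\<And>J A. finite J \<Longrightarrow> (\<And>i. i \<in> J \<Longrightarrow> A i \<in> sets borel) \<Longrightarrow>
      emeasure N {x. \<forall>i\<in>J. x i \<in> A i} = (\<integral>\<^sup>+\<omega>. (\<Prod>i\<in>J. emeasure (Q \<omega>) (A i)) \<partial>M)"
    by auto
  define path where "path n \<omega> = (\<lambda>k. X (n + k) \<omega>)" for n \<omega>
  have path_meas: "path (Suc n) \<in> borel_measurable M" for n
    unfolding path_def using X_measurable[of "n + _"]
    by (intro measurable_coordinatewise_then_product) simp
  define L where "L n = distr M borel (path (Suc n))" for n
  have L: "prob_space (L n)" "sets (L n) = sets borel" for n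
    unfolding L_def using path_meas by (auto intro: M.prob_space_distr)
  have "converges_weakly L N"
  proof (rule converges_weakly_of_cylinders[OF L(1) N(1) L(2) N(2)])
    fix k and A :: "nat \<Rightarrow> 'a set" assume A: "\<And>i. A i \<in> sets borel"
    let ?S = "{x. \<forall>i\<in>{..<k}. x i \<in> A i}"
    have S: "?S \<in> sets borel"
      unfolding prod_emb_UNIV_borel[symmetric] sets_PiM_equal_borel[symmetric]
      using A by (intro sets_PiM_I) auto
    have V01: "measure (Q \<omega>) B \<in> {0..1}" if "\<omega> \<in> space M" for \<omega> B
      using prob_space.prob_le_1[OF Q(1)[OF that]] by simp
    have "measure (L n) ?S = (LINT \<omega>|M. (\<Prod>i<k. indicator (A i) (X (Suc (n + i)) \<omega>)) * 1)" for n
    proof -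
      have "measure (L n) ?S = (LINT \<omega>|M. indicator (path (Suc n) -` ?S \<inter> space M) \<omega>)"
        unfolding L_def using S path_meas measurable_sets[OF path_meas S] by (subst measure_distr) auto
      also have "\<dots> = (LINT \<omega>|M. (\<Prod>i<k. indicator (A i) (X (Suc (n + i)) \<omega>)) * 1)"
        by (intro Bochner_Integration.integral_cong refl)
           (auto simp: path_def indicator_def prod.neutral prod_zero_iff)
      finally show ?thesis .
    qed
    moreover have "measure N ?S = (LINT \<omega>|M. (\<Prod>i<k. measure (Q \<omega>) (A i)) * 1)"
    proof -
      have "emeasure N ?S = (\<integral>\<^sup>+\<omega>. ennreal (\<Prod>i<k. measure (Q \<omega>) (A i)) \<partial>M)"
        using A by (subst formula) (auto intro!: nn_integral_cong simp: emeasure_Q prod_ennreal)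
      then show ?thesis
        unfolding measure_def[of N] using A Q(3)
        by (subst integral_eq_nn_integral) (auto intro!: prod_nonneg borel_measurable_prod)
    qed
    moreover have "(\<lambda>n. LINT \<omega>|M. (\<Prod>i<k. indicator (A i) (X (Suc (n + i)) \<omega>)) * 1)
        \<longlonglongrightarrow> (LINT \<omega>|M. (\<Prod>i<k. measure (Q \<omega>) (A i)) * 1)"
      using A Q(3,4) V01 by (intro block_converges[where w="\<lambda>_ _. 1"]) auto
    ultimately show "(\<lambda>n. measure (L n) {x. \<forall>i<k. x i \<in> A i}) \<longlonglongrightarrow> measure N {x. \<forall>i<k. x i \<in> A i}"
      by (simp add: Ball_def)
  qed
  moreover have "distr N borel (\<lambda>x k. x k) = N"
    using N(2) by (simp add: distr_id2)
  ultimately have "converges_weakly (\<lambda>n. distr M borel (path n)) (distr N borel (\<lambda>x k. x k))"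
    unfolding converges_weakly_def L_def by (auto intro: LIMSEQ_imp_Suc)
  moreover have "exchangeable N (\<lambda>k x. x k)"
    using exchangeable_of_product_formula[OF N formula] .
  moreover have "(\<lambda>x. x k) \<in> borel_measurable N" for k :: nat
    using N(2) by (simp cong: measurable_cong_sets)
  ultimately show ?thesis
    unfolding asymptotically_exchangeable_def path_def using N(1)
    by (intro exI[of _ N] exI[of _ "\<lambda>k x. x k"]) auto
qed

end

section \<open>Sigma-finiteness of the reference measure and conclusion\<close>

lemma reference_measure_sigma_finite:
  assumes "reference_measure \<mu>"
  shows "sigma_finite_measure \<mu>" "sets \<mu> = sets borel"
proof -
  consider "\<mu> = lborel" | S where "countable S" "\<mu> = distr (count_space S) borel (\<lambda>x. x)"
    using assms by (auto simp: reference_measure_def)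
  then have "sigma_finite_measure \<mu> \<and> sets \<mu> = sets borel"
  proof cases
    case 1
    then show ?thesis by (simp add: lborel.sigma_finite_measure_axioms)
  next
    case 2
    have id: "(\<lambda>x. x) \<in> count_space S \<rightarrow>\<^sub>M borel" by simp
    have "sigma_finite_measure \<mu>"
    proof
      show "\<exists>A. countable A \<and> A \<subseteq> sets \<mu> \<and> \<Union>A = space \<mu> \<and> (\<forall>a\<in>A. emeasure \<mu> a \<noteq> \<infinity>)"
      proof (intro exI[of _ "insert (- S) ((\<lambda>x. {x}) ` S)"] conjI ballI)
        have S: "S \<in> sets borel" using 2(1) by (rule sets.countable[rotated]) simp
        then show "insert (- S) ((\<lambda>x. {x}) ` S) \<subseteq> sets \<mu>" by (auto simp: 2(2))
        fix a assume "a \<in> insert (- S) ((\<lambda>x. {x}) ` S)"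
        then have a: "a \<in> sets borel" "finite (a \<inter> S)" using S by auto
        then show "emeasure \<mu> a \<noteq> \<infinity>"
          unfolding 2(2) by (subst emeasure_distr[OF id]) (auto simp: emeasure_count_space_finite)
      qed (use 2 in auto)
    qed
    then show ?thesis by (simp add: 2(2))
  qed
  then show "sigma_finite_measure \<mu>" "sets \<mu> = sets borel" by auto
qed

theorem proposition1:
  fixes M :: "'w measure"
    and X :: "nat \<Rightarrow> 'w \<Rightarrow> 'a::euclidean_space"
    and \<mu> :: "'a measure"
    and p :: "'a \<Rightarrow> real \<Rightarrow> real"
    and \<Theta> :: "real set"
    and \<eta> :: "nat \<Rightarrow> real"
    and \<theta>0 C \<epsilon> :: real
  assumes "prob_space M"
    and "reference_measure \<mu>"
    and "open \<Theta>" and "is_interval \<Theta>"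
    and "parametric_family \<mu> p \<Theta>"
    and "recursively_sampled M \<mu> p \<Theta> \<eta> \<theta>0 X"
    and "\<eta> \<longlonglongrightarrow> 0"
    and a: "\<And>x \<theta>. \<theta> \<in> \<Theta> \<Longrightarrow> p x differentiable (at \<theta>) \<and> deriv (p x) differentiable (at \<theta>)"
    and b: "continuous_on \<Theta> (fisher \<mu> p)"
      "\<epsilon> > 0"
      "\<And>\<theta>. \<theta> \<in> \<Theta> \<Longrightarrow> integrable (P_law \<mu> p \<theta>) (\<lambda>x. (score p x \<theta>)\<^sup>2) \<and> \<epsilon> < fisher \<mu> p \<theta>"
    and c: "uniformly_integrable M
        (\<lambda>n \<omega>. score_step \<mu> p (X n \<omega>) (theta_hat \<mu> p \<eta> \<theta>0 X (n - 1) \<omega>)) {1..}"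
    and d: "\<And>\<theta>. \<theta> \<in> \<Theta> \<Longrightarrow> integrable \<mu> (\<lambda>x. deriv (deriv (p x)) \<theta>)"
      "\<And>\<theta> A. \<theta> \<in> \<Theta> \<Longrightarrow> A \<in> sets borel \<Longrightarrow> (LINT x:A|\<mu>. deriv (deriv (p x)) \<theta>) < C"
    and "summable (\<lambda>n. (\<eta> (n + 1))\<^sup>2)"
  defines "\<xi> \<equiv> \<lambda>n \<omega>. C * ((\<eta> (n + 1))\<^sup>2 / (2 * fisher \<mu> p (theta_hat \<mu> p \<eta> \<theta>0 X n \<omega>)))"
  shows "acid M (natural_filtration M X) \<xi> X
    \<and> (AE \<omega> in M. summable (\<lambda>n. \<xi> n \<omega>))
    \<and> asymptotically_exchangeable M X"
proof -
  interpret M: prob_space M by fact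
  interpret S: recursive_sampling \<mu> p \<Theta> C \<epsilon> M \<eta> \<theta>0 X
    using assms reference_measure_sigma_finite[OF assms(2)]
    by unfold_locales (auto simp: sigma_finite_measure_def)
  have "\<xi> = S.\<xi>" by (intro ext) (simp add: \<xi>_def S.\<xi>_def)
  then show ?thesis
    using S.acid_sampling S.xi_summable S.asymptotically_exchangeable_sampling by auto
qed

end
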